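(* Let $\Omega\subset\mathbb{R}^N$ ($N\ge1$) be a bounded domain with smooth boundary. Assume that $a,f,g:[0,+\infty)\to\mathbb{R}$ are continuous functions, that $f,g\in L^\infty([0,+\infty))$, and that for some constant $a_0>0$ $$\inf_{t\in[0,+\infty)}a(t)\ge a_0,\qquad \inf_{t\in[0,+\infty)}f(t)\ge a_0,\qquad \inf_{t\in[0,+\infty)}g(t)\ge a_0 .$$ Let $p,q,r,\beta\in[1,+\infty)$ and $\alpha\in[0,1)$. Then the nonlocal problem $$\begin{cases}-a\bigl(\int_\Omega|u|^q\,dx\bigr)\Delta u=f\bigl(\int_\Omega|u|^p\,dx\bigr)u^\alpha-g\bigl(\int_\Omega|u|^r\,dx\bigr)u^\beta & \text{in }\Omega,\\ u(x)>0 & \text{in }\Omega,\\ u=0 & \text{on }\partial\Omega,\end{cases}$$ has a (weak) solution.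
   Context: A (weak) solution of the problem is a function $u\in H_0^1(\Omega)\cap L^\infty(\Omega)$ with $u>0$ a.e. in $\Omega$ such that $$a\Bigl(\int_\Omega|u|^q\,dx\Bigr)\int_\Omega\nabla u\cdot\nabla\phi\,dx=f\Bigl(\int_\Omega|u|^p\,dx\Bigr)\int_\Omega u^\alpha\phi\,dx-g\Bigl(\int_\Omega|u|^r\,dx\Bigr)\int_\Omega u^\beta\phi\,dx$$ for all $\phi\in H_0^1(\Omega)$. *)

theory Defs
  imports "HOL-Analysis.Analysis"
begin

section \<open>Smooth functions and domains with smooth boundary\<close>

primrec C_diff :: "nat \<Rightarrow> ('a::euclidean_space \<Rightarrow> real) \<Rightarrow> bool" where
  "C_diff 0 f \<longleftrightarrow> continuous_on UNIV f"
| "C_diff (Suc k) f \<longleftrightarrow> (\<forall>x. f differentiable (at x)) \<and>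
     (\<forall>b\<in>Basis. C_diff k (\<lambda>x. frechet_derivative f (at x) b))"

definition smooth :: "('a::euclidean_space \<Rightarrow> real) \<Rightarrow> bool" where
  "smooth f \<longleftrightarrow> (\<forall>k. C_diff k f)"

definition grad :: "('a::euclidean_space \<Rightarrow> real) \<Rightarrow> 'a \<Rightarrow> 'a" where
  "grad f x = (\<Sum>b\<in>Basis. frechet_derivative f (at x) b *\<^sub>R b)"

text \<open>Near every boundary point the domain is, after a rotation of the coordinates, the
  part of a ball lying above the graph of a smooth function. The unit vector \<open>e\<close> is the
  vertical direction, and the invariance of \<open>\<gamma>\<close> along \<open>e\<close> says that \<open>\<gamma>\<close> is a function of
  the remaining \<open>N - 1\<close> coordinates only (a constant if \<open>N = 1\<close>).\<close>

definition smooth_boundary :: "'a::euclidean_space set \<Rightarrow> bool" where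
  "smooth_boundary \<Omega> \<longleftrightarrow>
     (\<forall>z\<in>frontier \<Omega>. \<exists>\<rho>>0. \<exists>e \<gamma>. norm e = 1 \<and> smooth \<gamma> \<and>
        (\<forall>x t. \<gamma> (x + t *\<^sub>R e) = \<gamma> x) \<and>
        \<Omega> \<inter> ball z \<rho> = {x \<in> ball z \<rho>. \<gamma> x < x \<bullet> e})"

section \<open>Lebesgue and Sobolev spaces\<close>

text \<open>Elements of these spaces are represented by functions on the whole type; only their
  values almost everywhere on the set \<open>\<Omega>\<close> matter.\<close>

definition L2 :: "'a::euclidean_space set \<Rightarrow> ('a \<Rightarrow> 'b::euclidean_space) set" where
  "L2 \<Omega> = {u \<in> borel_measurable (lebesgue_on \<Omega>).
     integrable (lebesgue_on \<Omega>) (\<lambda>x. (norm (u x))\<^sup>2)}"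

definition Linf :: "'a::euclidean_space set \<Rightarrow> ('a \<Rightarrow> real) set" where
  "Linf \<Omega> = {u \<in> borel_measurable (lebesgue_on \<Omega>).
     \<exists>C. AE x in lebesgue_on \<Omega>. \<bar>u x\<bar> \<le> C}"

definition L1_loc :: "'a::euclidean_space set \<Rightarrow> ('a \<Rightarrow> 'b::euclidean_space) set" where
  "L1_loc \<Omega> = {u. \<forall>K. compact K \<and> K \<subseteq> \<Omega> \<longrightarrow> u absolutely_integrable_on K}"

definition test_functions :: "'a::euclidean_space set \<Rightarrow> ('a \<Rightarrow> real) set" where
  "test_functions \<Omega> = {\<phi>. smooth \<phi> \<and> compact (closure {x. \<phi> x \<noteq> 0}) \<and>
     closure {x. \<phi> x \<noteq> 0} \<subseteq> \<Omega>}"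

definition has_weak_gradient ::
    "'a::euclidean_space set \<Rightarrow> ('a \<Rightarrow> real) \<Rightarrow> ('a \<Rightarrow> 'a) \<Rightarrow> bool" where
  "has_weak_gradient \<Omega> u G \<longleftrightarrow> u \<in> L1_loc \<Omega> \<and> G \<in> L1_loc \<Omega> \<and>
     (\<forall>\<phi>\<in>test_functions \<Omega>.
        (LINT x|lebesgue_on \<Omega>. u x *\<^sub>R grad \<phi> x) = - (LINT x|lebesgue_on \<Omega>. \<phi> x *\<^sub>R G x))"

text \<open>A weak gradient is determined only almost everywhere; one representative is chosen.\<close>

definition weak_gradient :: "'a::euclidean_space set \<Rightarrow> ('a \<Rightarrow> real) \<Rightarrow> 'a \<Rightarrow> 'a" where
  "weak_gradient \<Omega> u = (SOME G. has_weak_gradient \<Omega> u G)"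

definition H1 :: "'a::euclidean_space set \<Rightarrow> ('a \<Rightarrow> real) set" where
  "H1 \<Omega> = {u \<in> L2 \<Omega>. \<exists>G\<in>L2 \<Omega>. has_weak_gradient \<Omega> u G}"

definition H1_norm :: "'a::euclidean_space set \<Rightarrow> ('a \<Rightarrow> real) \<Rightarrow> real" where
  "H1_norm \<Omega> u = sqrt ((LINT x|lebesgue_on \<Omega>. (u x)\<^sup>2) +
     (LINT x|lebesgue_on \<Omega>. (norm (weak_gradient \<Omega> u x))\<^sup>2))"

text \<open>The closure of the test functions in \<open>H1 \<Omega>\<close>.\<close>

definition H10 :: "'a::euclidean_space set \<Rightarrow> ('a \<Rightarrow> real) set" where
  "H10 \<Omega> = {u \<in> H1 \<Omega>. \<exists>\<phi>. (\<forall>n::nat. \<phi> n \<in> test_functions \<Omega>) \<and>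
     (\<lambda>n. H1_norm \<Omega> (\<lambda>x. u x - \<phi> n x)) \<longlonglongrightarrow> 0}"

section \<open>The nonlocal problem\<close>

definition weak_solution ::
    "'a::euclidean_space set \<Rightarrow> (real \<Rightarrow> real) \<Rightarrow> (real \<Rightarrow> real) \<Rightarrow> (real \<Rightarrow> real) \<Rightarrow>
     real \<Rightarrow> real \<Rightarrow> real \<Rightarrow> real \<Rightarrow> real \<Rightarrow> ('a \<Rightarrow> real) \<Rightarrow> bool" where
  "weak_solution \<Omega> a f g p q r \<alpha> \<beta> u \<longleftrightarrow>
     u \<in> H10 \<Omega> \<and> u \<in> Linf \<Omega> \<and> (AE x in lebesgue_on \<Omega>. 0 < u x) \<and>
     (\<forall>\<phi>\<in>H10 \<Omega>.
        a (LINT x|lebesgue_on \<Omega>. \<bar>u x\<bar> powr q) *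
          (LINT x|lebesgue_on \<Omega>. weak_gradient \<Omega> u x \<bullet> weak_gradient \<Omega> \<phi> x)
        = f (LINT x|lebesgue_on \<Omega>. \<bar>u x\<bar> powr p) * (LINT x|lebesgue_on \<Omega>. u x powr \<alpha> * \<phi> x)
        - g (LINT x|lebesgue_on \<Omega>. \<bar>u x\<bar> powr r) * (LINT x|lebesgue_on \<Omega>. u x powr \<beta> * \<phi> x))"

end

theory Submission
  imports Defs
begin

text \<open>
  The values \<open>a (\<integral>|u|\<^sup>q)\<close>, \<open>f (\<integral>|u|\<^sup>p)\<close> and \<open>g (\<integral>|u|\<^sup>r)\<close> are three numbers \<open>A, F, G\<close>.
  Once they are frozen, the problem becomes the local equation \<open>- A \<Delta>u = F u\<^sup>\<alpha> - G u\<^sup>\<beta>\<close>. This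
  equation is shown to have a positive solution \<open>u\<close> that depends continuously on \<open>(A, F, G)\<close> and
  is bounded by a constant which does not involve \<open>A\<close>. Sending \<open>(A, F, G)\<close> to the three numbers
  computed from \<open>u\<close> is then a continuous map of a box in \<open>\<real>\<^sup>3\<close> to itself, and a fixed point,
  supplied by Brouwer's theorem, is a solution of the nonlocal problem.

  The frozen equation is the Euler-Lagrange equation of
  \<open>J(u) = A/2 \<integral>|\<nabla>u|\<^sup>2 + \<integral>(G |u|\<^sup>\<beta>\<^sup>+\<^sup>1 / (\<beta>+1) - F |u|\<^sup>\<alpha>\<^sup>+\<^sup>1 / (\<alpha>+1))\<close>. Because
  \<open>\<alpha> < 1 \<le> \<beta>\<close>, this functional, although not convex in \<open>u\<close>, is convex as a functional of \<open>u\<^sup>2\<close>,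
  and uniformly so on functions with a common bound (\<open>potential_hidden_convexity\<close>,
  \<open>min_energy_le_quadratic_mean\<close>). Hence two almost minimizers are close in \<open>L\<^sup>1\<close>
  (\<open>excess_controls_L1\<close>), and then, by the parallelogram identity for the quadratic part, their
  gradients are close in \<open>L\<^sup>2\<close> (\<open>excess_controls_gradients\<close>). So minimizing sequences converge
  strongly in \<open>H\<^sup>1\<close>, and since the estimate is uniform in \<open>F, G\<close> and in \<open>A \<ge> a\<^sub>0\<close>, minimizers depend
  continuously on the coefficients (\<open>minimizers_depend_continuously\<close>).

  All comparison arguments are carried out on test functions, with the absolute value, the
  truncation at a constant and the maximum of two functions replaced by smooth approximations
  whose error tends to zero. Truncation (\<open>truncation\<close>) gives the bound on \<open>u\<close>: beyond the level \<open>M\<close>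
  the absorption term \<open>G s\<^sup>\<beta>\<close> exceeds the source \<open>F s\<^sup>\<alpha>\<close>. Comparison with a small multiple of a bump
  function \<open>w\<close> such that \<open>- \<Delta>w \<le> K w\<close> gives positivity (\<open>minimizer_positive\<close>): near zero
  the sublinear source dominates every linear term. As \<open>u > 0\<close> almost everywhere, \<open>J\<close> is
  differentiable at \<open>u\<close> in every direction even when \<open>\<alpha> = 0\<close>, and the vanishing of its derivative
  is the weak formulation (\<open>euler_lagrange_H10\<close>).

  The gradient in the weak formulation is an arbitrarily chosen weak gradient, so the argument
  also rests on the fact that weak gradients are unique almost everywhere
  (\<open>weak_gradient_unique\<close>).
\<close>

section \<open>Calculus of smooth functions\<close>

lemma grad_eqI:
  fixes f :: "'a::euclidean_space \<Rightarrow> real"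
  assumes "GDERIV f x :> D"
  shows "grad f x = D"
proof -
  have "frechet_derivative f (at x) = (\<lambda>h. h \<bullet> D)"
    using assms frechet_derivative_at unfolding gderiv_def by metis
  then show ?thesis
    by (simp add: grad_def inner_commute[of _ D] euclidean_representation)
qed

lemma grad_inner_Basis:
  fixes f :: "'a::euclidean_space \<Rightarrow> real"
  assumes "b \<in> Basis"
  shows "grad f x \<bullet> b = frechet_derivative f (at x) b"
  using assms by (simp add: grad_def inner_sum_left inner_Basis if_distrib cong: if_cong)

lemma GDERIV_grad:
  fixes f :: "'a::euclidean_space \<Rightarrow> real"
  assumes "f differentiable (at x)"
  shows "GDERIV f x :> grad f x"
proof -
  let ?L = "frechet_derivative f (at x)"
  have d: "(f has_derivative ?L) (at x)"
    using assms frechet_derivative_works by blast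
  then have lin: "linear ?L" by (rule has_derivative_linear)
  have "?L h = h \<bullet> grad f x" for h
  proof -
    have "?L h = ?L (\<Sum>b\<in>Basis. (h \<bullet> b) *\<^sub>R b)" by (simp add: euclidean_representation)
    also have "\<dots> = (\<Sum>b\<in>Basis. (h \<bullet> b) * ?L b)"
      using lin by (simp add: linear_sum linear_scale)
    also have "\<dots> = h \<bullet> grad f x"
      by (simp add: grad_def inner_sum_right mult.commute)
    finally show ?thesis .
  qed
  then have "?L = (\<lambda>h. h \<bullet> grad f x)" by (rule ext)
  then show ?thesis using d unfolding gderiv_def by metis
qed

text \<open>
  The vector \<open>grad f x\<close> is a genuine gradient as soon as \<open>f\<close> is differentiable, so smoothness can be
  handled through the calculus of \<open>GDERIV\<close> instead of Frechet derivatives of coordinates.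
\<close>

lemma C_diff_Suc_iff:
  "C_diff (Suc k) f \<longleftrightarrow> (\<forall>x. GDERIV f x :> grad f x) \<and> (\<forall>b\<in>Basis. C_diff k (\<lambda>x. grad f x \<bullet> b))"
proof -
  have "f differentiable (at x) \<longleftrightarrow> GDERIV f x :> grad f x" for x
    using GDERIV_grad unfolding gderiv_def differentiable_def by blast
  then show ?thesis by (simp add: grad_inner_Basis)
qed

lemma C_diff_SucI:
  fixes f :: "'a::euclidean_space \<Rightarrow> real"
  assumes "\<And>x. GDERIV f x :> D x" "\<And>b. b \<in> Basis \<Longrightarrow> C_diff k (\<lambda>x. D x \<bullet> b)"
  shows "C_diff (Suc k) f"
proof -
  have "grad f = D" using assms(1) grad_eqI by blast
  then show ?thesis using assms by (simp add: C_diff_Suc_iff del: C_diff.simps)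
qed

lemma GDERIV_continuous: "GDERIV f x :> D \<Longrightarrow> isCont f x"
  unfolding gderiv_def by (rule has_derivative_continuous)

lemma C_diff_lower: "C_diff (Suc k) f \<Longrightarrow> C_diff k f"
proof (induction k arbitrary: f)
  case 0
  then have "\<forall>x. GDERIV f x :> grad f x" by (simp add: C_diff_Suc_iff del: C_diff.simps)
  then show ?case by (auto simp: continuous_on_eq_continuous_at intro: GDERIV_continuous)
next
  case (Suc k)
  then show ?case by (auto simp: C_diff_Suc_iff simp del: C_diff.simps)
qed

lemma C_diff_SucD:
  assumes "C_diff (Suc k) f"
  shows "GDERIV f x :> grad f x" "b \<in> Basis \<Longrightarrow> C_diff k (\<lambda>x. grad f x \<bullet> b)" "C_diff k f"
  using assms C_diff_lower unfolding C_diff_Suc_iff by blast+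

lemma smooth_GDERIV: "smooth f \<Longrightarrow> GDERIV f x :> grad f x"
  unfolding smooth_def using C_diff_Suc_iff by blast

lemma smooth_continuous: "smooth f \<Longrightarrow> continuous_on UNIV f"
  unfolding smooth_def using C_diff.simps(1) by blast

lemma smooth_grad_component: "smooth f \<Longrightarrow> b \<in> Basis \<Longrightarrow> smooth (\<lambda>x. grad f x \<bullet> b)"
  unfolding smooth_def using C_diff_Suc_iff by blast

lemma smooth_grad_continuous:
  fixes f :: "'a::euclidean_space \<Rightarrow> real"
  assumes "smooth f"
  shows "continuous_on UNIV (grad f)"
proof -
  have "continuous_on UNIV (\<lambda>x. \<Sum>b\<in>Basis. (grad f x \<bullet> b) *\<^sub>R b)"
    using smooth_continuous[OF smooth_grad_component[OF assms]]
    by (intro continuous_on_sum continuous_on_scaleR continuous_on_const) blast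
  then show ?thesis by (simp add: euclidean_representation)
qed

lemma C_diff_const: "C_diff k (\<lambda>x::'a::euclidean_space. c)"
proof (induction k arbitrary: c)
  case (Suc k)
  show ?case by (rule C_diff_SucI[where D = "\<lambda>_. 0"]) (auto simp: GDERIV_const Suc)
qed simp

lemma C_diff_inner: "C_diff k (\<lambda>x::'a::euclidean_space. x \<bullet> w)"
proof (cases k)
  case (Suc j)
  have "GDERIV (\<lambda>x. x \<bullet> w) x :> w" for x :: 'a
    unfolding gderiv_def by (auto intro!: derivative_eq_intros)
  then show ?thesis unfolding Suc by (rule C_diff_SucI) (simp add: C_diff_const)
qed (auto intro!: continuous_intros)

lemma C_diff_add:
  assumes "C_diff k f" "C_diff k g"
  shows "C_diff k (\<lambda>x. f x + g x)"
  using assms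
proof (induction k arbitrary: f g)
  case 0 then show ?case by (simp add: continuous_on_add)
next
  case (Suc k)
  show ?case
    by (rule C_diff_SucI[where D = "\<lambda>x. grad f x + grad g x"])
       (use Suc in \<open>auto simp: C_diff_Suc_iff inner_add_left simp del: C_diff.simps intro!: GDERIV_add\<close>)
qed

lemma C_diff_mult:
  assumes "C_diff k f" "C_diff k g"
  shows "C_diff k (\<lambda>x. f x * g x)"
  using assms
proof (induction k arbitrary: f g)
  case 0 then show ?case by (simp add: continuous_on_mult)
next
  case (Suc k)
  show ?case
  proof (rule C_diff_SucI[where D = "\<lambda>x. f x *\<^sub>R grad g x + g x *\<^sub>R grad f x"])
    show "GDERIV (\<lambda>x. f x * g x) x :> f x *\<^sub>R grad g x + g x *\<^sub>R grad f x" for x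
      by (intro GDERIV_mult C_diff_SucD(1)[OF Suc.prems(1)] C_diff_SucD(1)[OF Suc.prems(2)])
    show "C_diff k (\<lambda>x. (f x *\<^sub>R grad g x + g x *\<^sub>R grad f x) \<bullet> b)" if "b \<in> Basis" for b
      unfolding inner_add_left inner_scaleR_left
      by (intro C_diff_add Suc.IH C_diff_SucD(2,3)[OF Suc.prems(1)] C_diff_SucD(2,3)[OF Suc.prems(2)] that)
  qed
qed

text \<open>
  The derivative of \<open>f powr c\<close> is again built from such a power, with exponent \<open>c - 1\<close>; quantifying
  over all exponents makes the induction close. Square roots are the case of interest.
\<close>

lemma C_diff_powr:
  fixes f :: "'a::euclidean_space \<Rightarrow> real"
  assumes "C_diff k f" "\<And>x. f x > 0"
  shows "C_diff k (\<lambda>x. f x powr c)"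
  using assms(1)
proof (induction k arbitrary: c)
  case 0 then show ?case
    using assms(2) by (auto intro!: continuous_on_powr simp: less_imp_neq[THEN not_sym])
next
  case (Suc k)
  show ?case
  proof (rule C_diff_SucI[where D = "\<lambda>x. (c * f x powr (c - 1)) *\<^sub>R grad f x"])
    show "GDERIV (\<lambda>x. f x powr c) x :> (c * f x powr (c - 1)) *\<^sub>R grad f x" for x
      by (intro GDERIV_DERIV_compose[where f = f and g = "\<lambda>t. t powr c"]
            C_diff_SucD[OF Suc.prems] has_real_derivative_powr assms(2))
    show "C_diff k (\<lambda>x. ((c * f x powr (c - 1)) *\<^sub>R grad f x) \<bullet> b)" if "b \<in> Basis" for b
      unfolding inner_scaleR_left
      by (intro C_diff_mult C_diff_const Suc.IH C_diff_SucD[OF Suc.prems] that)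
  qed
qed

lemma smooth_const: "smooth (\<lambda>x. c)"
  and smooth_inner: "smooth (\<lambda>x. x \<bullet> w)"
  by (simp_all add: smooth_def C_diff_const C_diff_inner)

lemma smooth_add: "smooth f \<Longrightarrow> smooth g \<Longrightarrow> smooth (\<lambda>x. f x + g x)"
  and smooth_mult: "smooth f \<Longrightarrow> smooth g \<Longrightarrow> smooth (\<lambda>x. f x * g x)"
  by (simp_all add: smooth_def C_diff_add C_diff_mult)

lemma smooth_diff: "smooth f \<Longrightarrow> smooth g \<Longrightarrow> smooth (\<lambda>x. f x - g x)"
  using smooth_add[of f "\<lambda>x. (-1) * g x"] smooth_mult[OF smooth_const[of "-1"], of g] by simp

lemma smooth_power2: "smooth f \<Longrightarrow> smooth (\<lambda>x. (f x)\<^sup>2)"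
  by (simp add: power2_eq_square smooth_mult)

lemma smooth_sqrt:
  assumes "smooth f" "\<And>x. f x > 0"
  shows "smooth (\<lambda>x. sqrt (f x))"
proof -
  have "(\<lambda>x. sqrt (f x)) = (\<lambda>x. f x powr (1/2))"
    using assms(2) by (simp add: powr_half_sqrt less_imp_le)
  then show ?thesis using assms by (simp add: smooth_def C_diff_powr)
qed

lemma smooth_prod:
  "finite I \<Longrightarrow> (\<And>i. i \<in> I \<Longrightarrow> smooth (f i)) \<Longrightarrow> smooth (\<lambda>x. \<Prod>i\<in>I. f i x)"
  by (induction I rule: finite_induct) (simp_all add: smooth_const smooth_mult)

lemma smooth_sum:
  "finite I \<Longrightarrow> (\<And>i. i \<in> I \<Longrightarrow> smooth (f i)) \<Longrightarrow> smooth (\<lambda>x. \<Sum>i\<in>I. f i x)"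
  by (induction I rule: finite_induct) (simp_all add: smooth_const smooth_add)

text \<open>
  The function \<open>exp (-1/t)\<close> is the source of all compactly supported smooth functions below. Its
  derivatives are linear combinations of the functions \<open>exp (-1/t) / t ^ n\<close>, which is why the whole
  family is treated at once.
\<close>

definition flat_exp :: "nat \<Rightarrow> real \<Rightarrow> real" where
  "flat_exp n t = (if t > 0 then exp (- (1 / t)) / t ^ n else 0)"

lemma flat_exp_nonneg: "0 \<le> flat_exp n t"
  by (simp add: flat_exp_def)

text \<open>
  At \<open>0\<close> the difference quotient from the right is \<open>y ^ (n + 1) / exp y\<close> with \<open>y = 1 / h\<close>, which
  tends to \<open>0\<close> because the exponential outgrows powers.
\<close>

lemma flat_exp_has_derivative:
  "(flat_exp n has_real_derivative flat_exp (n + 2) t - real n * flat_exp (n + 1) t) (at t)"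
proof -
  consider "t > 0" | "t < 0" | "t = 0" by linarith
  then show ?thesis
  proof cases
    case 1
    have "((\<lambda>s. exp (- (1 / s)) / s ^ n) has_real_derivative
       flat_exp (n + 2) t - real n * flat_exp (n + 1) t) (at t)"
      using 1
      apply (auto intro!: derivative_eq_intros simp: flat_exp_def)
      apply (cases n)
      apply (simp_all add: field_simps power2_eq_square)
      done
    moreover have "\<forall>\<^sub>F s in nhds t. s > 0"
      using 1 by (intro eventually_nhds_in_open[of "{0<..}", simplified]) auto
    then have "\<forall>\<^sub>F s in nhds t. exp (- (1 / s)) / s ^ n = flat_exp n s"
      by eventually_elim (simp add: flat_exp_def)
    ultimately show ?thesis
      by (subst DERIV_cong_ev[OF refl _ refl, symmetric]) auto
  next
    case 2
    have "\<forall>\<^sub>F s in nhds t. s < 0"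
      using 2 by (intro eventually_nhds_in_open[of "{..<0}", simplified]) auto
    then have "\<forall>\<^sub>F s in nhds t. 0 = flat_exp n s"
      by eventually_elim (simp add: flat_exp_def)
    then have "(flat_exp n has_real_derivative 0) (at t)"
      using DERIV_cong_ev[OF refl, of "\<lambda>_. 0" "flat_exp n" t 0 0] by simp
    then show ?thesis using 2 by (simp add: flat_exp_def)
  next
    case 3
    have "((\<lambda>h. flat_exp n h / h) \<longlongrightarrow> 0) (at_right 0)"
    proof -
      have "((\<lambda>y::real. y ^ (n + 1) / exp y) \<longlongrightarrow> 0) at_top"
        by (rule tendsto_power_div_exp_0)
      then have "((\<lambda>h::real. (inverse h) ^ (n + 1) / exp (inverse h)) \<longlongrightarrow> 0) (at_right 0)"
        by (rule filterlim_compose[OF _ filterlim_inverse_at_top_right])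
      then show ?thesis
      proof (rule Lim_transform_eventually)
        show "\<forall>\<^sub>F h::real in at_right 0. inverse h ^ (n + 1) / exp (inverse h) = flat_exp n h / h"
          unfolding eventually_at_right_field
          by (intro exI[of _ 1]) (auto simp: flat_exp_def exp_minus field_simps power_inverse)
      qed
    qed
    moreover have "((\<lambda>h. flat_exp n h / h) \<longlongrightarrow> 0) (at_left 0)"
    proof (rule Lim_transform_eventually[OF tendsto_const])
      show "\<forall>\<^sub>F h::real in at_left 0. 0 = flat_exp n h / h"
        unfolding eventually_at_left_field by (intro exI[of _ "-1"]) (auto simp: flat_exp_def)
    qed
    ultimately have "((\<lambda>h. flat_exp n h / h) \<longlongrightarrow> 0) (at 0)"
      by (simp add: filterlim_split_at)
    then show ?thesis using 3 by (simp add: DERIV_def flat_exp_def)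
  qed
qed

lemma C_diff_flat_exp:
  fixes f :: "'a::euclidean_space \<Rightarrow> real"
  assumes "C_diff k f"
  shows "C_diff k (\<lambda>x. flat_exp n (f x))"
  using assms
proof (induction k arbitrary: n)
  case 0
  have "continuous_on UNIV (flat_exp n)"
    using flat_exp_has_derivative DERIV_isCont by (blast intro: continuous_at_imp_continuous_on)
  then show ?case using 0 by (auto intro: continuous_on_compose2)
next
  case (Suc k)
  show ?case
  proof (rule C_diff_SucI[where
        D = "\<lambda>x. (flat_exp (n + 2) (f x) - real n * flat_exp (n + 1) (f x)) *\<^sub>R grad f x"])
    show "GDERIV (\<lambda>x. flat_exp n (f x)) x :>
        (flat_exp (n + 2) (f x) - real n * flat_exp (n + 1) (f x)) *\<^sub>R grad f x" for x
      by (intro GDERIV_DERIV_compose[where f = f] flat_exp_has_derivative C_diff_SucD[OF Suc.prems])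
    have "C_diff k (\<lambda>x. (flat_exp (n + 2) (f x) + (- real n) * flat_exp (n + 1) (f x)) * (grad f x \<bullet> b))"
      if "b \<in> Basis" for b
      by (intro C_diff_mult C_diff_add C_diff_const Suc.IH C_diff_SucD[OF Suc.prems] that)
    then show "C_diff k (\<lambda>x. ((flat_exp (n + 2) (f x) - real n * flat_exp (n + 1) (f x)) *\<^sub>R grad f x) \<bullet> b)"
      if "b \<in> Basis" for b
      using that by simp
  qed
qed

lemma smooth_flat_exp: "smooth f \<Longrightarrow> smooth (\<lambda>x. flat_exp n (f x))"
  by (simp add: smooth_def C_diff_flat_exp)

section \<open>Test functions\<close>

lemma test_functionsI:
  assumes "smooth \<phi>" "compact K" "K \<subseteq> \<Omega>" "\<And>x. x \<notin> K \<Longrightarrow> \<phi> x = 0"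
  shows "\<phi> \<in> test_functions \<Omega>"
proof -
  have "closure {x. \<phi> x \<noteq> 0} \<subseteq> K"
    using assms by (intro closure_minimal compact_imp_closed) auto
  then have "closure {x. \<phi> x \<noteq> 0} = K \<inter> closure {x. \<phi> x \<noteq> 0}" by blast
  then have "compact (closure {x. \<phi> x \<noteq> 0})"
    using compact_Int_closed[OF assms(2) closed_closure] by metis
  with \<open>closure {x. \<phi> x \<noteq> 0} \<subseteq> K\<close> show ?thesis
    using assms(1,3) unfolding test_functions_def by blast
qed

text \<open>
  A test function vanishes on a neighbourhood of every point outside its support, so its gradient
  has the same compact support.
\<close>

lemma test_functionsE:
  assumes "\<phi> \<in> test_functions \<Omega>"
  obtains K where "smooth \<phi>" "compact K" "K \<subseteq> \<Omega>" "\<And>x. x \<notin> K \<Longrightarrow> \<phi> x = 0" "\<And>x. x \<notin> K \<Longrightarrow> grad \<phi> x = 0"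
proof -
  let ?K = "closure {x. \<phi> x \<noteq> 0}"
  have K: "smooth \<phi>" "compact ?K" "?K \<subseteq> \<Omega>" using assms by (auto simp: test_functions_def)
  have z: "\<phi> x = 0" if "x \<notin> ?K" for x
    using that closure_subset[of "{x. \<phi> x \<noteq> 0}"] by blast
  have "grad \<phi> x = 0" if "x \<notin> ?K" for x
  proof (rule grad_eqI)
    have op: "open (- ?K)" by auto
    have "((\<lambda>x. 0) has_derivative (\<lambda>h. h \<bullet> 0)) (at x)" by simp
    then show "GDERIV \<phi> x :> 0"
      unfolding gderiv_def
    proof (rule has_derivative_transform_within_open)
      show "open (- ?K)" by (rule op)
      show "x \<in> - ?K" using that by simp
      show "0 = \<phi> y" if "y \<in> - ?K" for y using z[of y] that by simp
    qed
  qed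
  with K z show ?thesis by (rule that)
qed

text \<open>
  Every nonlinear construction below combines two test functions smoothly and maps \<open>(0, 0)\<close> to \<open>0\<close>;
  this is all that is needed to obtain a test function again.
\<close>

lemma test_functions_compose2:
  assumes "\<phi> \<in> test_functions \<Omega>" "\<psi> \<in> test_functions \<Omega>" "smooth \<zeta>"
    "\<And>x. \<phi> x = 0 \<Longrightarrow> \<psi> x = 0 \<Longrightarrow> \<zeta> x = 0"
  shows "\<zeta> \<in> test_functions \<Omega>"
proof -
  obtain K where K: "compact K" "K \<subseteq> \<Omega>" "\<And>x. x \<notin> K \<Longrightarrow> \<phi> x = 0"
    using assms(1) by (rule test_functionsE) (rule that)
  obtain L where L: "compact L" "L \<subseteq> \<Omega>" "\<And>x. x \<notin> L \<Longrightarrow> \<psi> x = 0"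
    using assms(2) by (rule test_functionsE) (rule that)
  show ?thesis
    by (rule test_functionsI[of _ "K \<union> L"]) (use K L assms in auto)
qed

lemma test_smooth: "\<phi> \<in> test_functions \<Omega> \<Longrightarrow> smooth \<phi>"
  by (simp add: test_functions_def)

lemma test_zero: "(\<lambda>x. 0) \<in> test_functions \<Omega>"
  by (rule test_functionsI[of _ "{}"]) (auto simp: smooth_const)

lemma test_mult: "\<phi> \<in> test_functions \<Omega> \<Longrightarrow> \<psi> \<in> test_functions \<Omega> \<Longrightarrow> (\<lambda>x. \<phi> x * \<psi> x) \<in> test_functions \<Omega>"
  by (rule test_functions_compose2[of \<phi> _ \<psi>]) (auto intro: smooth_mult test_smooth)

lemma test_scale: "\<phi> \<in> test_functions \<Omega> \<Longrightarrow> (\<lambda>x. c * \<phi> x) \<in> test_functions \<Omega>"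
  by (rule test_functions_compose2[of \<phi> _ \<phi>]) (auto intro: smooth_mult smooth_const test_smooth)

lemma test_add: "\<phi> \<in> test_functions \<Omega> \<Longrightarrow> \<psi> \<in> test_functions \<Omega> \<Longrightarrow> (\<lambda>x. \<phi> x + \<psi> x) \<in> test_functions \<Omega>"
  by (rule test_functions_compose2[of \<phi> _ \<psi>]) (auto intro: smooth_add test_smooth)

lemma grad_add: "smooth f \<Longrightarrow> smooth g \<Longrightarrow> grad (\<lambda>x. f x + g x) x = grad f x + grad g x"
  by (intro grad_eqI GDERIV_add smooth_GDERIV)

lemma grad_scale: "smooth f \<Longrightarrow> grad (\<lambda>x. c * f x) x = c *\<^sub>R grad f x"
  using GDERIV_mult[OF GDERIV_const smooth_GDERIV, of f c x] by (intro grad_eqI) simp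

lemma grad_mult: "smooth f \<Longrightarrow> smooth g \<Longrightarrow> grad (\<lambda>x. f x * g x) x = f x *\<^sub>R grad g x + g x *\<^sub>R grad f x"
  by (intro grad_eqI GDERIV_mult smooth_GDERIV)

lemma grad_compose:
  "smooth f \<Longrightarrow> (h has_real_derivative h') (at (f x)) \<Longrightarrow> grad (\<lambda>x. h (f x)) x = h' *\<^sub>R grad f x"
  by (intro grad_eqI GDERIV_DERIV_compose smooth_GDERIV)

lemma test_grad_component:
  assumes "\<phi> \<in> test_functions \<Omega>" "b \<in> Basis"
  shows "(\<lambda>x. grad \<phi> x \<bullet> b) \<in> test_functions \<Omega>"
proof -
  obtain K where K: "smooth \<phi>" "compact K" "K \<subseteq> \<Omega>" "\<And>x. x \<notin> K \<Longrightarrow> grad \<phi> x = 0"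
    using assms(1) by (rule test_functionsE) (rule that)
  show ?thesis
    by (rule test_functionsI[of _ K]) (use K assms in \<open>auto simp: smooth_grad_component\<close>)
qed

section \<open>Integration by parts\<close>

lemma lebesgue_on_eq_lborel_integral:
  fixes f :: "'a::euclidean_space \<Rightarrow> 'b::euclidean_space"
  assumes "\<Omega> \<in> sets lebesgue" "f \<in> borel_measurable borel" "\<And>x. x \<notin> \<Omega> \<Longrightarrow> f x = 0"
  shows "(LINT x|lebesgue_on \<Omega>. f x) = (LINT x|lborel. f x)"
proof -
  have "(LINT x|lebesgue_on \<Omega>. f x) = (LINT x|lebesgue. indicator \<Omega> x *\<^sub>R f x)"
    using assms(1) by (intro integral_restrict_space) simp
  also have "(\<lambda>x. indicator \<Omega> x *\<^sub>R f x) = f"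
    using assms(3) by (auto simp: fun_eq_iff indicator_def)
  also have "(LINT x|lebesgue. f x) = (LINT x|lborel. f x)"
    using assms(2) by (intro integral_completion) simp
  finally show ?thesis .
qed

lemma compact_support_integrable:
  fixes f :: "'a::euclidean_space \<Rightarrow> 'b::euclidean_space"
  assumes "continuous_on UNIV f" "compact K" "\<And>x. x \<notin> K \<Longrightarrow> f x = 0"
  shows "integrable lborel f"
proof -
  have "integrable lborel (\<lambda>x. indicator K x *\<^sub>R f x)"
    using assms(2) continuous_on_subset[OF assms(1) subset_UNIV] by (intro borel_integrable_compact)
  also have "(\<lambda>x. indicator K x *\<^sub>R f x) = f"
    using assms(3) by (auto simp: fun_eq_iff indicator_def)
  finally show ?thesis .
qed

lemma compact_support_bounded:
  fixes f :: "'a::euclidean_space \<Rightarrow> 'b::euclidean_space"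
  assumes "continuous_on UNIV f" "compact K" "\<And>x. x \<notin> K \<Longrightarrow> f x = 0"
  obtains C where "C > 0" "\<And>x. norm (f x) \<le> C"
proof -
  have "compact (f ` K)"
    using assms(2) continuous_on_subset[OF assms(1) subset_UNIV] by (intro compact_continuous_image)
  then obtain C where C: "C > 0" "\<forall>y\<in>f ` K. norm y \<le> C"
    using compact_imp_bounded bounded_pos by metis
  have "norm (f x) \<le> C" for x
    using C assms(3)[of x] by (cases "x \<in> K") auto
  with C(1) show ?thesis by (rule that)
qed

text \<open>
  By translation invariance of Lebesgue measure the difference quotients of \<open>h\<close> in the direction \<open>b\<close>
  have integral zero. They converge to the directional derivative and are dominated by a constant on
  a fixed ball.
\<close>

lemma integral_grad_compact_support:
  fixes h :: "'a::euclidean_space \<Rightarrow> real"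
  assumes h: "smooth h" and K: "compact K" "\<And>x. x \<notin> K \<Longrightarrow> h x = 0" "\<And>x. x \<notin> K \<Longrightarrow> grad h x = 0"
  shows "(LINT x|lborel. grad h x) = 0"
proof (rule euclidean_eqI)
  fix b :: 'a assume "b \<in> Basis"
  define s where "s n = inverse (real (Suc n))" for n
  have s: "0 < s n" "s n \<le> 1" for n by (auto simp: s_def field_simps)
  have s0: "s \<longlonglongrightarrow> 0" unfolding s_def by (rule LIMSEQ_inverse_real_of_nat)
  define F where "F n x = (h (x + s n *\<^sub>R b) - h x) / s n" for n x
  have cont: "continuous_on UNIV h" using h by (rule smooth_continuous)
  note gcont = smooth_grad_continuous[OF h]
  have [measurable]: "h \<in> borel_measurable borel" "grad h \<in> borel_measurable borel"
    using cont gcont borel_measurable_continuous_onI by auto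
  have inth: "integrable lborel h" by (rule compact_support_integrable[OF cont K(1,2)])
  have shift: "integrable lborel (\<lambda>x. h (x + c))" "(LINT x|lborel. h (x + c)) = (LINT x|lborel. h x)" for c
  proof -
    have "integrable (distr lborel borel ((+) c)) h" using inth by (simp add: lborel_distr_plus)
    then show "integrable lborel (\<lambda>x. h (x + c))"
      by (subst (asm) integrable_distr_eq) (auto simp: add.commute)
    have "(LINT x|lborel. h x) = (LINT x|distr lborel borel ((+) c). h x)" by (simp add: lborel_distr_plus)
    also have "\<dots> = (LINT x|lborel. h (x + c))" by (subst integral_distr) (auto simp: add.commute)
    finally show "(LINT x|lborel. h (x + c)) = (LINT x|lborel. h x)" by simp
  qed
  have F0: "(LINT x|lborel. F n x) = 0" for n
    unfolding F_def using shift[of "s n *\<^sub>R b"] inth by simp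
  obtain C where C: "C > 0" "\<And>x. norm (grad h x) \<le> C"
    using compact_support_bounded[OF gcont K(1,3)] by blast
  obtain R where R: "R > 0" "\<forall>x\<in>K. norm x \<le> R"
    using K(1) compact_imp_bounded bounded_pos by metis
  let ?w = "\<lambda>x. indicator (cball 0 (R + norm b)) x *\<^sub>R (C * norm b)"
  \<comment> \<open>Outside the ball of radius \<open>R + norm b\<close> both evaluation points of the quotient leave \<open>K\<close>.\<close>
  have bound: "norm (F n x) \<le> ?w x" for n x
  proof (cases "norm x \<le> R + norm b")
    case True
    have "norm (h (x + s n *\<^sub>R b) - h x) \<le> C * norm ((x + s n *\<^sub>R b) - x)"
    proof (rule differentiable_bound[of UNIV])
      show "(h has_derivative (\<lambda>v. v \<bullet> grad h y)) (at y within UNIV)" for y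
        using smooth_GDERIV[OF h] by (simp add: gderiv_def)
      show "onorm (\<lambda>v. v \<bullet> grad h y) \<le> C" for y
      proof (rule onorm_le)
        show "norm (v \<bullet> grad h y) \<le> C * norm v" for v
        proof -
          have "norm (v \<bullet> grad h y) \<le> norm v * norm (grad h y)"
            using Cauchy_Schwarz_ineq2 by simp
          also have "\<dots> \<le> norm v * C" using C(2) by (intro mult_left_mono) auto
          finally show ?thesis by (simp add: mult.commute)
        qed
      qed
    qed auto
    then have "\<bar>h (x + s n *\<^sub>R b) - h x\<bar> \<le> C * norm b * s n" using s(1)[of n] by (simp add: mult_ac)
    then have "norm (F n x) \<le> C * norm b" using s(1)[of n] by (simp add: F_def field_simps)
    with True show ?thesis by (simp add: indicator_def)
  next
    case False
    have "norm (s n *\<^sub>R b) \<le> norm b" using s[of n] mult_right_mono[OF s(2), of "norm b"] by auto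
    with False have "norm (x + s n *\<^sub>R b) > R"
      using norm_triangle_ineq4[of "x + s n *\<^sub>R b" "s n *\<^sub>R b"] by auto
    moreover have "norm x > R" using False norm_ge_zero[of b] by linarith
    ultimately have "x + s n *\<^sub>R b \<notin> K" "x \<notin> K" using R(2) by fastforce+
    then show ?thesis using C by (simp add: F_def K indicator_def)
  qed
  have lim: "(\<lambda>n. F n x) \<longlonglongrightarrow> grad h x \<bullet> b" for x
  proof -
    have "((\<lambda>t. h (x + t *\<^sub>R b)) has_real_derivative (grad h x \<bullet> b)) (at 0)"
    proof -
      have 1: "((\<lambda>t. x + t *\<^sub>R b) has_derivative (\<lambda>t. t *\<^sub>R b)) (at 0)"
        by (auto intro!: derivative_eq_intros)
      have 2: "(h has_derivative (\<lambda>v. v \<bullet> grad h x)) (at (x + 0 *\<^sub>R b))"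
        using smooth_GDERIV[OF h, of x] by (simp add: gderiv_def)
      have "((\<lambda>t. h (x + t *\<^sub>R b)) has_derivative (\<lambda>t. (t *\<^sub>R b) \<bullet> grad h x)) (at 0)"
        using has_derivative_compose[OF 1 2] .
      then show ?thesis
        by (simp add: has_field_derivative_def inner_commute mult.commute[of _ "_ \<bullet> _"])
    qed
    then have "((\<lambda>t. (h (x + t *\<^sub>R b) - h x) / t) \<longlongrightarrow> grad h x \<bullet> b) (at 0)"
      by (simp add: DERIV_def)
    moreover have "filterlim s (at 0) sequentially"
      using s0 s(1) by (auto simp: filterlim_at less_imp_neq[THEN not_sym])
    ultimately show ?thesis unfolding F_def by (rule filterlim_compose)
  qed
  have "(\<lambda>n. LINT x|lborel. F n x) \<longlonglongrightarrow> (LINT x|lborel. grad h x \<bullet> b)"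
  proof (rule integral_dominated_convergence[where w = ?w])
    show "integrable lborel ?w" by (intro borel_integrable_compact continuous_intros) auto
    show "F n \<in> borel_measurable lborel" for n unfolding F_def by measurable
  qed (use bound lim in auto)
  then have "(LINT x|lborel. grad h x \<bullet> b) = 0"
    by (simp add: F0 LIMSEQ_const_iff)
  moreover have "integrable lborel (grad h)" by (rule compact_support_integrable[OF gcont K(1,3)])
  ultimately show "(LINT x|lborel. grad h x) \<bullet> b = 0 \<bullet> b" by simp
qed

lemma integral_grad_test:
  assumes "\<Omega> \<in> sets lebesgue" "h \<in> test_functions \<Omega>"
  shows "(LINT x|lebesgue_on \<Omega>. grad h x) = 0"
proof -
  obtain K where K: "smooth h" "compact K" "K \<subseteq> \<Omega>" "\<And>x. x \<notin> K \<Longrightarrow> h x = 0" "\<And>x. x \<notin> K \<Longrightarrow> grad h x = 0"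
    using assms(2) by (rule test_functionsE) (rule that)
  have "(LINT x|lebesgue_on \<Omega>. grad h x) = (LINT x|lborel. grad h x)"
    using K assms(1) by (intro lebesgue_on_eq_lborel_integral)
       (auto intro: borel_measurable_continuous_onI smooth_grad_continuous)
  also have "\<dots> = 0" by (rule integral_grad_compact_support[OF K(1,2,4,5)])
  finally show ?thesis .
qed

lemma compact_support_integrable_on:
  fixes f :: "'a::euclidean_space \<Rightarrow> 'b::euclidean_space"
  assumes "\<Omega> \<in> sets lebesgue" "continuous_on UNIV f" "compact K" "\<And>x. x \<notin> K \<Longrightarrow> f x = 0"
  shows "integrable (lebesgue_on \<Omega>) f"
proof -
  have "integrable lebesgue f"
    using compact_support_integrable[OF assms(2-4)] borel_measurable_continuous_onI[OF assms(2)]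
    by (simp add: integrable_completion)
  then show ?thesis using assms(1) by (simp add: integrable_restrict_space integrable_mult_indicator)
qed

lemma test_bounded:
  assumes "\<phi> \<in> test_functions \<Omega>"
  obtains C where "C > 0" "\<And>x. \<bar>\<phi> x\<bar> \<le> C" "\<And>x. norm (grad \<phi> x) \<le> C"
proof -
  obtain K where K: "smooth \<phi>" "compact K" "K \<subseteq> \<Omega>" "\<And>x. x \<notin> K \<Longrightarrow> \<phi> x = 0" "\<And>x. x \<notin> K \<Longrightarrow> grad \<phi> x = 0"
    using assms by (rule test_functionsE) (rule that)
  obtain C where C: "C > 0" "\<And>x. norm (\<phi> x) \<le> C"
    using compact_support_bounded[OF smooth_continuous[OF K(1)] K(2,4)] by blast
  obtain D where D: "D > 0" "\<And>x. norm (grad \<phi> x) \<le> D"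
    using compact_support_bounded[OF smooth_grad_continuous[OF K(1)] K(2,5)] by blast
  show ?thesis
  proof (rule that[of "C + D"])
    show "\<bar>\<phi> x\<bar> \<le> C + D" "norm (grad \<phi> x) \<le> C + D" for x
      using C(2)[of x] D(2)[of x] C(1) D(1) by auto
  qed (use C D in auto)
qed

text \<open>
  The product \<open>\<phi> \<psi>\<close> is a test function, so the integral of its gradient vanishes.
\<close>

lemma integration_by_parts:
  assumes \<Omega>: "\<Omega> \<in> sets lebesgue" and "\<phi> \<in> test_functions \<Omega>" "\<psi> \<in> test_functions \<Omega>"
  shows "(LINT x|lebesgue_on \<Omega>. \<phi> x *\<^sub>R grad \<psi> x) = - (LINT x|lebesgue_on \<Omega>. \<psi> x *\<^sub>R grad \<phi> x)"
proof -
  obtain K where K: "smooth \<phi>" "compact K" "K \<subseteq> \<Omega>" "\<And>x. x \<notin> K \<Longrightarrow> \<phi> x = 0" "\<And>x. x \<notin> K \<Longrightarrow> grad \<phi> x = 0"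
    using assms(2) by (rule test_functionsE) (rule that)
  have sm: "smooth \<psi>" using assms(3) by (rule test_smooth)
  note c = smooth_continuous[OF K(1)] smooth_continuous[OF sm] smooth_grad_continuous[OF K(1)] smooth_grad_continuous[OF sm]
  have i: "integrable (lebesgue_on \<Omega>) (\<lambda>x. \<phi> x *\<^sub>R grad \<psi> x)" "integrable (lebesgue_on \<Omega>) (\<lambda>x. \<psi> x *\<^sub>R grad \<phi> x)"
    by (rule compact_support_integrable_on[OF \<Omega> _ K(2)], use c K in \<open>auto intro: continuous_on_scaleR\<close>)+
  have "0 = (LINT x|lebesgue_on \<Omega>. grad (\<lambda>x. \<phi> x * \<psi> x) x)"
    using integral_grad_test[OF \<Omega> test_mult[OF assms(2,3)]] by simp
  also have "\<dots> = (LINT x|lebesgue_on \<Omega>. \<phi> x *\<^sub>R grad \<psi> x + \<psi> x *\<^sub>R grad \<phi> x)"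
    using K(1) sm by (simp add: grad_mult)
  also have "\<dots> = (LINT x|lebesgue_on \<Omega>. \<phi> x *\<^sub>R grad \<psi> x) + (LINT x|lebesgue_on \<Omega>. \<psi> x *\<^sub>R grad \<phi> x)"
    using i by simp
  finally show ?thesis by (simp add: eq_neg_iff_add_eq_0)
qed

section \<open>Uniqueness of weak gradients\<close>

lemma smooth_affine: "smooth (\<lambda>x::'a::euclidean_space. c * (x \<bullet> w) + d)"
  by (intro smooth_add smooth_mult smooth_const smooth_inner)

text \<open>
  The factors \<open>exp (-1 / ((n + 1) s))\<close> tend to \<open>1\<close> at every positive distance \<open>s\<close> from a face of the
  box, so these bumps converge to the indicator function of the open box.
\<close>

definition box_bump :: "'a::euclidean_space \<Rightarrow> 'a \<Rightarrow> nat \<Rightarrow> 'a \<Rightarrow> real" where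
  "box_bump a b n x = (\<Prod>i\<in>Basis. flat_exp 0 (real (Suc n) * (x \<bullet> i) + - real (Suc n) * (a \<bullet> i)) *
     flat_exp 0 (- real (Suc n) * (x \<bullet> i) + real (Suc n) * (b \<bullet> i)))"

lemma smooth_box_bump: "smooth (box_bump a b n)"
  unfolding box_bump_def[abs_def]
  by (intro smooth_prod smooth_mult smooth_flat_exp smooth_affine finite_Basis)

lemma flat_exp_0_le_1: "flat_exp 0 t \<le> 1"
  by (auto simp: flat_exp_def)

lemma box_bump_bounds: "0 \<le> box_bump a b n x" "box_bump a b n x \<le> 1"
  unfolding box_bump_def
  by (auto intro!: prod_nonneg prod_le_1 mult_le_one simp: flat_exp_nonneg flat_exp_0_le_1)

lemma box_bump_outside:
  assumes "x \<notin> box a b"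
  shows "box_bump a b n x = 0"
proof -
  obtain i where i: "i \<in> Basis" "x \<bullet> i \<le> a \<bullet> i \<or> b \<bullet> i \<le> x \<bullet> i"
    using assms by (auto simp: mem_box not_less)
  from i(2) have "flat_exp 0 (real (Suc n) * (x \<bullet> i) + - real (Suc n) * (a \<bullet> i)) *
     flat_exp 0 (- real (Suc n) * (x \<bullet> i) + real (Suc n) * (b \<bullet> i)) = 0"
  proof
    assume "x \<bullet> i \<le> a \<bullet> i"
    then have "real (Suc n) * (x \<bullet> i) \<le> real (Suc n) * (a \<bullet> i)" by (intro mult_left_mono) auto
    then have "flat_exp 0 (real (Suc n) * (x \<bullet> i) + - real (Suc n) * (a \<bullet> i)) = 0"
      by (simp add: flat_exp_def algebra_simps)
    then show ?thesis by simp
  next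
    assume "b \<bullet> i \<le> x \<bullet> i"
    then have "real (Suc n) * (b \<bullet> i) \<le> real (Suc n) * (x \<bullet> i)" by (intro mult_left_mono) auto
    then have "flat_exp 0 (- real (Suc n) * (x \<bullet> i) + real (Suc n) * (b \<bullet> i)) = 0"
      by (simp add: flat_exp_def algebra_simps)
    then show ?thesis by simp
  qed
  with i(1) show ?thesis unfolding box_bump_def by (intro prod_zero) auto
qed

lemma box_bump_tendsto: "(\<lambda>n. box_bump a b n x) \<longlonglongrightarrow> indicator (box a b) x"
proof (cases "x \<in> box a b")
  case True
  have *: "(\<lambda>n. flat_exp 0 (real (Suc n) * t)) \<longlonglongrightarrow> 1" if "t > 0" for t
  proof -
    have "(\<lambda>n. exp (- (inverse (real (Suc n)) * inverse t))) \<longlonglongrightarrow> exp (- (0 * inverse t))"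
      by (intro tendsto_intros LIMSEQ_inverse_real_of_nat)
    moreover have "flat_exp 0 (real (Suc n) * t) = exp (- (inverse (real (Suc n)) * inverse t))" for n
      using mult_pos_pos[of "real (Suc n)" t] that
      by (simp add: flat_exp_def divide_inverse del: of_nat_Suc)
    ultimately show ?thesis by simp
  qed
  have "(\<lambda>n. \<Prod>i\<in>Basis. flat_exp 0 (real (Suc n) * (x \<bullet> i - a \<bullet> i)) * flat_exp 0 (real (Suc n) * (b \<bullet> i - x \<bullet> i)))
    \<longlonglongrightarrow> (\<Prod>i\<in>(Basis::'a set). 1 * 1)"
    using True by (intro tendsto_prod tendsto_mult *) (auto simp: mem_box)
  then show ?thesis using True by (simp add: box_bump_def algebra_simps)
next
  case False
  then show ?thesis by (simp add: box_bump_outside)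
qed

lemma test_box_bump:
  assumes "cbox a b \<subseteq> \<Omega>"
  shows "box_bump a b n \<in> test_functions \<Omega>"
  using assms box_subset_cbox[of a b]
  by (intro test_functionsI[OF smooth_box_bump compact_cbox]) (auto intro!: box_bump_outside)

text \<open>
  The boxes form an intersection-stable generator of the Borel sets, so Dynkin's lemma applies; a
  Lebesgue measurable set differs from a Borel set by a null set.
\<close>

lemma set_integral_sets_eq_0:
  fixes H :: "'a::euclidean_space \<Rightarrow> 'b::euclidean_space"
  assumes int: "integrable lebesgue H"
    and box: "\<And>a b. (LINT x:box a b|lebesgue. H x) = 0" and univ: "(LINT x|lebesgue. H x) = 0"
    and A: "A \<in> sets lebesgue"
  shows "(LINT x:A|lebesgue. H x) = 0"
proof -
  have borel: "(LINT x:A|lebesgue. H x) = 0" if "A \<in> sets borel" for A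
  proof -
    have si: "set_integrable lebesgue X H" if "X \<in> sets borel" for X
      unfolding set_integrable_def using that int by (intro integrable_mult_indicator) auto
    let ?E = "range (\<lambda>(a, b). box a b :: 'a set)"
    have E: "sigma_sets UNIV ?E = sets borel" by (subst borel_eq_box) simp
    have "Int_stable ?E" by (auto simp: Int_stable_def box_Int_box)
    moreover have "?E \<subseteq> Pow UNIV" by simp
    moreover have "A \<in> sigma_sets UNIV ?E" using that unfolding E .
    ultimately show ?thesis
    proof (induction rule: sigma_sets_induct_disjoint)
      case (basic B) then show ?case using box by auto
    next
      case empty then show ?case by (simp add: set_lebesgue_integral_def)
    next
      case (compl B)
      then have B: "B \<in> sets borel" unfolding E by simp
      have "(LINT x:UNIV|lebesgue. H x) = (LINT x:B \<union> (UNIV - B)|lebesgue. H x)" by (simp add: Un_Diff_cancel)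
      also have "\<dots> = (LINT x:B|lebesgue. H x) + (LINT x:(UNIV - B)|lebesgue. H x)"
        using B by (intro set_integral_Un si) auto
      finally show ?case using compl univ by (simp add: set_lebesgue_integral_def)
    next
      case (union D)
      then have D: "D i \<in> sets borel" for i unfolding E by auto
      have "(LINT x:(\<Union>i. D i)|lebesgue. H x) = (\<Sum>i. LINT x:D i|lebesgue. H x)"
        using D union(1) by (intro lebesgue_integral_countable_add si) (auto simp: disjoint_family_on_def)
      then show ?case using union by simp
    qed
  qed
  obtain S N N' where S: "A = S \<union> N" "N \<subseteq> N'" "N' \<in> null_sets lborel" "S \<in> sets lborel"
    using A by (auto elim: sets_completionE)
  have "N' \<in> null_sets lebesgue" using S(3) by (simp add: null_sets_completionI)
  then have "AE x in lebesgue. x \<notin> N'" by (rule AE_not_in)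
  then have "(LINT x:A|lebesgue. H x) = (LINT x:S|lebesgue. H x)"
    unfolding set_lebesgue_integral_def using S int A
    by (intro integral_cong_AE borel_measurable_integrable[OF integrable_mult_indicator])
       (auto simp: indicator_def)
  with borel S(4) show ?thesis by simp
qed

lemma sigma_finite_lebesgue: "sigma_finite_measure (lebesgue :: 'a::euclidean_space measure)"
proof
  obtain A :: "'a set set" where A: "countable A" "A \<subseteq> sets lborel" "\<Union>A = space lborel"
      "\<forall>a\<in>A. emeasure lborel a \<noteq> \<infinity>"
    using lborel.sigma_finite_countable by blast
  then have "\<forall>a\<in>A. a \<in> sets lebesgue \<and> emeasure lebesgue a \<noteq> \<infinity>" by auto
  with A show "\<exists>A :: 'a set set. countable A \<and> A \<subseteq> sets lebesgue \<and> \<Union>A = space lebesgue \<and>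
      (\<forall>a\<in>A. emeasure lebesgue a \<noteq> \<infinity>)"
    by (intro exI[of _ A]) auto
qed

text \<open>
  Box bumps turn the hypothesis into the vanishing of the integral of \<open>G\<close> over every box contained
  in a closed box inside \<open>\<Omega>\<close>. Hence \<open>G\<close> vanishes almost everywhere on each such closed box, and
  countably many of them cover \<open>\<Omega>\<close>.
\<close>

lemma fundamental_lemma_calculus_of_variations:
  fixes G :: "'a::euclidean_space \<Rightarrow> 'b::euclidean_space"
  assumes \<Omega>: "open \<Omega>" and G: "G \<in> L1_loc \<Omega>"
    and zero: "\<And>\<phi>. \<phi> \<in> test_functions \<Omega> \<Longrightarrow> (LINT x|lebesgue_on \<Omega>. \<phi> x *\<^sub>R G x) = 0"
  shows "AE x in lebesgue_on \<Omega>. G x = 0"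
proof -
  have \<Omega>s: "\<Omega> \<in> sets lebesgue" using \<Omega> by simp
  have cb: "AE x in lebesgue. x \<in> cbox c d \<longrightarrow> G x = 0" if sub: "cbox c d \<subseteq> \<Omega>" for c d
  proof -
    define H where "H x = indicator (box c d) x *\<^sub>R G x" for x
    have Gi: "set_integrable lebesgue (cbox c d) G"
      using G sub unfolding L1_loc_def by (simp add: compact_cbox)
    have "set_integrable lebesgue (box c d) G"
      by (rule set_integrable_subset[OF Gi]) (auto simp: box_subset_cbox)
    then have Hi: "integrable lebesgue H" unfolding H_def set_integrable_def .
    have bx: "(LINT x:box a b|lebesgue. G x) = 0" if ab: "box a b \<subseteq> box c d" for a b
    proof (cases "box a b = {}")
      case True then show ?thesis by (simp add: set_lebesgue_integral_def)
    next
      case False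
      have "cbox a b \<subseteq> cbox c d"
        using closure_mono[OF ab] False ab by (metis closure_box subset_empty)
      then have ab\<Omega>: "cbox a b \<subseteq> \<Omega>" using sub by blast
      have ind: "box_bump a b n x *\<^sub>R G x = box_bump a b n x *\<^sub>R (indicator (cbox c d) x *\<^sub>R G x)" for n x
        using box_bump_outside[of x a b n] ab box_subset_cbox[of c d] by (auto simp: indicator_def)
      have Gm: "(\<lambda>x. indicator (cbox c d) x *\<^sub>R G x) \<in> borel_measurable lebesgue"
        using Gi unfolding set_integrable_def by auto
      have bm: "box_bump a b n \<in> borel_measurable lebesgue" for n
        using borel_measurable_continuous_onI[OF smooth_continuous[OF smooth_box_bump[of a b n]]] by (intro measurable_completion) simp
      have "(\<lambda>n. LINT x|lebesgue. box_bump a b n x *\<^sub>R G x) \<longlonglongrightarrow> (LINT x|lebesgue. indicator (box a b) x *\<^sub>R G x)"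
      proof (rule integral_dominated_convergence[where w = "\<lambda>x. norm (indicator (cbox c d) x *\<^sub>R G x)"])
        show "integrable lebesgue (\<lambda>x. norm (indicator (cbox c d) x *\<^sub>R G x))"
          using Gi unfolding set_integrable_def by (rule integrable_norm)
        show "(\<lambda>x. box_bump a b n x *\<^sub>R G x) \<in> borel_measurable lebesgue" for n
          unfolding ind by (intro borel_measurable_scaleR Gm bm)
        have "indicator (box a b) x *\<^sub>R G x = indicator (box a b) x *\<^sub>R (indicator (cbox c d) x *\<^sub>R G x)" for x
          using ab box_subset_cbox[of c d] by (auto simp: indicator_def)
        then show "(\<lambda>x. indicator (box a b) x *\<^sub>R G x) \<in> borel_measurable lebesgue"
          by (simp only:) (intro borel_measurable_scaleR Gm borel_measurable_indicator, simp)
        show "AE x in lebesgue. (\<lambda>n. box_bump a b n x *\<^sub>R G x) \<longlonglongrightarrow> indicator (box a b) x *\<^sub>R G x"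
          by (intro AE_I2 tendsto_scaleR box_bump_tendsto tendsto_const)
        show "AE x in lebesgue. norm (box_bump a b n x *\<^sub>R G x) \<le> norm (indicator (cbox c d) x *\<^sub>R G x)" for n
          unfolding ind norm_scaleR[of "box_bump a b n _"]
          using box_bump_bounds[of a b n] by (intro AE_I2 mult_left_le_one_le) auto
      qed
      moreover have "(LINT x|lebesgue. box_bump a b n x *\<^sub>R G x) = 0" for n
      proof -
        have "0 = (LINT x|lebesgue_on \<Omega>. box_bump a b n x *\<^sub>R G x)"
          using zero[OF test_box_bump[OF ab\<Omega>]] by simp
        also have "\<dots> = (LINT x|lebesgue. indicator \<Omega> x *\<^sub>R (box_bump a b n x *\<^sub>R G x))"
          using \<Omega>s by (intro integral_restrict_space) simp
        also have "\<dots> = (LINT x|lebesgue. box_bump a b n x *\<^sub>R G x)"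
          using ab\<Omega> box_subset_cbox[of a b] box_bump_outside[of _ a b n]
          by (intro Bochner_Integration.integral_cong refl) (auto simp: indicator_def)
        finally show ?thesis by simp
      qed
      ultimately have "(LINT x|lebesgue. indicator (box a b) x *\<^sub>R G x) = 0"
        by (simp add: LIMSEQ_const_iff)
      then show ?thesis by (simp add: set_lebesgue_integral_def)
    qed
    have Hbox: "(LINT x:box a b|lebesgue. H x) = 0" for a b
    proof -
      obtain a' b' where "box a b \<inter> box c d = box a' b'" using box_Int_box by blast
      then have "(LINT x:box a b|lebesgue. H x) = (LINT x:box a' b'|lebesgue. G x)"
        unfolding set_lebesgue_integral_def H_def scaleR_scaleR indicator_inter_arith[symmetric] by simp
      also have "\<dots> = 0" using \<open>box a b \<inter> box c d = box a' b'\<close> by (intro bx) blast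
      finally show ?thesis .
    qed
    have Huniv: "(LINT x|lebesgue. H x) = 0"
      using bx[of c d] by (simp add: H_def set_lebesgue_integral_def)
    have "AE x in lebesgue. H x = 0"
      by (rule sigma_finite_measure.density_zero[OF sigma_finite_lebesgue Hi]) (rule set_integral_sets_eq_0[OF Hi Hbox Huniv])
    moreover have "negligible (cbox c d - box c d)" by (rule negligible_frontier_interval)
    then have "AE x in lebesgue. x \<notin> cbox c d - box c d"
      by (intro AE_not_in) (simp add: negligible_iff_null_sets)
    ultimately show ?thesis by eventually_elim (auto simp: H_def)
  qed
  let ?a = "\<lambda>f::'a \<Rightarrow> real \<times> real. \<Sum>i\<in>Basis. fst (f i) *\<^sub>R i"
  let ?b = "\<lambda>f::'a \<Rightarrow> real \<times> real. \<Sum>i\<in>Basis. snd (f i) *\<^sub>R i"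
  let ?I = "{f \<in> Basis \<rightarrow>\<^sub>E \<rat> \<times> \<rat>. cbox (?a f) (?b f) \<subseteq> \<Omega>}"
  have U: "\<Omega> = (\<Union>f\<in>?I. cbox (?a f) (?b f))" using open_UNION_cbox[OF \<Omega>] by simp
  have "countable ?I"
    by (rule countable_subset[of _ "Basis \<rightarrow>\<^sub>E \<rat> \<times> \<rat>"])
       (auto intro!: countable_PiE countable_SIGMA simp: countable_rat)
  moreover have "AE x in lebesgue. x \<in> cbox (?a f) (?b f) \<longrightarrow> G x = 0" if "f \<in> ?I" for f
    using that by (intro cb) auto
  ultimately have "AE x in lebesgue. \<forall>f\<in>?I. x \<in> cbox (?a f) (?b f) \<longrightarrow> G x = 0"
    by (subst AE_ball_countable) auto
  then have "AE x in lebesgue. x \<in> \<Omega> \<longrightarrow> G x = 0"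
    by eventually_elim (subst U, blast)
  then show ?thesis using \<Omega>s by (simp add: AE_restrict_space_iff)
qed

section \<open>Square-integrable functions\<close>

text \<open>
  This inequality and the next one are weighted forms of Young's inequality. With the weight \<open>\<delta>\<close> at
  choice they let smallness in \<open>L\<^sup>2\<close> be transferred to integrals that are linear in the function.
\<close>

lemma abs_le_delta_square:
  fixes t :: real
  assumes "\<delta> > 0"
  shows "\<bar>t\<bar> \<le> \<delta> + t\<^sup>2 / \<delta>"
proof -
  have "0 \<le> (\<bar>t\<bar> - \<delta>)\<^sup>2 + \<delta> * \<bar>t\<bar>" using assms by simp
  then have "\<bar>t\<bar> * \<delta> \<le> (\<delta> + t\<^sup>2 / \<delta>) * \<delta>"
    using assms by (simp add: power2_eq_square algebra_simps abs_mult_self_eq)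
  then show ?thesis using assms by simp
qed

lemma mult_le_delta_squares:
  fixes s t :: real
  assumes "\<delta> > 0"
  shows "s * t \<le> \<delta> * t\<^sup>2 + s\<^sup>2 / \<delta>"
proof -
  have "0 \<le> (s - \<delta> * t)\<^sup>2 + s\<^sup>2 + (\<delta> * t)\<^sup>2" by simp
  then have "s * t * \<delta> \<le> (\<delta> * t\<^sup>2 + s\<^sup>2 / \<delta>) * \<delta>"
    using assms by (simp add: power2_eq_square algebra_simps)
  then show ?thesis using assms by simp
qed

lemma norm_add_square_le: "(norm (x + y))\<^sup>2 \<le> 2 * (norm x)\<^sup>2 + 2 * (norm y)\<^sup>2"
  for x y :: "'b::real_normed_vector"
proof -
  have "(norm (x + y))\<^sup>2 \<le> (norm x + norm y)\<^sup>2"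
    by (intro power_mono norm_triangle_ineq) auto
  also have "\<dots> \<le> 2 * (norm x)\<^sup>2 + 2 * (norm y)\<^sup>2"
    using sum_squares_bound[of "norm x" "norm y"] by (simp add: power2_sum)
  finally show ?thesis .
qed

text \<open>
  The way in which an estimate with a free weight \<open>\<delta>\<close> is used: choose \<open>\<delta>\<close> small first, then \<open>n\<close>
  large.
\<close>

lemma tendsto_0_from_delta:
  fixes a b :: "nat \<Rightarrow> real"
  assumes "\<And>\<delta> n. \<delta> > 0 \<Longrightarrow> \<bar>a n\<bar> \<le> \<delta> * C + b n / \<delta>" "b \<longlonglongrightarrow> 0" "C \<ge> 0"
  shows "a \<longlonglongrightarrow> 0"
proof (rule LIMSEQ_I)
  fix e :: real assume e: "e > 0"
  define \<delta> where "\<delta> = e / (2 * (C + 1))"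
  have \<delta>: "\<delta> > 0" "\<delta> * C < e / 2 + e / 4"
    using e assms(3) by (auto simp: \<delta>_def field_simps add_pos_nonneg)
  obtain N where N: "\<And>n. n \<ge> N \<Longrightarrow> norm (b n - 0) < \<delta> * (e / 4)"
    using LIMSEQ_D[OF assms(2), of "\<delta> * (e / 4)"] \<delta> e by auto
  have "norm (a n - 0) < e" if "n \<ge> N" for n
  proof -
    have "b n / \<delta> < e / 4" using N[OF that] \<delta> by (simp add: pos_divide_less_eq mult.commute)
    then have "\<bar>a n\<bar> < e" using assms(1)[OF \<delta>(1), of n] \<delta>(2) by linarith
    then show ?thesis by simp
  qed
  then show "\<exists>N. \<forall>n\<ge>N. norm (a n - 0) < e" by blast
qed

lemma (in finite_measure) square_integrable_imp_integrable:
  fixes f :: "'a \<Rightarrow> 'b::{banach,second_countable_topology}"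
  assumes "f \<in> borel_measurable M" "integrable M (\<lambda>x. (norm (f x))\<^sup>2)"
  shows "integrable M f"
proof (rule Bochner_Integration.integrable_bound[where f = "\<lambda>x. 1 + (norm (f x))\<^sup>2"])
  show "integrable M (\<lambda>x. 1 + (norm (f x))\<^sup>2)" using assms by simp
  have "norm (f x) \<le> norm (1 + (norm (f x))\<^sup>2)" for x
    using abs_le_delta_square[of 1 "norm (f x)"] by simp
  then show "AE x in M. norm (f x) \<le> norm (1 + (norm (f x))\<^sup>2)" by simp
qed (use assms in auto)

lemma square_integrable_diff:
  fixes f g :: "'a \<Rightarrow> 'b::{banach,second_countable_topology}"
  assumes "f \<in> borel_measurable M" "integrable M (\<lambda>x. (norm (f x))\<^sup>2)"
    "g \<in> borel_measurable M" "integrable M (\<lambda>x. (norm (g x))\<^sup>2)"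
  shows "integrable M (\<lambda>x. (norm (f x - g x))\<^sup>2)"
proof (rule Bochner_Integration.integrable_bound[where f = "\<lambda>x. 2 * (norm (f x))\<^sup>2 + 2 * (norm (g x))\<^sup>2"])
  show "AE x in M. norm ((norm (f x - g x))\<^sup>2) \<le> norm (2 * (norm (f x))\<^sup>2 + 2 * (norm (g x))\<^sup>2)"
    using norm_add_square_le[of "f _" "- g _"] by (intro AE_I2) simp
qed (use assms in auto)

lemma square_integrable_inner:
  fixes f g :: "'a \<Rightarrow> 'b::euclidean_space"
  assumes "f \<in> borel_measurable M" "integrable M (\<lambda>x. (norm (f x))\<^sup>2)"
    "g \<in> borel_measurable M" "integrable M (\<lambda>x. (norm (g x))\<^sup>2)"
  shows "integrable M (\<lambda>x. f x \<bullet> g x)"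
proof (rule Bochner_Integration.integrable_bound[where f = "\<lambda>x. (norm (f x))\<^sup>2 + (norm (g x))\<^sup>2"])
  have "\<bar>f x \<bullet> g x\<bar> \<le> (norm (f x))\<^sup>2 + (norm (g x))\<^sup>2" for x
    using Cauchy_Schwarz_ineq2[of "f x" "g x"] mult_le_delta_squares[of 1 "norm (f x)" "norm (g x)"] by simp
  then show "AE x in M. norm (f x \<bullet> g x) \<le> norm ((norm (f x))\<^sup>2 + (norm (g x))\<^sup>2)" by simp
qed (use assms in auto)

text \<open>
  On a finite measure space an \<open>L\<^sup>2\<close>-Cauchy sequence is \<open>L\<^sup>1\<close>-Cauchy, so a subsequence converges almost
  everywhere. Fatou's lemma shows that its limit is the \<open>L\<^sup>2\<close> limit of the whole sequence.
\<close>

lemma (in finite_measure) L2_complete: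
  fixes s :: "nat \<Rightarrow> 'a \<Rightarrow> 'b::{banach,second_countable_topology}"
  assumes meas[measurable]: "\<And>n. s n \<in> borel_measurable M"
    and int: "\<And>n. integrable M (\<lambda>x. (norm (s n x))\<^sup>2)"
    and cauchy: "\<And>e. e > 0 \<Longrightarrow> \<exists>N. \<forall>i\<ge>N. \<forall>j\<ge>N. (LINT x|M. (norm (s i x - s j x))\<^sup>2) < e"
  obtains f where "f \<in> borel_measurable M" "integrable M (\<lambda>x. (norm (f x))\<^sup>2)"
    "(\<lambda>n. LINT x|M. (norm (s n x - f x))\<^sup>2) \<longlonglongrightarrow> 0"
proof -
  let ?m = "measure M (space M)"
  note int2 = square_integrable_diff[OF meas int meas int]
  have int1: "integrable M (s n)" for n
    by (rule square_integrable_imp_integrable[OF meas int])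
  have "\<exists>N. \<forall>i\<ge>N. \<forall>j\<ge>N. (LINT x|M. norm (s i x - s j x)) < e" if e: "e > 0" for e
  proof -
    define \<delta> where "\<delta> = e / (2 * (?m + 1))"
    have \<delta>: "\<delta> > 0" "\<delta> * ?m < e / 2 + e / 4"
      using e by (auto simp: \<delta>_def field_simps add_pos_nonneg)
    obtain N where N: "\<And>i j. i \<ge> N \<Longrightarrow> j \<ge> N \<Longrightarrow> (LINT x|M. (norm (s i x - s j x))\<^sup>2) < \<delta> * (e / 4)"
      using cauchy[of "\<delta> * (e / 4)"] \<delta> e by auto
    have "(LINT x|M. norm (s i x - s j x)) < e" if "i \<ge> N" "j \<ge> N" for i j
    proof -
      have "(LINT x|M. norm (s i x - s j x)) \<le> (LINT x|M. \<delta> + (norm (s i x - s j x))\<^sup>2 / \<delta>)"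
        using int1 int2[of i j] abs_le_delta_square[OF \<delta>(1)]
        by (intro integral_mono) (auto, metis abs_norm_cancel)
      also have "\<dots> = \<delta> * ?m + (LINT x|M. (norm (s i x - s j x))\<^sup>2) / \<delta>"
        using int2[of i j] by (simp add: mult.commute)
      also have "(LINT x|M. (norm (s i x - s j x))\<^sup>2) / \<delta> < e / 4"
        using N[OF that] \<delta> by (simp add: pos_divide_less_eq mult.commute)
      finally show ?thesis using \<delta>(2) by linarith
    qed
    then show ?thesis by blast
  qed
  then obtain r where r: "strict_mono r" "AE x in M. Cauchy (\<lambda>i. s (r i) x)"
    using cauchy_L1_AE_cauchy_subseq[of M s, OF int1] by blast
  define f where "f x = lim (\<lambda>i. s (r i) x)" for x
  have f[measurable]: "f \<in> borel_measurable M" unfolding f_def by measurable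
  have lim: "AE x in M. (\<lambda>i. s (r i) x) \<longlonglongrightarrow> f x"
    using r(2) by eventually_elim (auto simp: f_def Cauchy_convergent_iff convergent_LIMSEQ_iff)
  have key: "(\<integral>\<^sup>+x. ennreal ((norm (s n x - f x))\<^sup>2) \<partial>M) \<le> ennreal e"
    if N: "\<And>i j. i \<ge> N \<Longrightarrow> j \<ge> N \<Longrightarrow> (LINT x|M. (norm (s i x - s j x))\<^sup>2) < e" and n: "n \<ge> N" for n N e
  proof -
    have "AE x in M. ennreal ((norm (s n x - f x))\<^sup>2) = liminf (\<lambda>i. ennreal ((norm (s n x - s (r i) x))\<^sup>2))"
      using lim
    proof eventually_elim
      case (elim x)
      have "(\<lambda>i. ennreal ((norm (s n x - s (r i) x))\<^sup>2)) \<longlonglongrightarrow> ennreal ((norm (s n x - f x))\<^sup>2)"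
        by (intro tendsto_ennrealI tendsto_intros elim)
      then show ?case by (intro lim_imp_Liminf[symmetric]) auto
    qed
    then have "(\<integral>\<^sup>+x. ennreal ((norm (s n x - f x))\<^sup>2) \<partial>M)
        = (\<integral>\<^sup>+x. liminf (\<lambda>i. ennreal ((norm (s n x - s (r i) x))\<^sup>2)) \<partial>M)"
      by (rule nn_integral_cong_AE)
    also have "\<dots> \<le> liminf (\<lambda>i. \<integral>\<^sup>+x. ennreal ((norm (s n x - s (r i) x))\<^sup>2) \<partial>M)"
      by (rule nn_integral_liminf) measurable
    also have "\<dots> \<le> ennreal e"
    proof -
      have "\<forall>\<^sub>F i in sequentially. (\<integral>\<^sup>+x. ennreal ((norm (s n x - s (r i) x))\<^sup>2) \<partial>M) \<le> ennreal e"
        using eventually_ge_at_top[of N]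
      proof eventually_elim
        case (elim i)
        then have "r i \<ge> N" using seq_suble[OF r(1), of i] by simp
        then show ?case
          using N[OF n, of "r i"] int2[of n "r i"] by (simp add: nn_integral_eq_integral ennreal_leI less_imp_le)
      qed
      then show ?thesis by (intro Liminf_le) auto
    qed
    finally show ?thesis .
  qed
  have intd: "integrable M (\<lambda>x. (norm (s n x - f x))\<^sup>2) \<and> (LINT x|M. (norm (s n x - f x))\<^sup>2) \<le> e"
    if N: "\<And>i j. i \<ge> N \<Longrightarrow> j \<ge> N \<Longrightarrow> (LINT x|M. (norm (s i x - s j x))\<^sup>2) < e" and n: "n \<ge> N" and e: "e > 0" for n N e
  proof
    have k: "(\<integral>\<^sup>+x. ennreal ((norm (s n x - f x))\<^sup>2) \<partial>M) \<le> ennreal e" by (rule key[OF N n])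
    show i: "integrable M (\<lambda>x. (norm (s n x - f x))\<^sup>2)"
      using k by (intro integrableI_nonneg) (auto simp: less_top[symmetric] top_unique)
    show "(LINT x|M. (norm (s n x - f x))\<^sup>2) \<le> e"
      using k i e by (simp add: nn_integral_eq_integral)
  qed
  have "integrable M (\<lambda>x. (norm (f x))\<^sup>2)"
  proof -
    obtain N where "\<And>i j. i \<ge> N \<Longrightarrow> j \<ge> N \<Longrightarrow> (LINT x|M. (norm (s i x - s j x))\<^sup>2) < 1"
      using cauchy[of 1] by auto
    then have "integrable M (\<lambda>x. (norm (s N x - f x))\<^sup>2)" using intd[of N 1 N] by auto
    then have "integrable M (\<lambda>x. (norm (s N x - (s N x - f x)))\<^sup>2)"
      using square_integrable_diff[OF meas[of N] int[of N], of "\<lambda>x. s N x - f x"] by measurable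
    then show ?thesis by simp
  qed
  moreover have "(\<lambda>n. LINT x|M. (norm (s n x - f x))\<^sup>2) \<longlonglongrightarrow> 0"
  proof (rule LIMSEQ_I)
    fix e :: real assume e: "e > 0"
    obtain N where "\<And>i j. i \<ge> N \<Longrightarrow> j \<ge> N \<Longrightarrow> (LINT x|M. (norm (s i x - s j x))\<^sup>2) < e / 2"
      using cauchy[of "e / 2"] e by auto
    then have "(LINT x|M. (norm (s n x - f x))\<^sup>2) \<le> e / 2" if "n \<ge> N" for n
      using intd[of N "e / 2" n] that e by auto
    then have "norm ((LINT x|M. (norm (s n x - f x))\<^sup>2) - 0) < e" if "n \<ge> N" for n
      using that e by fastforce
    then show "\<exists>N. \<forall>n\<ge>N. norm ((LINT x|M. (norm (s n x - f x))\<^sup>2) - 0) < e" by blast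
  qed
  ultimately show ?thesis using f that by blast
qed

lemma L2_tendsto_inner:
  fixes s :: "nat \<Rightarrow> 'a \<Rightarrow> 'b::euclidean_space"
  assumes s: "\<And>n. s n \<in> borel_measurable M" "\<And>n. integrable M (\<lambda>x. (norm (s n x))\<^sup>2)"
    and f: "f \<in> borel_measurable M" "integrable M (\<lambda>x. (norm (f x))\<^sup>2)"
    and h: "h \<in> borel_measurable M" "integrable M (\<lambda>x. (norm (h x))\<^sup>2)"
    and conv: "(\<lambda>n. LINT x|M. (norm (s n x - f x))\<^sup>2) \<longlonglongrightarrow> 0"
  shows "(\<lambda>n. LINT x|M. s n x \<bullet> h x) \<longlonglongrightarrow> (LINT x|M. f x \<bullet> h x)"
proof (rule Lim_null[THEN iffD2])
  let ?a = "\<lambda>n. (LINT x|M. s n x \<bullet> h x) - (LINT x|M. f x \<bullet> h x)"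
  show "?a \<longlonglongrightarrow> 0"
  proof (rule tendsto_0_from_delta[where C = "LINT x|M. (norm (h x))\<^sup>2"])
    fix \<delta> :: real and n assume \<delta>: "\<delta> > 0"
    have sd: "integrable M (\<lambda>x. (norm (s n x - f x))\<^sup>2)" by (intro square_integrable_diff s f)
    have "?a n = (LINT x|M. (s n x - f x) \<bullet> h x)"
      by (simp add: inner_diff_left square_integrable_inner s f h)
    also have "\<bar>\<dots>\<bar> \<le> (LINT x|M. \<bar>(s n x - f x) \<bullet> h x\<bar>)" by (rule integral_abs_bound)
    also have "\<dots> \<le> (LINT x|M. \<delta> * (norm (h x))\<^sup>2 + (norm (s n x - f x))\<^sup>2 / \<delta>)"
    proof (intro integral_mono)
      show "integrable M (\<lambda>x. \<bar>(s n x - f x) \<bullet> h x\<bar>)"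
        using s f h sd by (intro integrable_abs square_integrable_inner) auto
      show "\<bar>(s n x - f x) \<bullet> h x\<bar> \<le> \<delta> * (norm (h x))\<^sup>2 + (norm (s n x - f x))\<^sup>2 / \<delta>" for x
        using Cauchy_Schwarz_ineq2[of "s n x - f x" "h x"]
          mult_le_delta_squares[OF \<delta>, of "norm (s n x - f x)" "norm (h x)"] by linarith
    qed (use h sd in auto)
    also have "\<dots> = \<delta> * (LINT x|M. (norm (h x))\<^sup>2) + (LINT x|M. (norm (s n x - f x))\<^sup>2) / \<delta>"
      using h sd by simp
    finally show "\<bar>?a n\<bar> \<le> \<dots>" .
  qed (use conv in auto)
qed

text \<open>
  Expand \<open>|s\<^sub>n|\<^sup>2 = |s\<^sub>n - f|\<^sup>2 + 2 s\<^sub>n \<bullet> f - |f|\<^sup>2\<close>.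
\<close>

lemma L2_tendsto_norm_square:
  fixes s :: "nat \<Rightarrow> 'a \<Rightarrow> 'b::euclidean_space"
  assumes s: "\<And>n. s n \<in> borel_measurable M" "\<And>n. integrable M (\<lambda>x. (norm (s n x))\<^sup>2)"
    and f: "f \<in> borel_measurable M" "integrable M (\<lambda>x. (norm (f x))\<^sup>2)"
    and conv: "(\<lambda>n. LINT x|M. (norm (s n x - f x))\<^sup>2) \<longlonglongrightarrow> 0"
  shows "(\<lambda>n. LINT x|M. (norm (s n x))\<^sup>2) \<longlonglongrightarrow> (LINT x|M. (norm (f x))\<^sup>2)"
proof -
  have "(LINT x|M. (norm (s n x))\<^sup>2) =
      (LINT x|M. (norm (s n x - f x))\<^sup>2) + 2 * (LINT x|M. s n x \<bullet> f x) - (LINT x|M. (norm (f x))\<^sup>2)" for n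
  proof -
    have "(LINT x|M. (norm (s n x))\<^sup>2) = (LINT x|M. (norm (s n x - f x))\<^sup>2 + 2 * (s n x \<bullet> f x) - (norm (f x))\<^sup>2)"
      by (simp add: power2_norm_eq_inner inner_diff_left inner_diff_right inner_commute)
    also have "\<dots> = (LINT x|M. (norm (s n x - f x))\<^sup>2) + 2 * (LINT x|M. s n x \<bullet> f x) - (LINT x|M. (norm (f x))\<^sup>2)"
      using square_integrable_diff[OF s(1)[of n] s(2)[of n] f] square_integrable_inner[OF s(1)[of n] s(2)[of n] f] f by simp
    finally show ?thesis .
  qed
  moreover have "(\<lambda>n. (LINT x|M. (norm (s n x - f x))\<^sup>2) + 2 * (LINT x|M. s n x \<bullet> f x) - (LINT x|M. (norm (f x))\<^sup>2))
     \<longlonglongrightarrow> 0 + 2 * (LINT x|M. f x \<bullet> f x) - (LINT x|M. (norm (f x))\<^sup>2)"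
    by (intro tendsto_intros conv L2_tendsto_inner[OF s f f conv])
  ultimately show ?thesis by (simp add: power2_norm_eq_inner)
qed

lemma (in finite_measure) L2_tendsto_L1:
  fixes s :: "nat \<Rightarrow> 'a \<Rightarrow> 'b::euclidean_space"
  assumes s: "\<And>n. s n \<in> borel_measurable M" "\<And>n. integrable M (\<lambda>x. (norm (s n x))\<^sup>2)"
    and f: "f \<in> borel_measurable M" "integrable M (\<lambda>x. (norm (f x))\<^sup>2)"
    and conv: "(\<lambda>n. LINT x|M. (norm (s n x - f x))\<^sup>2) \<longlonglongrightarrow> 0"
  shows "(\<lambda>n. LINT x|M. norm (s n x - f x)) \<longlonglongrightarrow> 0"
proof (rule tendsto_0_from_delta[where C = "measure M (space M)"])
  fix \<delta> :: real and n assume \<delta>: "\<delta> > 0"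
  have sd: "integrable M (\<lambda>x. (norm (s n x - f x))\<^sup>2)" by (intro square_integrable_diff s f)
  have "integrable M (\<lambda>x. s n x - f x)"
    by (rule square_integrable_imp_integrable[OF _ sd]) (use s f in auto)
  then have "(LINT x|M. norm (s n x - f x)) \<le> (LINT x|M. \<delta> + (norm (s n x - f x))\<^sup>2 / \<delta>)"
    using sd abs_le_delta_square[OF \<delta>, of "norm (s n _ - f _)"] by (intro integral_mono) auto
  also have "\<dots> = \<delta> * measure M (space M) + (LINT x|M. (norm (s n x - f x))\<^sup>2) / \<delta>"
    using sd by (simp add: mult.commute)
  finally show "\<bar>LINT x|M. norm (s n x - f x)\<bar> \<le> \<dots>" by simp
qed (use conv in auto)

section \<open>Sobolev functions on a bounded domain\<close>

locale bounded_domain =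
  fixes \<Omega> :: "'a::euclidean_space set"
  assumes open_domain: "open \<Omega>" and bounded_domain: "bounded \<Omega>"
begin

abbreviation "\<mu> \<equiv> lebesgue_on \<Omega>"

abbreviation "test \<equiv> test_functions \<Omega>"

lemma domain_sets: "\<Omega> \<in> sets lebesgue"
  using open_domain by simp

sublocale finite_measure \<mu>
proof -
  have "\<Omega> \<in> lmeasurable"
    using bounded_domain domain_sets by (rule bounded_set_imp_lmeasurable)
  then show "finite_measure \<mu>" by (rule finite_measure_lebesgue_on)
qed

lemma continuous_measurable: "continuous_on UNIV f \<Longrightarrow> f \<in> borel_measurable \<mu>"
  for f :: "'a \<Rightarrow> 'b::euclidean_space"
  using borel_measurable_continuous_onI[of f]
  by (intro measurable_restrict_space1 measurable_completion) simp

lemma test_measurable: "\<phi> \<in> test \<Longrightarrow> \<phi> \<in> borel_measurable \<mu>"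
  and grad_test_measurable: "\<phi> \<in> test \<Longrightarrow> grad \<phi> \<in> borel_measurable \<mu>"
  by (auto intro!: continuous_measurable smooth_continuous smooth_grad_continuous test_smooth)

lemma bounded_integrable:
  fixes f :: "'a \<Rightarrow> 'b::{banach,second_countable_topology}"
  assumes "f \<in> borel_measurable \<mu>" "\<And>x. norm (f x) \<le> C"
  shows "integrable \<mu> f"
  using assms by (intro integrable_const_bound[of _ C]) auto

lemma bounded_in_L2:
  fixes f :: "'a \<Rightarrow> 'b::euclidean_space"
  assumes "f \<in> borel_measurable \<mu>" "\<And>x. norm (f x) \<le> C"
  shows "f \<in> L2 \<Omega>"
proof -
  have "integrable \<mu> (\<lambda>x. (norm (f x))\<^sup>2)"
    by (rule bounded_integrable[of _ "C\<^sup>2"]) (use assms in \<open>auto intro: power_mono\<close>)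
  then show ?thesis using assms by (simp add: L2_def)
qed

lemma test_in_L2: "\<phi> \<in> test \<Longrightarrow> \<phi> \<in> L2 \<Omega>"
  and grad_test_in_L2: "\<phi> \<in> test \<Longrightarrow> grad \<phi> \<in> L2 \<Omega>"
  by (metis bounded_in_L2 test_measurable test_bounded real_norm_def)
     (metis bounded_in_L2 grad_test_measurable test_bounded)

lemma L2_D:
  assumes "u \<in> L2 \<Omega>"
  shows "u \<in> borel_measurable \<mu>" "integrable \<mu> (\<lambda>x. (norm (u x))\<^sup>2)" "integrable \<mu> u"
  using assms square_integrable_imp_integrable unfolding L2_def by auto

lemma L2_diff: "u \<in> L2 \<Omega> \<Longrightarrow> v \<in> L2 \<Omega> \<Longrightarrow> (\<lambda>x. u x - v x) \<in> L2 \<Omega>"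
  unfolding L2_def by (auto intro: square_integrable_diff)

lemma L2_inner_integrable: "u \<in> L2 \<Omega> \<Longrightarrow> v \<in> L2 \<Omega> \<Longrightarrow> integrable \<mu> (\<lambda>x. u x \<bullet> v x)"
  unfolding L2_def by (auto intro: square_integrable_inner)

lemma integrable_imp_L1_loc:
  fixes u :: "'a \<Rightarrow> 'b::euclidean_space"
  assumes "integrable \<mu> u"
  shows "u \<in> L1_loc \<Omega>"
  unfolding L1_loc_def
proof safe
  fix K :: "'a set" assume K: "compact K" "K \<subseteq> \<Omega>"
  have "set_integrable lebesgue \<Omega> u"
    using assms domain_sets by (simp add: integrable_restrict_space set_integrable_def)
  then show "set_integrable lebesgue K u"
    by (rule set_integrable_subset) (use K in \<open>auto dest: compact_imp_closed\<close>)
qed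

lemma test_mult_L1_loc_integrable:
  fixes G :: "'a \<Rightarrow> 'b::euclidean_space"
  assumes "\<phi> \<in> test" "G \<in> L1_loc \<Omega>"
  shows "integrable \<mu> (\<lambda>x. \<phi> x *\<^sub>R G x)"
proof -
  obtain K where K: "smooth \<phi>" "compact K" "K \<subseteq> \<Omega>" "\<And>x. x \<notin> K \<Longrightarrow> \<phi> x = 0"
    using assms(1) by (rule test_functionsE) (rule that)
  obtain C where C: "C > 0" "\<And>x. \<bar>\<phi> x\<bar> \<le> C"
    using test_bounded[OF assms(1)] by metis
  have i: "integrable lebesgue (\<lambda>x. indicator K x *\<^sub>R G x)"
    using assms(2) K unfolding L1_loc_def set_integrable_def by blast
  have "integrable lebesgue (\<lambda>x. \<phi> x *\<^sub>R (indicator K x *\<^sub>R G x))"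
  proof (rule Bochner_Integration.integrable_bound[where f = "\<lambda>x. C *\<^sub>R (indicator K x *\<^sub>R G x)"])
    show "integrable lebesgue (\<lambda>x. C *\<^sub>R (indicator K x *\<^sub>R G x))"
      using i by (rule integrable_scaleR_right)
    show "(\<lambda>x. \<phi> x *\<^sub>R (indicator K x *\<^sub>R G x)) \<in> borel_measurable lebesgue"
    proof (rule borel_measurable_scaleR)
      show "\<phi> \<in> borel_measurable lebesgue"
        using borel_measurable_continuous_onI[OF smooth_continuous[OF K(1)]]
        by (intro measurable_completion) simp
    qed (use i in auto)
    have "norm (\<phi> x *\<^sub>R (indicator K x *\<^sub>R G x)) \<le> norm (C *\<^sub>R (indicator K x *\<^sub>R G x))" for x
      unfolding norm_scaleR[of "\<phi> x"] norm_scaleR[of C] using C by (intro mult_right_mono) (auto intro: order_trans)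
    then show "AE x in lebesgue. norm (\<phi> x *\<^sub>R (indicator K x *\<^sub>R G x)) \<le> norm (C *\<^sub>R (indicator K x *\<^sub>R G x))"
      by blast
  qed
  also have "(\<lambda>x. \<phi> x *\<^sub>R (indicator K x *\<^sub>R G x)) = (\<lambda>x. indicator \<Omega> x *\<^sub>R (\<phi> x *\<^sub>R G x))"
    using K by (auto simp: fun_eq_iff indicator_def)
  finally show ?thesis using domain_sets by (simp add: integrable_restrict_space)
qed

lemma complete_domain: "complete_measure \<mu>"
proof
  fix A B :: "'a set" assume "B \<subseteq> A" "A \<in> null_sets \<mu>"
  then have "A \<subseteq> \<Omega>" "A \<in> null_sets lebesgue" by (simp_all add: null_sets_restrict_space domain_sets)
  with \<open>B \<subseteq> A\<close> have "B \<subseteq> \<Omega>" "B \<in> sets lebesgue" using completion.complete by blast+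
  then show "B \<in> sets \<mu>" by (simp add: sets_restrict_space_iff domain_sets)
qed

text \<open>
  The chosen representative \<open>weak_gradient\<close> carries no information on null sets; completeness of
  Lebesgue measure makes it measurable nevertheless.
\<close>

lemma measurable_AE_eq:
  assumes f: "f \<in> borel_measurable \<mu>" and ae: "AE x in \<mu>. f x = g x"
  shows "g \<in> borel_measurable \<mu>"
proof (rule measurableI)
  fix S :: "'b set" assume S: "S \<in> sets borel"
  show "g -` S \<inter> space \<mu> \<in> sets \<mu>"
  proof (rule complete_measure.in_sets_AE[OF complete_domain])
    show "f -` S \<inter> space \<mu> \<in> sets \<mu>" using f S by (rule measurable_sets)
    show "AE x in \<mu>. (x \<in> f -` S \<inter> space \<mu>) = (x \<in> g -` S \<inter> space \<mu>)"
      using ae by eventually_elim auto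
  qed auto
qed auto

lemma weak_gradient_unique:
  assumes "has_weak_gradient \<Omega> u G" "has_weak_gradient \<Omega> u G'"
  shows "AE x in \<mu>. G x = G' x"
proof -
  have L: "G \<in> L1_loc \<Omega>" "G' \<in> L1_loc \<Omega>" using assms by (auto simp: has_weak_gradient_def)
  have "AE x in \<mu>. G x - G' x = 0"
  proof (rule fundamental_lemma_calculus_of_variations[OF open_domain])
    show "(\<lambda>x. G x - G' x) \<in> L1_loc \<Omega>"
      using L unfolding L1_loc_def by (auto intro: set_integral_diff)
    show "(LINT x|\<mu>. \<phi> x *\<^sub>R (G x - G' x)) = 0" if "\<phi> \<in> test" for \<phi>
      using assms that test_mult_L1_loc_integrable[OF that L(1)] test_mult_L1_loc_integrable[OF that L(2)]
      by (auto simp: has_weak_gradient_def scaleR_diff_right)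
  qed
  then show ?thesis by simp
qed

text \<open>
  This makes the arbitrary choice in \<open>weak_gradient\<close> harmless: any weak gradient that is known
  explicitly computes it.
\<close>

lemma weak_gradient_AE:
  assumes "has_weak_gradient \<Omega> u G"
  shows "AE x in \<mu>. weak_gradient \<Omega> u x = G x"
  using weak_gradient_unique[OF someI[of "has_weak_gradient \<Omega> u", OF assms] assms]
  by (simp add: weak_gradient_def)

lemma L2_has_weak_gradientI:
  assumes "u \<in> L2 \<Omega>" "G \<in> L2 \<Omega>"
    "\<And>\<phi>. \<phi> \<in> test \<Longrightarrow> (LINT x|\<mu>. u x *\<^sub>R grad \<phi> x) = - (LINT x|\<mu>. \<phi> x *\<^sub>R G x)"
  shows "has_weak_gradient \<Omega> u G"
  using assms by (auto simp: has_weak_gradient_def intro!: integrable_imp_L1_loc L2_D(3))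

lemma has_weak_gradient_test: "\<phi> \<in> test \<Longrightarrow> has_weak_gradient \<Omega> \<phi> (grad \<phi>)"
  by (intro L2_has_weak_gradientI integration_by_parts test_in_L2 grad_test_in_L2 domain_sets)

lemma L2_mult_test_integrable:
  fixes u :: "'a \<Rightarrow> real"
  assumes "u \<in> L2 \<Omega>" "\<phi> \<in> test"
  shows "integrable \<mu> (\<lambda>x. u x *\<^sub>R grad \<phi> x)"
proof (rule Bochner_Integration.integrable_bound[where f = "\<lambda>x. (norm (u x))\<^sup>2 + (norm (grad \<phi> x))\<^sup>2"])
  have "norm (u x *\<^sub>R grad \<phi> x) \<le> (norm (u x))\<^sup>2 + (norm (grad \<phi> x))\<^sup>2" for x
    using mult_le_delta_squares[of 1 "norm (u x)" "norm (grad \<phi> x)"] by simp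
  then show "AE x in \<mu>. norm (u x *\<^sub>R grad \<phi> x) \<le> norm ((norm (u x))\<^sup>2 + (norm (grad \<phi> x))\<^sup>2)"
    by (intro AE_I2) simp
qed (use L2_D[OF assms(1)] L2_D[OF grad_test_in_L2[OF assms(2)]] in auto)

lemma has_weak_gradient_diff_test:
  assumes u: "u \<in> L2 \<Omega>" "G \<in> L2 \<Omega>" "has_weak_gradient \<Omega> u G" and \<psi>: "\<psi> \<in> test"
  shows "has_weak_gradient \<Omega> (\<lambda>x. u x - \<psi> x) (\<lambda>x. G x - grad \<psi> x)"
proof (rule L2_has_weak_gradientI)
  show "(LINT x|\<mu>. (u x - \<psi> x) *\<^sub>R grad \<phi> x) = - (LINT x|\<mu>. \<phi> x *\<^sub>R (G x - grad \<psi> x))" if \<phi>: "\<phi> \<in> test" for \<phi>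
  proof -
    have L: "G \<in> L1_loc \<Omega>" "grad \<psi> \<in> L1_loc \<Omega>"
      using u(2) \<psi> grad_test_in_L2 L2_D(3) integrable_imp_L1_loc by blast+
    show ?thesis
      using L2_mult_test_integrable[OF u(1) \<phi>] L2_mult_test_integrable[OF test_in_L2[OF \<psi>] \<phi>]
        test_mult_L1_loc_integrable[OF \<phi> L(1)] test_mult_L1_loc_integrable[OF \<phi> L(2)]
        u(3) has_weak_gradient_test[OF \<psi>] \<phi>
      by (simp add: scaleR_diff_left scaleR_diff_right has_weak_gradient_def)
  qed
qed (intro L2_diff u test_in_L2 grad_test_in_L2 \<psi>)+

text \<open>
  The norm is defined through a chosen weak gradient of the difference; it is expressed here by a
  known weak gradient of \<open>u\<close>.
\<close>

lemma H1_norm_diff_test: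
  assumes u: "u \<in> L2 \<Omega>" "G \<in> L2 \<Omega>" "has_weak_gradient \<Omega> u G" and \<psi>: "\<psi> \<in> test"
  shows "H1_norm \<Omega> (\<lambda>x. u x - \<psi> x) =
    sqrt ((LINT x|\<mu>. (norm (\<psi> x - u x))\<^sup>2) + (LINT x|\<mu>. (norm (grad \<psi> x - G x))\<^sup>2))"
proof -
  note w = has_weak_gradient_diff_test[OF assms]
  have ae: "AE x in \<mu>. weak_gradient \<Omega> (\<lambda>x. u x - \<psi> x) x = G x - grad \<psi> x"
    by (rule weak_gradient_AE[OF w])
  have m: "(\<lambda>x. G x - grad \<psi> x) \<in> borel_measurable \<mu>"
    using L2_diff[OF u(2) grad_test_in_L2[OF \<psi>]] L2_D(1) by blast
  have "AE x in \<mu>. (norm (weak_gradient \<Omega> (\<lambda>x. u x - \<psi> x) x))\<^sup>2 = (norm (grad \<psi> x - G x))\<^sup>2"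
    using ae by eventually_elim (simp add: norm_minus_commute)
  moreover have "weak_gradient \<Omega> (\<lambda>x. u x - \<psi> x) \<in> borel_measurable \<mu>"
  proof (rule measurable_AE_eq[OF m])
    show "AE x in \<mu>. G x - grad \<psi> x = weak_gradient \<Omega> (\<lambda>x. u x - \<psi> x) x"
      using ae by eventually_elim simp
  qed
  ultimately have "(LINT x|\<mu>. (norm (weak_gradient \<Omega> (\<lambda>x. u x - \<psi> x) x))\<^sup>2) = (LINT x|\<mu>. (norm (grad \<psi> x - G x))\<^sup>2)"
    using u \<psi> by (intro integral_cong_AE) (auto dest!: L2_D(1) grad_test_measurable)
  then show ?thesis by (simp add: H1_norm_def power2_commute)
qed

text \<open>
  Each coordinate of the two sides of the identity defining a weak gradient is an \<open>L\<^sup>2\<close> inner product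
  with a fixed function, so the identity survives \<open>L\<^sup>2\<close> limits.
\<close>

lemma L2_limit_of_test_functions:
  assumes \<phi>: "\<And>n. \<phi> n \<in> test" and u: "u \<in> L2 \<Omega>" and G: "G \<in> L2 \<Omega>"
    and convu: "(\<lambda>n. LINT x|\<mu>. (norm (\<phi> n x - u x))\<^sup>2) \<longlonglongrightarrow> 0"
    and convG: "(\<lambda>n. LINT x|\<mu>. (norm (grad (\<phi> n) x - G x))\<^sup>2) \<longlonglongrightarrow> 0"
  shows "has_weak_gradient \<Omega> u G" "u \<in> H10 \<Omega>"
proof -
  show wg: "has_weak_gradient \<Omega> u G"
  proof (rule L2_has_weak_gradientI[OF u G])
    fix \<eta> assume \<eta>: "\<eta> \<in> test"
    note Dphi = L2_D[OF test_in_L2[OF \<phi>]] and Dg = L2_D[OF grad_test_in_L2[OF \<phi>]]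
    note Du = L2_D[OF u] and DG = L2_D[OF G]
    show "(LINT x|\<mu>. u x *\<^sub>R grad \<eta> x) = - (LINT x|\<mu>. \<eta> x *\<^sub>R G x)"
    proof (rule euclidean_eqI)
      fix b :: 'a assume b: "b \<in> Basis"
      have i1: "integrable \<mu> (\<lambda>x. v x *\<^sub>R grad \<eta> x)" if "v \<in> L2 \<Omega>" for v
        using that \<eta> by (rule L2_mult_test_integrable)
      have i2: "integrable \<mu> (\<lambda>x. \<eta> x *\<^sub>R V x)" if "V \<in> L2 \<Omega>" for V :: "'a \<Rightarrow> 'a"
        using \<eta> integrable_imp_L1_loc[OF L2_D(3)[OF that]] by (rule test_mult_L1_loc_integrable)
      have h1: "(\<lambda>x. grad \<eta> x \<bullet> b) \<in> L2 \<Omega>"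
        by (rule test_in_L2[OF test_grad_component[OF \<eta> b]])
      have h2: "(\<lambda>x. \<eta> x *\<^sub>R b) \<in> L2 \<Omega>"
      proof -
        obtain C where "\<And>x. \<bar>\<eta> x\<bar> \<le> C" using test_bounded[OF \<eta>] by metis
        then show ?thesis using b test_measurable[OF \<eta>] by (intro bounded_in_L2[of _ C]) auto
      qed
      have "(\<lambda>n. LINT x|\<mu>. \<phi> n x \<bullet> (grad \<eta> x \<bullet> b)) \<longlonglongrightarrow> (LINT x|\<mu>. u x \<bullet> (grad \<eta> x \<bullet> b))"
        by (rule L2_tendsto_inner[OF Dphi(1,2) Du(1,2) L2_D(1,2)[OF h1] convu])
      moreover have "(LINT x|\<mu>. v x \<bullet> (grad \<eta> x \<bullet> b)) = (LINT x|\<mu>. v x *\<^sub>R grad \<eta> x) \<bullet> b"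
        if "v \<in> L2 \<Omega>" for v
        by (simp add: integral_inner_left[symmetric] i1[OF that] del: integral_inner_left)
      ultimately have 1: "(\<lambda>n. (LINT x|\<mu>. \<phi> n x *\<^sub>R grad \<eta> x) \<bullet> b) \<longlonglongrightarrow> (LINT x|\<mu>. u x *\<^sub>R grad \<eta> x) \<bullet> b"
        using u test_in_L2[OF \<phi>] by simp
      have "(\<lambda>n. LINT x|\<mu>. grad (\<phi> n) x \<bullet> (\<eta> x *\<^sub>R b)) \<longlonglongrightarrow> (LINT x|\<mu>. G x \<bullet> (\<eta> x *\<^sub>R b))"
        by (rule L2_tendsto_inner[OF Dg(1,2) DG(1,2) L2_D(1,2)[OF h2] convG])
      moreover have "(LINT x|\<mu>. V x \<bullet> (\<eta> x *\<^sub>R b)) = (LINT x|\<mu>. \<eta> x *\<^sub>R V x) \<bullet> b"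
        if "V \<in> L2 \<Omega>" for V :: "'a \<Rightarrow> 'a"
        by (simp add: integral_inner_left[symmetric] i2[OF that] del: integral_inner_left)
      ultimately have "(\<lambda>n. - ((LINT x|\<mu>. \<eta> x *\<^sub>R grad (\<phi> n) x) \<bullet> b)) \<longlonglongrightarrow> - ((LINT x|\<mu>. \<eta> x *\<^sub>R G x) \<bullet> b)"
        using G grad_test_in_L2[OF \<phi>] by (intro tendsto_minus) simp
      moreover have "(LINT x|\<mu>. \<phi> n x *\<^sub>R grad \<eta> x) = - (LINT x|\<mu>. \<eta> x *\<^sub>R grad (\<phi> n) x)" for n
        by (rule integration_by_parts[OF domain_sets \<phi> \<eta>])
      ultimately show "(LINT x|\<mu>. u x *\<^sub>R grad \<eta> x) \<bullet> b = (- (LINT x|\<mu>. \<eta> x *\<^sub>R G x)) \<bullet> b"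
        using LIMSEQ_unique[OF 1] by simp
    qed
  qed
  have "(\<lambda>n. H1_norm \<Omega> (\<lambda>x. u x - \<phi> n x)) \<longlonglongrightarrow> sqrt (0 + 0)"
    unfolding H1_norm_diff_test[OF u G wg \<phi>] by (intro tendsto_intros convu convG)
  then show "u \<in> H10 \<Omega>"
    using u G wg \<phi> by (auto simp: H10_def H1_def)
qed

lemma H10_approximation:
  assumes "\<psi> \<in> H10 \<Omega>"
  obtains \<phi> where "\<And>n. \<phi> n \<in> test" "\<psi> \<in> L2 \<Omega>" "weak_gradient \<Omega> \<psi> \<in> L2 \<Omega>"
    "(\<lambda>n. LINT x|\<mu>. (norm (\<phi> n x - \<psi> x))\<^sup>2) \<longlonglongrightarrow> 0"
    "(\<lambda>n. LINT x|\<mu>. (norm (grad (\<phi> n) x - weak_gradient \<Omega> \<psi> x))\<^sup>2) \<longlonglongrightarrow> 0"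
proof -
  obtain \<phi> G where \<phi>: "\<And>n. \<phi> n \<in> test" and \<psi>: "\<psi> \<in> L2 \<Omega>" "G \<in> L2 \<Omega>" "has_weak_gradient \<Omega> \<psi> G"
    and conv: "(\<lambda>n. H1_norm \<Omega> (\<lambda>x. \<psi> x - \<phi> n x)) \<longlonglongrightarrow> 0"
    using assms by (auto simp: H10_def H1_def)
  have ae: "AE x in \<mu>. weak_gradient \<Omega> \<psi> x = G x" by (rule weak_gradient_AE[OF \<psi>(3)])
  have ae': "AE x in \<mu>. G x = weak_gradient \<Omega> \<psi> x" using ae by eventually_elim simp
  have wgm: "weak_gradient \<Omega> \<psi> \<in> borel_measurable \<mu>"
    by (rule measurable_AE_eq[OF L2_D(1)[OF \<psi>(2)] ae'])
  have "integrable \<mu> (\<lambda>x. (norm (weak_gradient \<Omega> \<psi> x))\<^sup>2) \<longleftrightarrow> integrable \<mu> (\<lambda>x. (norm (G x))\<^sup>2)"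
    using ae wgm L2_D(1)[OF \<psi>(2)] by (intro integrable_cong_AE) auto
  then have wL: "weak_gradient \<Omega> \<psi> \<in> L2 \<Omega>"
    using wgm L2_D(2)[OF \<psi>(2)] by (simp add: L2_def)
  have whas: "has_weak_gradient \<Omega> \<psi> (weak_gradient \<Omega> \<psi>)"
    unfolding weak_gradient_def by (rule someI[of "has_weak_gradient \<Omega> \<psi>", OF \<psi>(3)])
  let ?A = "\<lambda>n. LINT x|\<mu>. (norm (\<phi> n x - \<psi> x))\<^sup>2"
  let ?B = "\<lambda>n. LINT x|\<mu>. (norm (grad (\<phi> n) x - weak_gradient \<Omega> \<psi> x))\<^sup>2"
  have eq: "(H1_norm \<Omega> (\<lambda>x. \<psi> x - \<phi> n x))\<^sup>2 = ?A n + ?B n" for n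
    unfolding H1_norm_diff_test[OF \<psi>(1) wL whas \<phi>] by (intro real_sqrt_pow2 add_nonneg_nonneg integral_nonneg) auto
  have "(\<lambda>n. (H1_norm \<Omega> (\<lambda>x. \<psi> x - \<phi> n x))\<^sup>2) \<longlonglongrightarrow> 0\<^sup>2" by (intro tendsto_power conv)
  then have lim: "(\<lambda>n. ?A n + ?B n) \<longlonglongrightarrow> 0" unfolding eq by simp
  have A: "0 \<le> ?A n" and B: "0 \<le> ?B n" for n by (simp_all add: integral_nonneg)
  have "?A \<longlonglongrightarrow> 0" "?B \<longlonglongrightarrow> 0"
    by (rule tendsto_sandwich[OF _ _ tendsto_const lim], use A B in auto)+
  with \<phi> \<psi>(1) wL show ?thesis by (rule that)
qed

end

section \<open>The potential\<close>

text \<open>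
  The even primitive of \<open>G s\<^sup>\<beta> - F s\<^sup>\<alpha>\<close>. Being even, it does not distinguish a function from its
  absolute value, and the energy can be minimized over test functions of arbitrary sign.
\<close>

definition potential :: "real \<Rightarrow> real \<Rightarrow> real \<Rightarrow> real \<Rightarrow> real \<Rightarrow> real" where
  "potential \<alpha> \<beta> F G s = G * \<bar>s\<bar> powr (\<beta> + 1) / (\<beta> + 1) - F * \<bar>s\<bar> powr (\<alpha> + 1) / (\<alpha> + 1)"

lemma powr_continuous_on:
  assumes "c > 0" "0 \<le> x"
  shows "continuous_on {x..y} (\<lambda>t::real. t powr c)"
  using assms by (intro continuous_on_powr' continuous_intros) auto

lemma powr_mean_value:
  fixes x y c :: real
  assumes "0 \<le> x" "x < y" "c > 0"
  shows "\<exists>\<xi>. x < \<xi> \<and> \<xi> < y \<and> y powr c - x powr c = (y - x) * (c * \<xi> powr (c - 1))"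
proof -
  have "\<exists>l z. x < z \<and> z < y \<and> ((\<lambda>t. t powr c) has_real_derivative l) (at z) \<and> y powr c - x powr c = (y - x) * l"
  proof (rule MVT)
    show "(\<lambda>t. t powr c) differentiable (at t)" if "x < t" "t < y" for t
      using that assms has_real_derivative_powr[of t c] real_differentiable_def by force
  qed (use assms powr_continuous_on in auto)
  then obtain l z where z: "x < z" "z < y" "((\<lambda>t. t powr c) has_real_derivative l) (at z)"
      "y powr c - x powr c = (y - x) * l" by blast
  have "((\<lambda>t. t powr c) has_real_derivative (c * z powr (c - 1))) (at z)"
    using z assms by (intro has_real_derivative_powr) auto
  then have "l = c * z powr (c - 1)" using z(3) DERIV_unique by blast
  with z show ?thesis by blast
qed

lemma powr_lipschitz:
  fixes x y C c :: real
  assumes "\<bar>x\<bar> \<le> C" "\<bar>y\<bar> \<le> C" "c \<ge> 1"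
  shows "\<bar>\<bar>x\<bar> powr c - \<bar>y\<bar> powr c\<bar> \<le> c * C powr (c - 1) * \<bar>x - y\<bar>"
proof -
  have *: "\<bar>b powr c - a powr c\<bar> \<le> c * C powr (c - 1) * \<bar>b - a\<bar>" if ab: "0 \<le> a" "a < b" "b \<le> C" for a b
  proof -
    obtain \<xi> where \<xi>: "a < \<xi>" "\<xi> < b" "b powr c - a powr c = (b - a) * (c * \<xi> powr (c - 1))"
      using powr_mean_value[of a b c] ab assms(3) by auto
    have "\<xi> powr (c - 1) \<le> C powr (c - 1)" using \<xi> that assms by (intro powr_mono2) auto
    then have "(b - a) * (c * \<xi> powr (c - 1)) \<le> (b - a) * (c * C powr (c - 1))"
      using that assms by (intro mult_left_mono) auto
    moreover have "a powr c \<le> b powr c" using that assms by (intro powr_mono2) auto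
    ultimately show ?thesis using \<xi>(3) that by (simp add: mult_ac)
  qed
  have "\<bar>\<bar>x\<bar> powr c - \<bar>y\<bar> powr c\<bar> \<le> c * C powr (c - 1) * \<bar>\<bar>x\<bar> - \<bar>y\<bar>\<bar>"
    using *[of "\<bar>x\<bar>" "\<bar>y\<bar>"] *[of "\<bar>y\<bar>" "\<bar>x\<bar>"] assms
    by (cases "\<bar>x\<bar>" "\<bar>y\<bar>" rule: linorder_cases) (auto simp: abs_minus_commute)
  also have "\<dots> \<le> c * C powr (c - 1) * \<bar>x - y\<bar>"
    using assms by (intro mult_left_mono) auto
  finally show ?thesis .
qed

text \<open>
  The potential has a corner at zero when \<open>\<alpha> = 0\<close>, but it is locally Lipschitz for all \<open>\<alpha> \<ge> 0\<close>. This
  controls every error made by smoothing.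
\<close>

lemma potential_lipschitz:
  assumes "\<bar>x\<bar> \<le> C" "\<bar>y\<bar> \<le> C" "0 \<le> \<alpha>" "1 \<le> \<beta>" "0 \<le> F" "F \<le> \<Lambda>" "0 \<le> G" "G \<le> \<Lambda>"
  shows "\<bar>potential \<alpha> \<beta> F G x - potential \<alpha> \<beta> F G y\<bar> \<le> \<Lambda> * (C powr \<beta> + C powr \<alpha>) * \<bar>x - y\<bar>"
proof -
  have part: "\<bar>H * (\<bar>x\<bar> powr (c + 1)) / (c + 1) - H * (\<bar>y\<bar> powr (c + 1)) / (c + 1)\<bar> \<le> \<Lambda> * C powr c * \<bar>x - y\<bar>"
    if "0 \<le> H" "H \<le> \<Lambda>" "0 \<le> c" for H c
  proof -
    have "\<bar>\<bar>x\<bar> powr (c + 1) - \<bar>y\<bar> powr (c + 1)\<bar> \<le> (c + 1) * (C powr c * \<bar>x - y\<bar>)"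
      using powr_lipschitz[OF assms(1,2), of "c + 1"] that by (simp add: mult.assoc)
    then have "\<bar>(\<bar>x\<bar> powr (c + 1) - \<bar>y\<bar> powr (c + 1)) / (c + 1)\<bar> \<le> C powr c * \<bar>x - y\<bar>"
      using that by (simp add: abs_divide pos_divide_le_eq mult.commute)
    then have "H * \<bar>(\<bar>x\<bar> powr (c + 1) - \<bar>y\<bar> powr (c + 1)) / (c + 1)\<bar> \<le> \<Lambda> * (C powr c * \<bar>x - y\<bar>)"
      using that by (intro mult_mono) auto
    moreover have "H * (\<bar>x\<bar> powr (c + 1)) / (c + 1) - H * (\<bar>y\<bar> powr (c + 1)) / (c + 1)
        = H * ((\<bar>x\<bar> powr (c + 1) - \<bar>y\<bar> powr (c + 1)) / (c + 1))"
      by (simp add: right_diff_distrib diff_divide_distrib)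
    ultimately show ?thesis using that by (simp add: abs_mult mult.assoc)
  qed
  have sum: "\<Lambda> * (C powr \<beta> + C powr \<alpha>) * \<bar>x - y\<bar> = \<Lambda> * C powr \<beta> * \<bar>x - y\<bar> + \<Lambda> * C powr \<alpha> * \<bar>x - y\<bar>"
    by (simp add: distrib_left distrib_right)
  have tri: "\<bar>(g1 - f1) - (g2 - f2)\<bar> \<le> l1 + l2" if "\<bar>g1 - g2\<bar> \<le> l1" "\<bar>f1 - f2\<bar> \<le> l2"
    for g1 g2 f1 f2 l1 l2 :: real using that by linarith
  show ?thesis
    unfolding potential_def sum by (rule tri; rule part) (use assms in auto)
qed

lemma potential_has_derivative:
  assumes "x > 0" "0 \<le> \<alpha>" "0 \<le> \<beta>"
  shows "(potential \<alpha> \<beta> F G has_real_derivative (G * x powr \<beta> - F * x powr \<alpha>)) (at x)"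
proof -
  have part: "((\<lambda>t. H * t powr (c + 1) / (c + 1)) has_real_derivative (H * x powr c)) (at x)" if "0 \<le> c" for H c
  proof -
    have "((\<lambda>t. H * t powr (c + 1) / (c + 1)) has_real_derivative (H * ((c + 1) * x powr (c + 1 - 1)) / (c + 1))) (at x)"
      using assms(1) by (intro DERIV_cdivide DERIV_cmult has_real_derivative_powr)
    then show ?thesis using that by simp
  qed
  have "((\<lambda>t. G * t powr (\<beta> + 1) / (\<beta> + 1) - F * t powr (\<alpha> + 1) / (\<alpha> + 1)) has_real_derivative
      (G * x powr \<beta> - F * x powr \<alpha>)) (at x)"
    using assms by (intro DERIV_diff part)
  moreover have "\<forall>\<^sub>F t in nhds x. t > 0"
    using assms(1) by (intro eventually_nhds_in_open[of "{0<..}", simplified]) auto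
  then have "\<forall>\<^sub>F t in nhds x. G * t powr (\<beta> + 1) / (\<beta> + 1) - F * t powr (\<alpha> + 1) / (\<alpha> + 1) = potential \<alpha> \<beta> F G t"
    by eventually_elim (simp add: potential_def)
  ultimately show ?thesis by (subst DERIV_cong_ev[OF refl _ refl, symmetric]) auto
qed

text \<open>
  Beyond \<open>M\<close> the potential is nondecreasing: \<open>F t\<^sup>\<alpha> \<le> G M\<^sup>1\<^sup>-\<^sup>\<alpha> t\<^sup>\<alpha> \<le> G t \<le> G t\<^sup>\<beta>\<close> for \<open>t \<ge> M \<ge> 1\<close>.
\<close>

lemma potential_truncate:
  assumes "0 \<le> s" "1 \<le> M" "0 \<le> \<alpha>" "\<alpha> < 1" "1 \<le> \<beta>" "0 \<le> G" "F \<le> G * M powr (1 - \<alpha>)"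
  shows "potential \<alpha> \<beta> F G (min s M) \<le> potential \<alpha> \<beta> F G s"
proof (cases "s \<le> M")
  case False
  have "potential \<alpha> \<beta> F G M \<le> potential \<alpha> \<beta> F G s"
  proof (rule DERIV_nonneg_imp_nondecreasing[where f = "potential \<alpha> \<beta> F G"])
    fix t assume t: "M \<le> t" "t \<le> s"
    have "F * t powr \<alpha> \<le> G * M powr (1 - \<alpha>) * t powr \<alpha>" using assms by (intro mult_right_mono) auto
    also have "\<dots> \<le> G * t powr (1 - \<alpha>) * t powr \<alpha>"
      using assms t by (intro mult_right_mono mult_left_mono powr_mono2) auto
    also have "\<dots> = G * t powr 1" by (simp add: powr_add[symmetric])
    also have "\<dots> \<le> G * t powr \<beta>" using assms t by (intro mult_left_mono powr_mono) auto
    finally have "0 \<le> G * t powr \<beta> - F * t powr \<alpha>" by simp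
    moreover have "(potential \<alpha> \<beta> F G has_real_derivative (G * t powr \<beta> - F * t powr \<alpha>)) (at t)"
      using assms t by (intro potential_has_derivative) auto
    ultimately show "\<exists>y. (potential \<alpha> \<beta> F G has_real_derivative y) (at t) \<and> 0 \<le> y" by blast
  qed (use False in simp)
  then show ?thesis using False by simp
qed simp

text \<open>
  The mean value theorem on the two halves of the interval. The derivative is used in the interior
  only, because powers with exponent less than one are not differentiable at the endpoint zero.
\<close>

lemma midpoint_concave:
  fixes h :: "real \<Rightarrow> real"
  assumes cont: "continuous_on {a..b} h" and "a < b"
    and der: "\<And>t. a < t \<Longrightarrow> t < b \<Longrightarrow> (h has_real_derivative h' t) (at t)"
    and dec: "\<And>s t. a < s \<Longrightarrow> s < t \<Longrightarrow> t < b \<Longrightarrow> h' t \<le> h' s"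
  shows "h a + h b \<le> 2 * h ((a + b) / 2)"
proof -
  let ?m = "(a + b) / 2"
  have mvt: "\<exists>z. u < z \<and> z < v \<and> h v - h u = (v - u) * h' z" if uv: "a \<le> u" "u < v" "v \<le> b" for u v
  proof -
    have "\<exists>l z. u < z \<and> z < v \<and> (h has_real_derivative l) (at z) \<and> h v - h u = (v - u) * l"
    proof (rule MVT)
      show "continuous_on {u..v} h" using cont by (rule continuous_on_subset) (use uv in auto)
      show "h differentiable (at t)" if "u < t" "t < v" for t
        using der[of t] that uv real_differentiable_def by force
    qed (use uv in auto)
    then obtain l z where z: "u < z" "z < v" "(h has_real_derivative l) (at z)" "h v - h u = (v - u) * l" by blast
    moreover have "l = h' z" using z(3) der[of z] z uv DERIV_unique by force
    ultimately show ?thesis by blast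
  qed
  obtain z1 where z1: "a < z1" "z1 < ?m" "h ?m - h a = (?m - a) * h' z1" using mvt[of a ?m] assms(2) by force
  obtain z2 where z2: "?m < z2" "z2 < b" "h b - h ?m = (b - ?m) * h' z2" using mvt[of ?m b] assms(2) by force
  have "(b - ?m) * h' z2 \<le> (b - ?m) * h' z1" using z1 z2 assms(2) by (intro mult_left_mono dec) auto
  moreover have eq: "?m - a = b - ?m" by (simp add: field_simps)
  ultimately show ?thesis using z1(3)[unfolded eq] z2(3) by linarith
qed

lemma powr_midpoint_convex:
  fixes X Y \<sigma> :: real
  assumes "0 \<le> X" "0 \<le> Y" "1 \<le> \<sigma>"
  shows "2 * ((X + Y) / 2) powr \<sigma> \<le> X powr \<sigma> + Y powr \<sigma>"
proof -
  have *: "2 * ((X + Y) / 2) powr \<sigma> \<le> X powr \<sigma> + Y powr \<sigma>" if "0 \<le> X" "X < Y" for X Y :: real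
  proof -
    have "- (X powr \<sigma>) + - (Y powr \<sigma>) \<le> 2 * - (((X + Y) / 2) powr \<sigma>)"
    proof (rule midpoint_concave[where h' = "\<lambda>t. - (\<sigma> * t powr (\<sigma> - 1))"])
      show "continuous_on {X..Y} (\<lambda>t. - (t powr \<sigma>))"
        using that assms by (intro continuous_on_minus powr_continuous_on) auto
      show "((\<lambda>t. - (t powr \<sigma>)) has_real_derivative - (\<sigma> * t powr (\<sigma> - 1))) (at t)" if "X < t" "t < Y" for t
        using that \<open>0 \<le> X\<close> by (intro DERIV_minus has_real_derivative_powr) auto
      show "- (\<sigma> * t powr (\<sigma> - 1)) \<le> - (\<sigma> * s powr (\<sigma> - 1))" if "X < s" "s < t" "t < Y" for s t
        using that \<open>0 \<le> X\<close> assms by (auto intro!: mult_left_mono powr_mono2)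
    qed (rule that)
    then show ?thesis by simp
  qed
  consider "X < Y" | "Y < X" | "X = Y" by linarith
  then show ?thesis
    using *[of X Y] *[of Y X] assms by cases (auto simp: add.commute)
qed

text \<open>
  On \<open>[0, R]\<close> the second derivative of \<open>t\<^sup>s\<close> is at most \<open>- s (1 - s) R\<^sup>s\<^sup>-\<^sup>2\<close>, so \<open>t\<^sup>s\<close> stays concave
  after adding \<open>k t\<^sup>2\<close> with \<open>2 k = s (1 - s) R\<^sup>s\<^sup>-\<^sup>2\<close>. The midpoint defect of the square gives the extra term.
\<close>

lemma powr_midpoint_uniformly_concave:
  fixes X Y s R :: real
  assumes "0 \<le> X" "X \<le> R" "0 \<le> Y" "Y \<le> R" "0 < s" "s < 1"
  shows "X powr s + Y powr s + s * (1 - s) * R powr (s - 2) / 4 * (X - Y)\<^sup>2 \<le> 2 * ((X + Y) / 2) powr s"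
proof -
  define k where "k = s * (1 - s) * R powr (s - 2) / 2"
  have *: "X powr s + Y powr s + k / 2 * (X - Y)\<^sup>2 \<le> 2 * ((X + Y) / 2) powr s"
    if XY: "0 \<le> X" "X < Y" "Y \<le> R" for X Y :: real
  proof -
    have "(X powr s + k * X\<^sup>2) + (Y powr s + k * Y\<^sup>2) \<le> 2 * (((X + Y) / 2) powr s + k * ((X + Y) / 2)\<^sup>2)"
    proof (rule midpoint_concave[where h' = "\<lambda>t. s * t powr (s - 1) + k * (2 * t)"])
      show "continuous_on {X..Y} (\<lambda>t. t powr s + k * t\<^sup>2)"
        using that assms by (intro continuous_on_add powr_continuous_on continuous_intros) auto
      show "((\<lambda>t. t powr s + k * t\<^sup>2) has_real_derivative s * t powr (s - 1) + k * (2 * t)) (at t)" if "X < t" "t < Y" for t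
        using that \<open>0 \<le> X\<close> by (auto intro!: derivative_eq_intros has_real_derivative_powr)
      show "s * t powr (s - 1) + k * (2 * t) \<le> s * r powr (s - 1) + k * (2 * r)" if r: "X < r" "r < t" "t < Y" for r t
      proof -
        have "\<exists>z>r. z < t \<and> t powr (s - 1) - r powr (s - 1) = (t - r) * ((s - 1) * z powr (s - 1 - 1))"
          using r XY by (intro MVT2 has_real_derivative_powr) auto
        then obtain z where z: "r < z" "z < t" "t powr (s - 1) - r powr (s - 1) = (t - r) * ((s - 1) * z powr (s - 2))"
          by auto
        have "R powr (s - 2) \<le> z powr (s - 2)"
          using z r XY assms by (intro powr_mono2') auto
        then have "(t - r) * (s * (1 - s)) * R powr (s - 2) \<le> (t - r) * (s * (1 - s)) * z powr (s - 2)"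
          using r assms by (intro mult_left_mono) auto
        moreover have "s * r powr (s - 1) - s * t powr (s - 1) = (t - r) * (s * (1 - s)) * z powr (s - 2)"
        proof -
          have "s * r powr (s - 1) - s * t powr (s - 1) = - (s * (t powr (s - 1) - r powr (s - 1)))"
            by (simp add: right_diff_distrib)
          also have "\<dots> = (t - r) * (s * (1 - s)) * z powr (s - 2)"
            unfolding z(3) by algebra
          finally show ?thesis .
        qed
        moreover have "k * (2 * t) - k * (2 * r) = (t - r) * (s * (1 - s)) * R powr (s - 2)"
          unfolding k_def by algebra
        ultimately show ?thesis by linarith
      qed
    qed (rule XY(2))
    then show ?thesis by (simp add: power2_eq_square field_simps)
  qed
  consider "X < Y" | "Y < X" | "X = Y" by linarith
  then have "X powr s + Y powr s + k / 2 * (X - Y)\<^sup>2 \<le> 2 * ((X + Y) / 2) powr s"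
    using *[of X Y] *[of Y X] assms by cases (auto simp: add.commute power2_commute)
  then show ?thesis by (simp add: k_def)
qed

text \<open>
  In terms of \<open>X = x\<^sup>2\<close> the source contributes \<open>- X\<^sup>s\<close> with \<open>s = (\<alpha> + 1) / 2 < 1\<close>, which is uniformly
  convex on bounded intervals, and the absorption contributes \<open>X\<^sup>\<sigma>\<close> with \<open>\<sigma> = (\<beta> + 1) / 2 \<ge> 1\<close>, which is
  convex.
\<close>

lemma potential_hidden_convexity:
  assumes x: "0 \<le> x" "x \<le> B" and y: "0 \<le> y" "y \<le> B"
    and "0 \<le> \<alpha>" "\<alpha> < 1" "1 \<le> \<beta>" "0 \<le> a0" "a0 \<le> F" "0 \<le> G"
  shows "potential \<alpha> \<beta> F G (sqrt ((x\<^sup>2 + y\<^sup>2) / 2)) + a0 * (1 - \<alpha>) * B powr (\<alpha> - 3) / 64 * (x\<^sup>2 - y\<^sup>2)\<^sup>2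
    \<le> (potential \<alpha> \<beta> F G x + potential \<alpha> \<beta> F G y) / 2"
proof -
  define s \<sigma> where "s = (\<alpha> + 1) / 2" and "\<sigma> = (\<beta> + 1) / 2"
  let ?m = "(x\<^sup>2 + y\<^sup>2) / 2"
  have sq: "\<bar>t\<bar> powr (c + 1) = (t\<^sup>2) powr ((c + 1) / 2)" for t c :: real
  proof (cases "t = 0")
    case False
    have "(t\<^sup>2) powr ((c + 1) / 2) = (\<bar>t\<bar> powr 2) powr ((c + 1) / 2)" using False by (simp add: powr_numeral)
    also have "\<dots> = \<bar>t\<bar> powr (2 * ((c + 1) / 2))" by (rule powr_powr)
    also have "2 * ((c + 1) / 2) = c + 1" by simp
    finally show ?thesis by simp
  qed simp
  have rt: "(sqrt ?m)\<^sup>2 = ?m" by (intro real_sqrt_pow2) auto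
  define p d where "p = G / (\<beta> + 1)" and "d = F / (\<alpha> + 1)"
  have pot: "potential \<alpha> \<beta> F G t = p * (t\<^sup>2) powr \<sigma> - d * (t\<^sup>2) powr s" for t
    unfolding potential_def sq s_def \<sigma>_def p_def d_def by simp
  have R: "(B\<^sup>2) powr (s - 2) = B powr (\<alpha> - 3)"
  proof (cases "B = 0")
    case False
    then have "(B\<^sup>2) powr (s - 2) = (B powr 2) powr (s - 2)" using x by (simp add: powr_numeral)
    also have "\<dots> = B powr (2 * (s - 2))" by (rule powr_powr)
    also have "2 * (s - 2) = \<alpha> - 3" by (simp add: s_def)
    finally show ?thesis .
  qed simp
  let ?k = "s * (1 - s) * B powr (\<alpha> - 3) / 4"
  have conc: "(x\<^sup>2) powr s + (y\<^sup>2) powr s + ?k * (x\<^sup>2 - y\<^sup>2)\<^sup>2 \<le> 2 * ?m powr s"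
  proof -
    have "x\<^sup>2 \<le> B\<^sup>2" "y\<^sup>2 \<le> B\<^sup>2" "0 < s" "s < 1"
      using assms by (auto simp: s_def intro: power_mono)
    then show ?thesis
      using powr_midpoint_uniformly_concave[of "x\<^sup>2" "B\<^sup>2" "y\<^sup>2" s] unfolding R by simp
  qed
  have conv: "2 * ?m powr \<sigma> \<le> (x\<^sup>2) powr \<sigma> + (y\<^sup>2) powr \<sigma>"
    using assms by (intro powr_midpoint_convex) (auto simp: \<sigma>_def)
  define D where "D = (x\<^sup>2 - y\<^sup>2)\<^sup>2"
  have pd: "p \<ge> 0" "d \<ge> 0" using assms by (auto simp: p_def d_def)
  note 1 = mult_left_mono[OF conv pd(1)] and 2 = mult_left_mono[OF conc[folded D_def] pd(2)]
  have 3: "a0 / 2 * ((1 - \<alpha>) * B powr (\<alpha> - 3) / 16 * D) \<le> d * (?k * D)"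
    unfolding d_def
  proof (rule mult_mono)
    show "a0 / 2 \<le> F / (\<alpha> + 1)" using assms by (intro frac_le) auto
    have "(1 - \<alpha>) / 4 \<le> s * (1 - s)"
    proof -
      have "1 / 2 * ((1 - \<alpha>) / 2) \<le> s * ((1 - \<alpha>) / 2)" using assms by (intro mult_right_mono) (auto simp: s_def)
      moreover have eq: "1 - s = (1 - \<alpha>) / 2" by (simp add: s_def field_simps)
      ultimately show ?thesis unfolding eq by simp
    qed
    then have "(1 - \<alpha>) / 4 * (B powr (\<alpha> - 3) / 4 * D) \<le> s * (1 - s) * (B powr (\<alpha> - 3) / 4 * D)"
      by (intro mult_right_mono) (auto simp: D_def)
    then show "(1 - \<alpha>) * B powr (\<alpha> - 3) / 16 * D \<le> ?k * D" by simp
  qed (use assms in \<open>auto simp: D_def\<close>)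
  have lin: "2 * (P - Q) + A \<le> P1 - Q1 + (P2 - Q2)"
    if "2 * P \<le> P1 + P2" "Q1 + Q2 + K \<le> 2 * Q" "A \<le> K" for P Q P1 P2 Q1 Q2 K A :: real
    using that by argo
  have "2 * potential \<alpha> \<beta> F G (sqrt ?m) + a0 / 2 * ((1 - \<alpha>) * B powr (\<alpha> - 3) / 16 * D)
      \<le> potential \<alpha> \<beta> F G x + potential \<alpha> \<beta> F G y"
    unfolding pot rt using lin[OF 1[unfolded distrib_left mult.left_commute[of p 2]]
      2[unfolded distrib_left mult.left_commute[of d 2]] 3] .
  moreover have "a0 / 2 * ((1 - \<alpha>) * B powr (\<alpha> - 3) / 16 * D) = 2 * (a0 * (1 - \<alpha>) * B powr (\<alpha> - 3) / 64 * D)"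
    by simp
  ultimately show ?thesis unfolding D_def by argo
qed

text \<open>
  Raising a value \<open>x\<close> to a larger but small value \<open>v\<close> lowers the potential by at least a multiple of
  \<open>v\<^sup>\<alpha> (v - x)\<close>. Since \<open>v = v\<^sup>1\<^sup>-\<^sup>\<alpha> v\<^sup>\<alpha>\<close> and \<open>v\<^sup>1\<^sup>-\<^sup>\<alpha>\<close> is small, the gain
  outweighs the linear cost \<open>Q v (v - x)\<close>.
\<close>

lemma potential_subsolution:
  assumes "0 \<le> x" "0 \<le> v" "v \<le> c" "c \<le> 1" "0 \<le> \<alpha>" "\<alpha> < 1" "1 \<le> \<beta>" "0 \<le> F" "0 \<le> G" "0 \<le> Q"
    and c: "(Q + G + 1) * c powr (1 - \<alpha>) \<le> F / 2"
  shows "Q * v * max 0 (v - x) + potential \<alpha> \<beta> F G (max x v) - potential \<alpha> \<beta> F G x \<le> - (v * max 0 (v - x))"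
proof (cases "x < v")
  case True
  then have v: "v > 0" "v \<le> 1" using assms by auto
  have A: "v powr \<alpha> * (v - x) \<le> v powr (\<alpha> + 1) - x powr (\<alpha> + 1)"
  proof -
    have "x powr (\<alpha> + 1) = x powr \<alpha> * x" using assms by (cases "x = 0") (auto simp: powr_add)
    also have "\<dots> \<le> v powr \<alpha> * x" using assms True by (intro mult_right_mono powr_mono2) auto
    finally show ?thesis using v by (simp add: powr_add algebra_simps)
  qed
  have Bd: "v powr (\<beta> + 1) - x powr (\<beta> + 1) \<le> (\<beta> + 1) * (v * (v - x))"
  proof -
    obtain z where z: "x < z" "z < v" "v powr (\<beta> + 1) - x powr (\<beta> + 1) = (v - x) * ((\<beta> + 1) * z powr \<beta>)"
      using powr_mean_value[of x v "\<beta> + 1"] assms True by auto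
    have "z powr \<beta> \<le> v powr \<beta>" using z assms by (intro powr_mono2) auto
    also have "\<dots> \<le> v powr 1" using v assms by (intro powr_mono') auto
    finally have "(v - x) * ((\<beta> + 1) * z powr \<beta>) \<le> (v - x) * ((\<beta> + 1) * v)"
      using v True assms by (intro mult_left_mono) auto
    then show ?thesis using z(3) by (simp add: algebra_simps)
  qed
  have "G * ((v powr (\<beta> + 1) - x powr (\<beta> + 1)) / (\<beta> + 1)) \<le> G * (v * (v - x))"
    using Bd assms by (intro mult_left_mono) (auto simp: pos_divide_le_eq mult_ac)
  moreover have "F / 2 * (v powr \<alpha> * (v - x)) \<le> F / (\<alpha> + 1) * (v powr (\<alpha> + 1) - x powr (\<alpha> + 1))"
    using assms A True by (intro mult_mono frac_le) auto
  moreover have "potential \<alpha> \<beta> F G v - potential \<alpha> \<beta> F G x =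
     G * ((v powr (\<beta> + 1) - x powr (\<beta> + 1)) / (\<beta> + 1)) - F / (\<alpha> + 1) * (v powr (\<alpha> + 1) - x powr (\<alpha> + 1))"
    using assms by (simp add: potential_def right_diff_distrib diff_divide_distrib)
  ultimately have 1: "potential \<alpha> \<beta> F G v - potential \<alpha> \<beta> F G x \<le> G * (v * (v - x)) - F / 2 * (v powr \<alpha> * (v - x))"
    by linarith
  have "(Q + G + 1) * v = (Q + G + 1) * (v powr (1 - \<alpha>) * v powr \<alpha>)"
    using v by (simp add: powr_add[symmetric])
  also have "\<dots> \<le> (Q + G + 1) * (c powr (1 - \<alpha>) * v powr \<alpha>)"
    using assms by (intro mult_left_mono mult_right_mono powr_mono2) auto
  also have "\<dots> \<le> F / 2 * v powr \<alpha>"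
    using mult_right_mono[OF c, of "v powr \<alpha>"] by (simp add: mult.assoc)
  finally have "(Q + G + 1) * v * (v - x) \<le> F / 2 * v powr \<alpha> * (v - x)"
    using True by (intro mult_right_mono) auto
  with 1 show ?thesis using True by (simp add: algebra_simps)
qed (use assms in simp)

lemma small_constant_exists:
  fixes \<alpha> P F :: real
  assumes "\<alpha> < 1" "P > 0" "F > 0"
  obtains c where "0 < c" "c \<le> 1" "P * c powr (1 - \<alpha>) \<le> F"
proof
  let ?c = "min 1 ((F / P) powr (1 / (1 - \<alpha>)))"
  show "0 < ?c" "?c \<le> 1" using assms by auto
  have "?c powr (1 - \<alpha>) \<le> ((F / P) powr (1 / (1 - \<alpha>))) powr (1 - \<alpha>)"
    using assms by (intro powr_mono2) auto
  also have "\<dots> = F / P" using assms by (simp add: powr_powr)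
  finally show "P * ?c powr (1 - \<alpha>) \<le> F" using assms by (simp add: pos_le_divide_eq mult.commute)
qed

section \<open>Smoothed lattice operations\<close>

definition soft_abs :: "real \<Rightarrow> real \<Rightarrow> real" where
  "soft_abs \<delta> t = sqrt (t\<^sup>2 + \<delta>\<^sup>2)"

lemma soft_abs_pos: "\<delta> > 0 \<Longrightarrow> 0 < soft_abs \<delta> t"
  unfolding soft_abs_def by (intro real_sqrt_gt_zero add_nonneg_pos) auto

lemma soft_abs_bounds:
  assumes "\<delta> > 0"
  shows "\<bar>t\<bar> \<le> soft_abs \<delta> t" "soft_abs \<delta> t \<le> \<bar>t\<bar> + \<delta>" "\<delta> \<le> soft_abs \<delta> t"
proof -
  show "\<bar>t\<bar> \<le> soft_abs \<delta> t" "\<delta> \<le> soft_abs \<delta> t"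
    unfolding soft_abs_def by (auto intro!: real_le_rsqrt)
  show "soft_abs \<delta> t \<le> \<bar>t\<bar> + \<delta>"
    unfolding soft_abs_def using assms by (intro real_le_lsqrt) (auto simp: power2_sum)
qed

lemma soft_abs_has_derivative:
  assumes "\<delta> > 0"
  shows "(soft_abs \<delta> has_real_derivative t / soft_abs \<delta> t) (at t)"
proof -
  have "t\<^sup>2 + \<delta>\<^sup>2 > 0" using assms by (intro add_nonneg_pos) auto
  then show ?thesis
    unfolding soft_abs_def[abs_def]
    by (auto intro!: derivative_eq_intros simp: field_simps)
qed

lemma soft_abs_slope: "\<delta> > 0 \<Longrightarrow> \<bar>t / soft_abs \<delta> t\<bar> \<le> 1"
  using soft_abs_bounds(1)[of \<delta> t] soft_abs_pos[of \<delta> t] by (simp add: abs_divide)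

lemma smooth_soft_abs: "smooth f \<Longrightarrow> \<delta> > 0 \<Longrightarrow> smooth (\<lambda>x. soft_abs \<delta> (f x))"
  unfolding soft_abs_def
  by (intro smooth_sqrt smooth_add smooth_power2 smooth_const add_nonneg_pos) auto

section \<open>The energy functional\<close>

text \<open>
  The problem with frozen coefficients. The constants \<open>a0\<close> and \<open>\<Lambda>\<close> bound the values of \<open>f\<close> and \<open>g\<close>,
  and the condition on \<open>M\<close> says that \<open>F s\<^sup>\<alpha> \<le> G s\<^sup>\<beta>\<close> for all \<open>s \<ge> M\<close>.
\<close>

locale frozen_problem = bounded_domain \<Omega> for \<Omega> :: "'a::euclidean_space set" +
  fixes \<alpha> \<beta> a0 \<Lambda> M :: real
  assumes \<alpha>: "0 \<le> \<alpha>" "\<alpha> < 1" and \<beta>: "1 \<le> \<beta>"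
    and a0: "0 < a0" "a0 \<le> \<Lambda>" and M: "1 \<le> M" "\<Lambda> \<le> a0 * M powr (1 - \<alpha>)"
begin

abbreviation "pot \<equiv> potential \<alpha> \<beta>"

text \<open>
  The number \<open>A\<close> is bounded from below only. Thus the bound \<open>B\<close> for the minimizers can be fixed before
  a bound for the values of \<open>a\<close>, which are taken at integrals of minimizers.
\<close>

definition admissible :: "real \<Rightarrow> real \<Rightarrow> real \<Rightarrow> bool" where
  "admissible A F G \<longleftrightarrow> a0 \<le> A \<and> F \<in> {a0..\<Lambda>} \<and> G \<in> {a0..\<Lambda>}"

text \<open>
  The smoothed truncation at \<open>M\<close> overshoots \<open>M\<close> slightly; one unit of room is enough.
\<close>

definition B :: real where "B = M + 1"

definition Lip :: "real \<Rightarrow> real" where "Lip C = \<Lambda> * (C powr \<beta> + C powr \<alpha>)"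

definition vol :: real where "vol = measure \<mu> (space \<mu>)"

text \<open>
  The function and its gradient are separate arguments, so that the energy is also available for
  limits of test functions, whose gradient is the limit of the gradients.
\<close>

definition energy :: "real \<Rightarrow> real \<Rightarrow> real \<Rightarrow> ('a \<Rightarrow> real) \<Rightarrow> ('a \<Rightarrow> 'a) \<Rightarrow> real" where
  "energy A F G u V = A / 2 * (LINT x|\<mu>. (norm (V x))\<^sup>2) + (LINT x|\<mu>. pot F G (u x))"

abbreviation "J A F G \<phi> \<equiv> energy A F G \<phi> (grad \<phi>)"

definition min_energy :: "real \<Rightarrow> real \<Rightarrow> real \<Rightarrow> real" where
  "min_energy A F G = Inf (J A F G ` test)"

definition capped_test :: "('a \<Rightarrow> real) set" where
  "capped_test = {\<phi> \<in> test. \<forall>x. 0 \<le> \<phi> x \<and> \<phi> x \<le> B}"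

lemma admissibleD:
  assumes "admissible A F G"
  shows "0 < A" "0 < F" "0 < G" "a0 \<le> A" "a0 \<le> F" "a0 \<le> G" "F \<le> \<Lambda>" "G \<le> \<Lambda>"
  using assms a0 by (auto simp: admissible_def)

lemma B_ge: "2 \<le> B" "M \<le> B" "0 < B"
  using M by (auto simp: B_def)

lemma Lip_nonneg: "0 \<le> Lip C"
  unfolding Lip_def using a0 by auto

lemma vol_nonneg: "0 \<le> vol"
  by (simp add: vol_def)

lemma pot_lipschitz:
  assumes "admissible A F G" "\<bar>s\<bar> \<le> C" "\<bar>t\<bar> \<le> C"
  shows "\<bar>pot F G s - pot F G t\<bar> \<le> Lip C * \<bar>s - t\<bar>"
  unfolding Lip_def using assms \<alpha> \<beta> admissibleD[OF assms(1)] by (intro potential_lipschitz) auto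

lemma pot_measurable [measurable]: "pot F G \<in> borel_measurable borel"
  unfolding potential_def[abs_def] by measurable

lemma pot_0: "pot F G 0 = 0"
  by (simp add: potential_def)

lemma pot_abs: "pot F G \<bar>t\<bar> = pot F G t"
  by (simp add: potential_def)

lemma pot_bound:
  assumes "admissible A F G" "\<bar>s\<bar> \<le> C"
  shows "\<bar>pot F G s\<bar> \<le> Lip C * C"
proof -
  have "\<bar>pot F G s - pot F G 0\<bar> \<le> Lip C * \<bar>s - 0\<bar>"
    using assms abs_ge_zero[of s] by (intro pot_lipschitz) auto
  also have "\<dots> \<le> Lip C * C" using assms Lip_nonneg by (intro mult_left_mono) auto
  finally show ?thesis by (simp add: pot_0)
qed

lemma pot_integrable:
  assumes "admissible A F G" "u \<in> borel_measurable \<mu>" "\<And>x. \<bar>u x\<bar> \<le> C"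
  shows "integrable \<mu> (\<lambda>x. pot F G (u x))"
  by (rule bounded_integrable[of _ "Lip C * C"]) (use assms pot_bound in auto)

lemma pot_test_integrable: "admissible A F G \<Longrightarrow> \<phi> \<in> test \<Longrightarrow> integrable \<mu> (\<lambda>x. pot F G (\<phi> x))"
  using test_bounded[of \<phi> \<Omega>] pot_integrable[OF _ test_measurable] by metis

lemma grad_test_square_integrable: "\<phi> \<in> test \<Longrightarrow> integrable \<mu> (\<lambda>x. (norm (grad \<phi> x))\<^sup>2)"
  using L2_D(2)[OF grad_test_in_L2] .

lemma integral_const_vol: "(LINT x|\<mu>. c) = c * vol"
  by (simp add: vol_def mult.commute)

lemma capped_testD:
  assumes "\<phi> \<in> capped_test"
  shows "\<phi> \<in> test" "0 \<le> \<phi> x" "\<phi> x \<le> B" "\<bar>\<phi> x\<bar> \<le> B"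
  using assms by (auto simp: capped_test_def)

text \<open>
  The common form of the comparison arguments below: pointwise bounds for a competitor, up to a
  constant \<open>k\<close> that accounts for the smoothing.
\<close>

lemma energy_compare:
  assumes adm: "admissible A F G" and \<psi>: "\<psi> \<in> test"
    and g: "integrable \<mu> g" "\<And>x. (norm (grad \<psi> x))\<^sup>2 \<le> g x"
    and h: "integrable \<mu> h" "\<And>x. pot F G (\<psi> x) \<le> h x + k"
  shows "J A F G \<psi> \<le> A / 2 * (LINT x|\<mu>. g x) + (LINT x|\<mu>. h x) + k * vol"
proof -
  have "(LINT x|\<mu>. (norm (grad \<psi> x))\<^sup>2) \<le> (LINT x|\<mu>. g x)"
    using \<psi> g by (intro integral_mono grad_test_square_integrable) auto
  then have 1: "A / 2 * (LINT x|\<mu>. (norm (grad \<psi> x))\<^sup>2) \<le> A / 2 * (LINT x|\<mu>. g x)"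
    using admissibleD[OF adm] by (intro mult_left_mono) auto
  have "(LINT x|\<mu>. pot F G (\<psi> x)) \<le> (LINT x|\<mu>. h x + k)"
    using \<psi> h adm by (intro integral_mono pot_test_integrable) auto
  also have "\<dots> = (LINT x|\<mu>. h x) + k * vol"
    using h by (simp add: integral_const_vol[symmetric])
  finally show ?thesis using 1 by (simp add: energy_def)
qed

text \<open>
  The competitor is a smooth version of \<open>min |\<phi>| M\<close>. The two functions composed with \<open>\<phi>\<close> have slopes
  between \<open>-1\<close> and \<open>1\<close>, so the Dirichlet integral does not increase, and the potential increases
  only by its Lipschitz constant times the smoothing error.
\<close>

lemma truncation:
  assumes adm: "admissible A F G" and \<phi>: "\<phi> \<in> test" and \<epsilon>: "\<epsilon> > 0"
  obtains \<psi> where "\<psi> \<in> capped_test" "J A F G \<psi> \<le> J A F G \<phi> + \<epsilon>"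
proof -
  \<comment> \<open>The truncated function differs from \<open>min |\<phi>| M\<close> by at most \<open>2 \<delta>\<close>; the summand 1 avoids a division by zero.\<close>
  define \<delta> where "\<delta> = min 1 (\<epsilon> / (2 * Lip B * vol + 1))"
  have pos: "2 * Lip B * vol + 1 > 0" using Lip_nonneg[of B] vol_nonneg by (intro add_nonneg_pos mult_nonneg_nonneg) auto
  have \<delta>: "0 < \<delta>" "\<delta> \<le> 1" using \<epsilon> pos by (auto simp: \<delta>_def)
  have \<delta>e: "Lip B * (2 * \<delta>) * vol \<le> \<epsilon>"
  proof -
    have "\<delta> * (2 * Lip B * vol + 1) \<le> \<epsilon>" using pos by (simp add: \<delta>_def pos_le_divide_eq[symmetric])
    then show ?thesis using \<delta> by (simp add: algebra_simps)
  qed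
  define s where "s x = soft_abs \<delta> (\<phi> x) - \<delta>" for x
  \<comment> \<open>This is \<open>min s M = (s + M - |s - M|) / 2\<close>, smoothed and shifted so that it vanishes with \<open>s\<close>.\<close>
  define \<psi> where "\<psi> x = (s x - soft_abs \<delta> (s x - M) + soft_abs \<delta> M) / 2" for x
  note sb = soft_abs_bounds[OF \<delta>(1)]
  have sms: "smooth s"
    unfolding s_def[abs_def] by (intro smooth_diff smooth_const smooth_soft_abs test_smooth[OF \<phi>] \<delta>)
  have sm\<psi>: "smooth \<psi>"
  proof -
    have "smooth (\<lambda>x. (1/2) * (s x - soft_abs \<delta> (s x - M) + soft_abs \<delta> M))"
      by (intro smooth_diff smooth_add smooth_mult smooth_const smooth_soft_abs sms \<delta>)
    then show ?thesis by (simp add: \<psi>_def[abs_def])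
  qed
  have s0: "0 \<le> s x" for x using sb(3)[of "\<phi> x"] by (simp add: s_def)
  have s\<phi>: "\<bar>s x - \<bar>\<phi> x\<bar>\<bar> \<le> \<delta>" for x using sb(1,2)[of "\<phi> x"] \<delta> by (simp add: s_def)
  have \<psi>0: "0 \<le> \<psi> x" for x
  proof -
    have "soft_abs \<delta> (s x - M) \<le> s x + soft_abs \<delta> M"
      unfolding soft_abs_def[of \<delta> "s x - M"]
    proof (rule real_le_lsqrt)
      show "0 \<le> s x + soft_abs \<delta> M" using s0[of x] soft_abs_pos[OF \<delta>(1), of M] by simp
      have "(soft_abs \<delta> M)\<^sup>2 = M\<^sup>2 + \<delta>\<^sup>2" unfolding soft_abs_def by (intro real_sqrt_pow2) auto
      then show "(s x - M)\<^sup>2 + \<delta>\<^sup>2 \<le> (s x + soft_abs \<delta> M)\<^sup>2"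
        using mult_nonneg_nonneg[OF s0[of x], of M] mult_nonneg_nonneg[OF s0[of x], of "soft_abs \<delta> M"] M soft_abs_pos[OF \<delta>(1), of M]
        by (simp add: power2_sum power2_diff mult.commute)
    qed
    then show ?thesis by (simp add: \<psi>_def)
  qed
  have \<psi>B: "\<psi> x \<le> B" for x
    using sb(1)[of "s x - M"] sb(2)[of M] M \<delta> by (simp add: \<psi>_def B_def)
  have \<psi>min: "\<bar>\<psi> x - min \<bar>\<phi> x\<bar> M\<bar> \<le> 2 * \<delta>" for x
  proof -
    have "\<bar>\<psi> x - min (s x) M\<bar> \<le> \<delta> / 2"
    proof -
      have "\<psi> x - min (s x) M = (soft_abs \<delta> M - M) / 2 - (soft_abs \<delta> (s x - M) - \<bar>s x - M\<bar>) / 2"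
        by (simp add: \<psi>_def min_def abs_if field_simps)
      moreover have "0 \<le> (soft_abs \<delta> M - M) / 2" "(soft_abs \<delta> M - M) / 2 \<le> \<delta> / 2" using sb(1,2)[of M] M(1) by auto
      moreover have "0 \<le> (soft_abs \<delta> (s x - M) - \<bar>s x - M\<bar>) / 2"
        "(soft_abs \<delta> (s x - M) - \<bar>s x - M\<bar>) / 2 \<le> \<delta> / 2"
        using sb(1,2)[of "s x - M"] by auto
      moreover have "\<bar>c\<bar> \<le> \<delta> / 2" if "c = a - b" "0 \<le> a" "a \<le> \<delta> / 2" "0 \<le> b" "b \<le> \<delta> / 2" for a b c
        using that by linarith
      ultimately show ?thesis by blast
    qed
    moreover have "\<bar>min (s x) M - min \<bar>\<phi> x\<bar> M\<bar> \<le> \<delta>" using s\<phi>[of x] by (auto simp: min_def)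
    ultimately show ?thesis using \<delta> by linarith
  qed
  have test\<psi>: "\<psi> \<in> test"
  proof (rule test_functions_compose2[OF \<phi> \<phi> sm\<psi>])
    show "\<psi> x = 0" if "\<phi> x = 0" for x
      using that \<delta> by (simp add: \<psi>_def s_def soft_abs_def)
  qed
  have gr: "(norm (grad \<psi> x))\<^sup>2 \<le> (norm (grad \<phi> x))\<^sup>2" for x
  proof -
    define d1 where "d1 = \<phi> x / soft_abs \<delta> (\<phi> x)"
    define d2 where "d2 = (1 - (s x - M) / soft_abs \<delta> (s x - M)) / 2"
    have "((\<lambda>t. soft_abs \<delta> t - \<delta>) has_real_derivative d1) (at (\<phi> x))"
      unfolding d1_def by (auto intro!: derivative_eq_intros soft_abs_has_derivative \<delta>)
    from grad_compose[OF test_smooth[OF \<phi>] this] have g1: "grad s x = d1 *\<^sub>R grad \<phi> x" by (simp add: s_def[abs_def])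
    have "((\<lambda>t. soft_abs \<delta> (t - M)) has_real_derivative (s x - M) / soft_abs \<delta> (s x - M)) (at (s x))"
      using DERIV_shift[of "soft_abs \<delta>" _ "s x" "- M"] soft_abs_has_derivative[OF \<delta>(1), of "s x - M"] by simp
    then have "((\<lambda>t. (t - soft_abs \<delta> (t - M) + soft_abs \<delta> M) / 2) has_real_derivative d2) (at (s x))"
      unfolding d2_def by (auto intro!: derivative_eq_intros)
    from grad_compose[OF sms this] have g2: "grad \<psi> x = d2 *\<^sub>R grad s x" by (simp add: \<psi>_def[abs_def])
    have "\<bar>(1 - r) / 2\<bar> \<le> 1" if "\<bar>r\<bar> \<le> 1" for r :: real
      using that by (auto simp: abs_le_iff)
    then have "\<bar>d2\<bar> \<le> 1" unfolding d2_def using soft_abs_slope[OF \<delta>(1)] by blast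
    moreover have "\<bar>d1\<bar> \<le> 1" unfolding d1_def by (rule soft_abs_slope[OF \<delta>(1)])
    ultimately have "\<bar>d2\<bar> * \<bar>d1\<bar> \<le> 1" by (intro mult_le_one) auto
    then have "\<bar>d2\<bar> * \<bar>d1\<bar> * norm (grad \<phi> x) \<le> 1 * norm (grad \<phi> x)" by (intro mult_right_mono) auto
    then show ?thesis unfolding g1 g2 by (intro power_mono) (auto simp: abs_mult mult.assoc)
  qed
  have po: "pot F G (\<psi> x) \<le> pot F G (\<phi> x) + Lip B * (2 * \<delta>)" for x
  proof -
    have "\<bar>pot F G (\<psi> x) - pot F G (min \<bar>\<phi> x\<bar> M)\<bar> \<le> Lip B * \<bar>\<psi> x - min \<bar>\<phi> x\<bar> M\<bar>"
      using \<psi>0[of x] \<psi>B[of x] B_ge M by (intro pot_lipschitz[OF adm]) auto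
    also have "\<dots> \<le> Lip B * (2 * \<delta>)" using \<psi>min Lip_nonneg by (intro mult_left_mono) auto
    finally have 1: "pot F G (\<psi> x) \<le> pot F G (min \<bar>\<phi> x\<bar> M) + Lip B * (2 * \<delta>)" by linarith
    have "F \<le> G * M powr (1 - \<alpha>)"
    proof -
      have "a0 * M powr (1 - \<alpha>) \<le> G * M powr (1 - \<alpha>)"
        using admissibleD[OF adm] by (intro mult_right_mono) auto
      then show ?thesis using admissibleD[OF adm] M(2) by linarith
    qed
    then have "pot F G (min \<bar>\<phi> x\<bar> M) \<le> pot F G \<bar>\<phi> x\<bar>"
      using M \<alpha> \<beta> admissibleD[OF adm] by (intro potential_truncate) auto
    with 1 show ?thesis by (simp add: pot_abs)
  qed
  have "J A F G \<psi> \<le> J A F G \<phi> + Lip B * (2 * \<delta>) * vol"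
    using energy_compare[OF adm test\<psi> grad_test_square_integrable[OF \<phi>] gr pot_test_integrable[OF adm \<phi>] po]
    by (simp add: energy_def)
  with \<delta>e have "J A F G \<psi> \<le> J A F G \<phi> + \<epsilon>" by linarith
  moreover have "\<psi> \<in> capped_test" using test\<psi> \<psi>0 \<psi>B by (simp add: capped_test_def)
  ultimately show ?thesis using that by blast
qed

lemma integral_pot_lower:
  assumes "admissible A F G" "u \<in> borel_measurable \<mu>" "\<And>x. \<bar>u x\<bar> \<le> B"
  shows "- (Lip B * B * vol) \<le> (LINT x|\<mu>. pot F G (u x))"
proof -
  have "(LINT x|\<mu>. - (Lip B * B)) \<le> (LINT x|\<mu>. pot F G (u x))"
    using assms pot_bound[OF assms(1), of "u _" B]
    by (intro integral_mono pot_integrable) (auto simp: abs_le_iff minus_le_iff)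
  then show ?thesis by (simp add: integral_const_vol mult_ac del: integral_const lebesgue_integral_const)
qed

lemma capped_energy_lower:
  assumes adm: "admissible A F G" and "\<phi> \<in> capped_test"
  shows "A / 2 * (LINT x|\<mu>. (norm (grad \<phi> x))\<^sup>2) - Lip B * B * vol \<le> J A F G \<phi>"
  using integral_pot_lower[OF adm test_measurable capped_testD(4)] capped_testD(1) assms
  by (fastforce simp: energy_def)

lemma energy_bdd_below: "admissible A F G \<Longrightarrow> bdd_below (J A F G ` test)"
proof (rule bdd_belowI2)
  fix \<phi> assume adm: "admissible A F G" and \<phi>: "\<phi> \<in> test"
  obtain \<psi> where \<psi>: "\<psi> \<in> capped_test" "J A F G \<psi> \<le> J A F G \<phi> + 1"
    using truncation[OF adm \<phi>, of 1] by auto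
  have "0 \<le> A / 2 * (LINT x|\<mu>. (norm (grad \<psi> x))\<^sup>2)"
    using admissibleD[OF adm] by (intro mult_nonneg_nonneg integral_nonneg) auto
  with capped_energy_lower[OF adm \<psi>(1)] \<psi>(2) show "- (Lip B * B * vol) - 1 \<le> J A F G \<phi>" by linarith
qed

lemma min_energy_le: "admissible A F G \<Longrightarrow> \<phi> \<in> test \<Longrightarrow> min_energy A F G \<le> J A F G \<phi>"
  unfolding min_energy_def by (intro cInf_lower energy_bdd_below) auto

lemma min_energy_nonpos:
  assumes "admissible A F G"
  shows "min_energy A F G \<le> 0"
proof -
  have "grad (\<lambda>x::'a. 0) = (\<lambda>x. 0)" by (rule ext, rule grad_eqI, rule GDERIV_const)
  then show ?thesis using min_energy_le[OF assms test_zero] by (simp add: energy_def pot_0)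
qed

lemma minimizing_capped_test:
  assumes adm: "admissible A F G" and \<epsilon>: "\<epsilon> > 0"
  obtains \<phi> where "\<phi> \<in> capped_test" "J A F G \<phi> \<le> min_energy A F G + \<epsilon>"
proof -
  have "\<exists>y\<in>J A F G ` test. y < min_energy A F G + \<epsilon> / 2"
    unfolding min_energy_def
  proof (rule cInf_lessD[THEN bexE])
    show "J A F G ` test \<noteq> {}" using test_zero by blast
  qed (use \<epsilon> in auto)
  then obtain \<phi> where \<phi>: "\<phi> \<in> test" "J A F G \<phi> < min_energy A F G + \<epsilon> / 2" by blast
  obtain \<psi> where "\<psi> \<in> capped_test" "J A F G \<psi> \<le> J A F G \<phi> + \<epsilon> / 2"
    using truncation[OF adm \<phi>(1), of "\<epsilon> / 2"] \<epsilon> by auto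
  with \<phi>(2) show ?thesis by (intro that[of \<psi>]) auto
qed

text \<open>
  The Cauchy-Schwarz inequality, in the form which says that \<open>|\<nabla>(sqrt w)|\<^sup>2\<close> is convex in \<open>w\<close>. Here \<open>w\<close>
  may exceed the mean of the squares, as it does after smoothing.
\<close>

lemma gradient_of_quadratic_mean:
  fixes p q :: "'c::real_inner"
  assumes "(s\<^sup>2 + t\<^sup>2) / 2 \<le> w" "0 < w"
  shows "(norm ((1 / (2 * sqrt w)) *\<^sub>R (s *\<^sub>R p + t *\<^sub>R q)))\<^sup>2 \<le> ((norm p)\<^sup>2 + (norm q)\<^sup>2) / 2"
proof -
  have "norm (s *\<^sub>R p + t *\<^sub>R q) \<le> \<bar>s\<bar> * norm p + \<bar>t\<bar> * norm q"
    using norm_triangle_ineq[of "s *\<^sub>R p" "t *\<^sub>R q"] by simp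
  then have "(norm (s *\<^sub>R p + t *\<^sub>R q))\<^sup>2 \<le> (\<bar>s\<bar> * norm p + \<bar>t\<bar> * norm q)\<^sup>2" by (intro power_mono) auto
  also have "\<dots> \<le> (s\<^sup>2 + t\<^sup>2) * ((norm p)\<^sup>2 + (norm q)\<^sup>2)"
  proof -
    have "0 \<le> (\<bar>s\<bar> * norm q - \<bar>t\<bar> * norm p)\<^sup>2" by simp
    then show ?thesis by (simp add: power2_sum power2_diff power_mult_distrib algebra_simps)
  qed
  also have "\<dots> \<le> (2 * w) * ((norm p)\<^sup>2 + (norm q)\<^sup>2)" using assms by (intro mult_right_mono) auto
  finally have "(norm (s *\<^sub>R p + t *\<^sub>R q))\<^sup>2 / (4 * w) \<le> ((norm p)\<^sup>2 + (norm q)\<^sup>2) / 2"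
    using assms by (simp add: field_simps)
  moreover have "(norm ((1 / (2 * sqrt w)) *\<^sub>R (s *\<^sub>R p + t *\<^sub>R q)))\<^sup>2 = (norm (s *\<^sub>R p + t *\<^sub>R q))\<^sup>2 / (4 * w)"
    using assms by (simp add: power_mult_distrib power_divide)
  ultimately show ?thesis by simp
qed

text \<open>
  The competitor is the quadratic mean of \<open>\<phi>\<close> and \<open>\<psi>\<close>, that is, the midpoint in the variable \<open>u\<^sup>2\<close>. It
  is not smooth where both functions vanish. With \<open>m\<close> the mean of the squares,
  \<open>sqrt (m + \<delta>\<^sup>2) - \<delta>\<close> is smooth and still vanishes there.
\<close>

lemma min_energy_le_quadratic_mean:
  assumes adm: "admissible A F G" and \<phi>: "\<phi> \<in> capped_test" and \<psi>: "\<psi> \<in> capped_test"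
  shows "min_energy A F G \<le> A / 2 * (LINT x|\<mu>. ((norm (grad \<phi> x))\<^sup>2 + (norm (grad \<psi> x))\<^sup>2) / 2)
     + (LINT x|\<mu>. pot F G (sqrt (((\<phi> x)\<^sup>2 + (\<psi> x)\<^sup>2) / 2)))"
    (is "_ \<le> ?R")
proof (rule field_le_epsilon)
  fix \<epsilon> :: real assume \<epsilon>: "\<epsilon> > 0"
  note t = capped_testD(1)[OF \<phi>] capped_testD(1)[OF \<psi>]
  define \<delta> where "\<delta> = \<epsilon> / (Lip B * vol + 1)"
  have pos: "Lip B * vol + 1 > 0" using Lip_nonneg[of B] vol_nonneg by (intro add_nonneg_pos mult_nonneg_nonneg) auto
  have \<delta>: "0 < \<delta>" "Lip B * \<delta> * vol \<le> \<epsilon>"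
  proof -
    show d: "0 < \<delta>" using \<epsilon> pos by (simp add: \<delta>_def)
    have "\<delta> * (Lip B * vol + 1) = \<epsilon>" using pos by (simp add: \<delta>_def)
    then show "Lip B * \<delta> * vol \<le> \<epsilon>" using d by (simp add: algebra_simps)
  qed
  define m where "m x = ((\<phi> x)\<^sup>2 + (\<psi> x)\<^sup>2) / 2" for x
  define w where "w x = m x + \<delta>\<^sup>2" for x
  define v where "v x = sqrt (w x) - \<delta>" for x
  have m0: "0 \<le> m x" for x by (simp add: m_def)
  have w0: "0 < w x" for x using m0[of x] \<delta> by (simp add: w_def add_nonneg_pos)
  have smm: "smooth m"
  proof -
    have "smooth (\<lambda>x. (1/2) * ((\<phi> x)\<^sup>2 + (\<psi> x)\<^sup>2))"
      by (intro smooth_mult smooth_const smooth_add smooth_power2 test_smooth[OF t(1)] test_smooth[OF t(2)])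
    then show ?thesis by (simp add: m_def[abs_def])
  qed
  have smw: "smooth w" unfolding w_def[abs_def] by (intro smooth_add smooth_const smm)
  have smv: "smooth v" unfolding v_def[abs_def] by (intro smooth_diff smooth_const smooth_sqrt smw w0)
  have testv: "v \<in> test"
    by (rule test_functions_compose2[OF t smv]) (use \<delta> in \<open>simp add: v_def w_def m_def\<close>)
  have vb: "\<bar>v x - sqrt (m x)\<bar> \<le> \<delta>" "0 \<le> v x" "v x \<le> sqrt (m x)" for x
  proof -
    have "sqrt (w x) = soft_abs \<delta> (sqrt (m x))" using m0 by (simp add: soft_abs_def w_def)
    then show "\<bar>v x - sqrt (m x)\<bar> \<le> \<delta>" "0 \<le> v x" "v x \<le> sqrt (m x)"
      using soft_abs_bounds[OF \<delta>(1), of "sqrt (m x)"] m0[of x] \<delta> by (auto simp: v_def)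
  qed
  have mB: "sqrt (m x) \<le> B" for x
  proof -
    have "(\<phi> x)\<^sup>2 \<le> B\<^sup>2" "(\<psi> x)\<^sup>2 \<le> B\<^sup>2" using capped_testD[OF \<phi>] capped_testD[OF \<psi>] by (auto intro: power_mono)
    then show ?thesis using B_ge by (intro real_le_lsqrt) (auto simp: m_def)
  qed
  have gr: "(norm (grad v x))\<^sup>2 \<le> ((norm (grad \<phi> x))\<^sup>2 + (norm (grad \<psi> x))\<^sup>2) / 2" for x
  proof -
    have gsq: "grad (\<lambda>x. (f x)\<^sup>2) x = (2 * f x) *\<^sub>R grad f x" if "smooth f" for f :: "'a \<Rightarrow> real"
      using grad_mult[OF that that, of x] by (simp add: power2_eq_square scaleR_2[symmetric])
    have sq: "smooth (\<lambda>x. (\<phi> x)\<^sup>2 + (\<psi> x)\<^sup>2)"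
      by (intro smooth_add smooth_power2 test_smooth[OF t(1)] test_smooth[OF t(2)])
    have "grad w x = grad (\<lambda>x. (1/2) * ((\<phi> x)\<^sup>2 + (\<psi> x)\<^sup>2) + \<delta>\<^sup>2) x" by (simp add: w_def[abs_def] m_def)
    also have "\<dots> = grad (\<lambda>x. (1/2) * ((\<phi> x)\<^sup>2 + (\<psi> x)\<^sup>2)) x + grad (\<lambda>x. \<delta>\<^sup>2) x"
      by (intro grad_add smooth_mult smooth_const sq)
    also have "\<dots> = (1/2) *\<^sub>R grad (\<lambda>x. (\<phi> x)\<^sup>2 + (\<psi> x)\<^sup>2) x"
      by (simp only: grad_scale[OF sq] grad_eqI[OF GDERIV_const] add_0_right)
    also have "\<dots> = \<phi> x *\<^sub>R grad \<phi> x + \<psi> x *\<^sub>R grad \<psi> x"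
      by (simp add: grad_add gsq smooth_power2 test_smooth[OF t(1)] test_smooth[OF t(2)] scaleR_add_right)
    finally have gw: "grad w x = \<phi> x *\<^sub>R grad \<phi> x + \<psi> x *\<^sub>R grad \<psi> x" .
    have "((\<lambda>t. sqrt t - \<delta>) has_real_derivative (1 / (2 * sqrt (w x)))) (at (w x))"
      using w0[of x] by (auto intro!: derivative_eq_intros simp: field_simps)
    from grad_compose[OF smw this] have "grad v x = (1 / (2 * sqrt (w x))) *\<^sub>R (\<phi> x *\<^sub>R grad \<phi> x + \<psi> x *\<^sub>R grad \<psi> x)"
      by (simp only: v_def[abs_def] gw)
    then show ?thesis
      using gradient_of_quadratic_mean[of "\<phi> x" "\<psi> x" "w x"] w0[of x] by (simp add: w_def m_def)
  qed
  have po: "pot F G (v x) \<le> pot F G (sqrt (m x)) + Lip B * \<delta>" for x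
  proof -
    have "\<bar>pot F G (v x) - pot F G (sqrt (m x))\<bar> \<le> Lip B * \<bar>v x - sqrt (m x)\<bar>"
      using vb[of x] mB[of x] m0[of x] by (intro pot_lipschitz[OF adm]) auto
    also have "\<dots> \<le> Lip B * \<delta>" using vb Lip_nonneg by (intro mult_left_mono) auto
    finally show ?thesis by linarith
  qed
  have gi: "integrable \<mu> (\<lambda>x. ((norm (grad \<phi> x))\<^sup>2 + (norm (grad \<psi> x))\<^sup>2) / 2)"
    using grad_test_square_integrable[OF t(1)] grad_test_square_integrable[OF t(2)] by simp
  have pi: "integrable \<mu> (\<lambda>x. pot F G (sqrt (m x)))"
  proof (rule pot_integrable[OF adm])
    show "(\<lambda>x. sqrt (m x)) \<in> borel_measurable \<mu>"
      using test_measurable[OF t(1)] test_measurable[OF t(2)] unfolding m_def by measurable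
    show "\<bar>sqrt (m x)\<bar> \<le> B" for x using mB[of x] m0[of x] by simp
  qed
  have "min_energy A F G \<le> J A F G v" by (rule min_energy_le[OF adm testv])
  also have "\<dots> \<le> A / 2 * (LINT x|\<mu>. ((norm (grad \<phi> x))\<^sup>2 + (norm (grad \<psi> x))\<^sup>2) / 2)
      + (LINT x|\<mu>. pot F G (sqrt (m x))) + Lip B * \<delta> * vol"
    by (rule energy_compare[OF adm testv gi gr pi po])
  finally show "min_energy A F G \<le> ?R + \<epsilon>" using \<delta>(2) unfolding m_def by linarith
qed

definition convexity_const :: real where
  "convexity_const = a0 * (1 - \<alpha>) * B powr (\<alpha> - 3) / 64"

lemma convexity_const_pos: "0 < convexity_const"
  using a0 \<alpha> B_ge by (simp add: convexity_const_def)

lemma capped_square_diff_integrable: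
  assumes \<phi>: "\<phi> \<in> capped_test" and \<psi>: "\<psi> \<in> capped_test"
  shows "integrable \<mu> (\<lambda>x. ((\<phi> x)\<^sup>2 - (\<psi> x)\<^sup>2)\<^sup>2)"
proof (rule bounded_integrable[of _ "(B\<^sup>2)\<^sup>2"])
  have "(\<phi> x)\<^sup>2 \<le> B\<^sup>2" "(\<psi> x)\<^sup>2 \<le> B\<^sup>2" for x
    using capped_testD[OF \<phi>] capped_testD[OF \<psi>] by (auto intro: power_mono)
  then have "\<bar>(\<phi> x)\<^sup>2 - (\<psi> x)\<^sup>2\<bar> \<le> B\<^sup>2" for x
    using zero_le_power2[of "\<phi> x"] zero_le_power2[of "\<psi> x"] by (smt (verit))
  then show "norm (((\<phi> x)\<^sup>2 - (\<psi> x)\<^sup>2)\<^sup>2) \<le> (B\<^sup>2)\<^sup>2" for x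
    using power_mono[of "\<bar>(\<phi> x)\<^sup>2 - (\<psi> x)\<^sup>2\<bar>" "B\<^sup>2" 2] by simp
qed (use test_measurable[OF capped_testD(1)] assms in measurable)

text \<open>
  The quadratic mean has energy at least \<open>min_energy\<close>, but by hidden convexity it lies below the
  average energy by the integral on the left.
\<close>

lemma excess_controls_squares:
  assumes adm: "admissible A F G" and \<phi>: "\<phi> \<in> capped_test" and \<psi>: "\<psi> \<in> capped_test"
  shows "convexity_const * (LINT x|\<mu>. ((\<phi> x)\<^sup>2 - (\<psi> x)\<^sup>2)\<^sup>2) \<le> (J A F G \<phi> + J A F G \<psi>) / 2 - min_energy A F G"
proof -
  note t = capped_testD(1)[OF \<phi>] capped_testD(1)[OF \<psi>]
  note [measurable] = test_measurable[OF t(1)] test_measurable[OF t(2)]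
  have sq: "(\<phi> x)\<^sup>2 \<le> B\<^sup>2" "(\<psi> x)\<^sup>2 \<le> B\<^sup>2" for x
    using capped_testD[OF \<phi>] capped_testD[OF \<psi>] by (auto intro: power_mono)
  note i1 = capped_square_diff_integrable[OF \<phi> \<psi>]
  have i2: "integrable \<mu> (\<lambda>x. pot F G (sqrt (((\<phi> x)\<^sup>2 + (\<psi> x)\<^sup>2) / 2)))"
  proof (rule pot_integrable[OF adm])
    show "\<bar>sqrt (((\<phi> x)\<^sup>2 + (\<psi> x)\<^sup>2) / 2)\<bar> \<le> B" for x
      using sq[of x] B_ge by (simp add: real_le_lsqrt)
  qed measurable
  note i3 = pot_test_integrable[OF adm t(1)] pot_test_integrable[OF adm t(2)]
  note i4 = grad_test_square_integrable[OF t(1)] grad_test_square_integrable[OF t(2)]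
  have pw: "pot F G (sqrt (((\<phi> x)\<^sup>2 + (\<psi> x)\<^sup>2) / 2)) \<le>
     (pot F G (\<phi> x) + pot F G (\<psi> x)) / 2 - convexity_const * ((\<phi> x)\<^sup>2 - (\<psi> x)\<^sup>2)\<^sup>2" for x
  proof -
    have "pot F G (sqrt (((\<phi> x)\<^sup>2 + (\<psi> x)\<^sup>2) / 2)) + convexity_const * ((\<phi> x)\<^sup>2 - (\<psi> x)\<^sup>2)\<^sup>2
        \<le> (pot F G (\<phi> x) + pot F G (\<psi> x)) / 2"
      unfolding convexity_const_def
      by (rule potential_hidden_convexity)
         (use capped_testD(2-)[OF \<phi>, of x] capped_testD(2-)[OF \<psi>, of x] \<alpha> \<beta> a0 admissibleD[OF adm] in auto)
    then show ?thesis by linarith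
  qed
  have "(LINT x|\<mu>. pot F G (sqrt (((\<phi> x)\<^sup>2 + (\<psi> x)\<^sup>2) / 2))) \<le>
     (LINT x|\<mu>. (pot F G (\<phi> x) + pot F G (\<psi> x)) / 2 - convexity_const * ((\<phi> x)\<^sup>2 - (\<psi> x)\<^sup>2)\<^sup>2)"
    by (rule integral_mono[OF i2 _ pw]) (use i1 i3 in auto)
  also have "\<dots> = ((LINT x|\<mu>. pot F G (\<phi> x)) + (LINT x|\<mu>. pot F G (\<psi> x))) / 2
      - convexity_const * (LINT x|\<mu>. ((\<phi> x)\<^sup>2 - (\<psi> x)\<^sup>2)\<^sup>2)"
    using i1 i3 by simp
  finally have "(LINT x|\<mu>. pot F G (sqrt (((\<phi> x)\<^sup>2 + (\<psi> x)\<^sup>2) / 2))) \<le> \<dots>" .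
  moreover have "(LINT x|\<mu>. ((norm (grad \<phi> x))\<^sup>2 + (norm (grad \<psi> x))\<^sup>2) / 2)
      = ((LINT x|\<mu>. (norm (grad \<phi> x))\<^sup>2) + (LINT x|\<mu>. (norm (grad \<psi> x))\<^sup>2)) / 2"
    using i4 by simp
  ultimately show ?thesis
    using min_energy_le_quadratic_mean[OF adm \<phi> \<psi>] unfolding energy_def by (simp add: algebra_simps add_divide_distrib)
qed

end

section \<open>Stability of almost minimizers\<close>

text \<open>
  For nonnegative \<open>x\<close> and \<open>y\<close> one has \<open>(x - y)\<^sup>4 \<le> (x\<^sup>2 - y\<^sup>2)\<^sup>2\<close>.
\<close>

lemma abs_diff_le_square_diff:
  fixes x y \<eta> :: real
  assumes "0 \<le> x" "0 \<le> y" "\<eta> > 0"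
  shows "\<bar>x - y\<bar> \<le> \<eta> + (x\<^sup>2 - y\<^sup>2)\<^sup>2 / \<eta> ^ 3"
proof (cases "\<bar>x - y\<bar> \<le> \<eta>")
  case True
  have "0 \<le> (x\<^sup>2 - y\<^sup>2)\<^sup>2 / \<eta> ^ 3" using assms by simp
  with True show ?thesis by linarith
next
  case False
  let ?d = "\<bar>x - y\<bar>"
  have "?d * \<eta> ^ 3 \<le> ?d * ?d ^ 3" using False assms by (intro mult_left_mono power_mono) auto
  also have "\<dots> = (x - y)\<^sup>2 * (x - y)\<^sup>2" by (simp add: power3_eq_cube power2_eq_square abs_mult_self_eq flip: mult.assoc)
  also have "\<dots> \<le> (x - y)\<^sup>2 * (x + y)\<^sup>2"
    using assms by (intro mult_left_mono) (auto simp: abs_le_square_iff[symmetric])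
  also have "\<dots> = (x\<^sup>2 - y\<^sup>2)\<^sup>2" by (simp add: power2_eq_square algebra_simps)
  finally have "?d \<le> (x\<^sup>2 - y\<^sup>2)\<^sup>2 / \<eta> ^ 3" using assms by (simp add: pos_le_divide_eq)
  then show ?thesis using assms by linarith
qed

context frozen_problem
begin

lemma capped_diff_integrable:
  assumes "\<phi> \<in> capped_test" "\<psi> \<in> capped_test"
  shows "integrable \<mu> (\<lambda>x. \<phi> x - \<psi> x)"
  using L2_D(3)[OF test_in_L2] capped_testD(1) assms by auto

lemma excess_controls_L1:
  assumes adm: "admissible A F G" and \<phi>: "\<phi> \<in> capped_test" and \<psi>: "\<psi> \<in> capped_test" and \<eta>: "\<eta> > 0"
  shows "(LINT x|\<mu>. \<bar>\<phi> x - \<psi> x\<bar>)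
    \<le> \<eta> * vol + ((J A F G \<phi> + J A F G \<psi>) / 2 - min_energy A F G) / (convexity_const * \<eta> ^ 3)"
proof -
  let ?S = "LINT x|\<mu>. ((\<phi> x)\<^sup>2 - (\<psi> x)\<^sup>2)\<^sup>2"
  have "(LINT x|\<mu>. \<bar>\<phi> x - \<psi> x\<bar>) \<le> (LINT x|\<mu>. \<eta> + ((\<phi> x)\<^sup>2 - (\<psi> x)\<^sup>2)\<^sup>2 / \<eta> ^ 3)"
    using capped_diff_integrable[OF \<phi> \<psi>] capped_square_diff_integrable[OF \<phi> \<psi>]
      abs_diff_le_square_diff[OF capped_testD(2)[OF \<phi>] capped_testD(2)[OF \<psi>] \<eta>]
    by (intro integral_mono) auto
  also have "\<dots> = \<eta> * vol + ?S / \<eta> ^ 3"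
    using capped_square_diff_integrable[OF \<phi> \<psi>] by (simp add: integral_const_vol[symmetric])
  also have "?S / \<eta> ^ 3 \<le> ((J A F G \<phi> + J A F G \<psi>) / 2 - min_energy A F G) / (convexity_const * \<eta> ^ 3)"
  proof -
    have "?S \<le> ((J A F G \<phi> + J A F G \<psi>) / 2 - min_energy A F G) / convexity_const"
      using excess_controls_squares[OF adm \<phi> \<psi>] convexity_const_pos by (simp add: pos_le_divide_eq mult.commute)
    then show ?thesis using \<eta> by (simp add: divide_right_mono flip: divide_divide_eq_left)
  qed
  finally show ?thesis by simp
qed

lemma parallelogram_half:
  fixes p q :: "'c::real_inner"
  shows "(norm ((1/2) *\<^sub>R (p + q)))\<^sup>2 = ((norm p)\<^sup>2 + (norm q)\<^sup>2) / 2 - (norm (p - q))\<^sup>2 / 4"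
proof -
  have "(norm ((1/2) *\<^sub>R (p + q)))\<^sup>2 = (norm (p + q))\<^sup>2 / 4"
    by (simp only: norm_scaleR power_mult_distrib) (simp add: power2_eq_square)
  moreover have "(norm (p + q))\<^sup>2 + (norm (p - q))\<^sup>2 = 2 * ((norm p)\<^sup>2 + (norm q)\<^sup>2)"
    by (simp add: power2_norm_eq_inner inner_add_left inner_add_right inner_diff_left inner_diff_right)
  ultimately show ?thesis by argo
qed

lemma grad_diff_square_integrable:
  assumes "\<phi> \<in> test" "\<psi> \<in> test"
  shows "integrable \<mu> (\<lambda>x. (norm (grad \<phi> x - grad \<psi> x))\<^sup>2)"
  using L2_D(2)[OF L2_diff[OF grad_test_in_L2[OF assms(1)] grad_test_in_L2[OF assms(2)]]] .

text \<open>
  Now the competitor is the arithmetic mean. Its Dirichlet integral gains by the parallelogram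
  identity, and its potential energy loses at most the Lipschitz constant times the \<open>L\<^sup>1\<close> distance.
\<close>

lemma excess_controls_gradients:
  assumes adm: "admissible A F G" and \<phi>: "\<phi> \<in> capped_test" and \<psi>: "\<psi> \<in> capped_test"
  shows "A / 8 * (LINT x|\<mu>. (norm (grad \<phi> x - grad \<psi> x))\<^sup>2)
    \<le> (J A F G \<phi> + J A F G \<psi>) / 2 - min_energy A F G + Lip B / 2 * (LINT x|\<mu>. \<bar>\<phi> x - \<psi> x\<bar>)"
proof -
  note t = capped_testD(1)[OF \<phi>] capped_testD(1)[OF \<psi>]
  define v where "v x = (1/2) * (\<phi> x + \<psi> x)" for x
  have tv: "v \<in> test" unfolding v_def[abs_def] by (intro test_scale test_add t)
  have gv: "grad v x = (1/2) *\<^sub>R (grad \<phi> x + grad \<psi> x)" for x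
    unfolding v_def[abs_def]
    by (simp only: grad_scale[OF smooth_add[OF test_smooth[OF t(1)] test_smooth[OF t(2)]]]
        grad_add[OF test_smooth[OF t(1)] test_smooth[OF t(2)]])
  note i = grad_test_square_integrable[OF t(1)] grad_test_square_integrable[OF t(2)]
    grad_diff_square_integrable[OF t] pot_test_integrable[OF adm t(1)] pot_test_integrable[OF adm t(2)]
    capped_diff_integrable[OF \<phi> \<psi>]
  have po: "pot F G (v x) \<le> (pot F G (\<phi> x) + pot F G (\<psi> x)) / 2 + Lip B / 2 * \<bar>\<phi> x - \<psi> x\<bar> + 0" for x
  proof -
    have b: "\<bar>v x\<bar> \<le> B" "\<bar>\<phi> x\<bar> \<le> B" "\<bar>\<psi> x\<bar> \<le> B"
      using capped_testD(2-)[OF \<phi>, of x] capped_testD(2-)[OF \<psi>, of x] by (auto simp: v_def)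
    have d: "\<bar>v x - \<phi> x\<bar> = \<bar>\<phi> x - \<psi> x\<bar> / 2" "\<bar>v x - \<psi> x\<bar> = \<bar>\<phi> x - \<psi> x\<bar> / 2"
      by (auto simp: v_def abs_if field_simps)
    have "\<bar>pot F G (v x) - pot F G (\<phi> x)\<bar> \<le> Lip B / 2 * \<bar>\<phi> x - \<psi> x\<bar>"
         "\<bar>pot F G (v x) - pot F G (\<psi> x)\<bar> \<le> Lip B / 2 * \<bar>\<phi> x - \<psi> x\<bar>"
      using pot_lipschitz[OF adm b(1,2)] pot_lipschitz[OF adm b(1,3)] unfolding d by auto
    then have "pot F G (v x) \<le> pot F G (\<phi> x) + Lip B / 2 * \<bar>\<phi> x - \<psi> x\<bar>"
         "pot F G (v x) \<le> pot F G (\<psi> x) + Lip B / 2 * \<bar>\<phi> x - \<psi> x\<bar>"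
      by (simp_all only: abs_le_iff) linarith+
    then show ?thesis by argo
  qed
  have gr: "(norm (grad v x))\<^sup>2 \<le> ((norm (grad \<phi> x))\<^sup>2 + (norm (grad \<psi> x))\<^sup>2) / 2 - (norm (grad \<phi> x - grad \<psi> x))\<^sup>2 / 4" for x
    unfolding gv parallelogram_half by simp
  have "min_energy A F G \<le> J A F G v" by (rule min_energy_le[OF adm tv])
  also have "\<dots> \<le> A / 2 * (LINT x|\<mu>. ((norm (grad \<phi> x))\<^sup>2 + (norm (grad \<psi> x))\<^sup>2) / 2 - (norm (grad \<phi> x - grad \<psi> x))\<^sup>2 / 4)
      + (LINT x|\<mu>. (pot F G (\<phi> x) + pot F G (\<psi> x)) / 2 + Lip B / 2 * \<bar>\<phi> x - \<psi> x\<bar>) + 0 * vol"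
    by (rule energy_compare[OF adm tv _ gr _ po]) (use i in auto)
  also have "\<dots> = A / 2 * (((LINT x|\<mu>. (norm (grad \<phi> x))\<^sup>2) + (LINT x|\<mu>. (norm (grad \<psi> x))\<^sup>2)) / 2
        - (LINT x|\<mu>. (norm (grad \<phi> x - grad \<psi> x))\<^sup>2) / 4)
      + (((LINT x|\<mu>. pot F G (\<phi> x)) + (LINT x|\<mu>. pot F G (\<psi> x))) / 2 + Lip B / 2 * (LINT x|\<mu>. \<bar>\<phi> x - \<psi> x\<bar>))"
    using i by simp
  finally show ?thesis by (simp add: energy_def field_simps)
qed

text \<open>
  The same \<open>\<delta>\<close> serves all admissible coefficients; this uniformity is what continuous dependence on
  the coefficients rests on.
\<close>

lemma almost_minimizers_close:
  assumes \<epsilon>: "\<epsilon> > 0"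
  obtains \<delta> where "\<delta> > 0"
    "\<And>A F G \<phi> \<psi>. admissible A F G \<Longrightarrow> \<phi> \<in> capped_test \<Longrightarrow> \<psi> \<in> capped_test \<Longrightarrow>
      J A F G \<phi> \<le> min_energy A F G + \<delta> \<Longrightarrow> J A F G \<psi> \<le> min_energy A F G + \<delta> \<Longrightarrow>
      (LINT x|\<mu>. \<bar>\<phi> x - \<psi> x\<bar>) \<le> \<epsilon> \<and> (LINT x|\<mu>. (norm (grad \<phi> x - grad \<psi> x))\<^sup>2) \<le> \<epsilon>"
proof -
  note L = Lip_nonneg[of B] and c = convexity_const_pos
  \<comment> \<open>Let \<open>e\<close> bound the \<open>L\<^sup>1\<close> distance: half of it comes from \<open>\<eta> * vol\<close> and half from the excess. The
    second entry of the minimum keeps the potential term in the gradient estimate at most half of its budget.\<close>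
  define e where "e = min \<epsilon> (a0 * \<epsilon> / (8 * (Lip B + 1)))"
  define \<eta> where "\<eta> = e / (2 * (vol + 1))"
  define \<delta> where "\<delta> = min (convexity_const * \<eta> ^ 3 * (e / 2)) (a0 * \<epsilon> / 16)"
  have e: "0 < e" "e \<le> \<epsilon>" using \<epsilon> a0 L by (auto simp: e_def add_nonneg_pos)
  have eL: "Lip B / 2 * e \<le> a0 * \<epsilon> / 16"
  proof -
    have "e * (8 * (Lip B + 1)) \<le> a0 * \<epsilon>" using L by (simp add: e_def pos_le_divide_eq[symmetric])
    then show ?thesis using e L by (simp add: algebra_simps)
  qed
  have \<eta>: "0 < \<eta>" using e vol_nonneg by (simp add: \<eta>_def add_nonneg_pos)
  have \<eta>v: "\<eta> * vol \<le> e / 2"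
  proof -
    have "\<eta> * (2 * (vol + 1)) = e" using vol_nonneg by (simp add: \<eta>_def)
    then show ?thesis using \<eta> by (simp add: algebra_simps)
  qed
  have \<delta>: "0 < \<delta>" using c \<eta> e \<epsilon> a0 by (simp add: \<delta>_def)
  show ?thesis
  proof (rule that[OF \<delta>])
    fix A F G \<phi> \<psi>
    assume adm: "admissible A F G" and \<phi>: "\<phi> \<in> capped_test" and \<psi>: "\<psi> \<in> capped_test"
      and J: "J A F G \<phi> \<le> min_energy A F G + \<delta>" "J A F G \<psi> \<le> min_energy A F G + \<delta>"
    let ?X = "(J A F G \<phi> + J A F G \<psi>) / 2 - min_energy A F G"
    let ?D = "LINT x|\<mu>. (norm (grad \<phi> x - grad \<psi> x))\<^sup>2"
    have X: "?X \<le> \<delta>" using J by argo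
    have "?X / (convexity_const * \<eta> ^ 3) \<le> e / 2"
    proof -
      have "?X \<le> e / 2 * (convexity_const * \<eta> ^ 3)" using X by (simp add: \<delta>_def mult_ac)
      then show ?thesis using c \<eta> by (simp only: pos_divide_le_eq mult_pos_pos zero_less_power)
    qed
    with excess_controls_L1[OF adm \<phi> \<psi> \<eta>] \<eta>v have L1: "(LINT x|\<mu>. \<bar>\<phi> x - \<psi> x\<bar>) \<le> e" by linarith
    have "a0 / 8 * ?D \<le> A / 8 * ?D"
      using admissibleD[OF adm] by (intro mult_right_mono integral_nonneg) auto
    also have "\<dots> \<le> ?X + Lip B / 2 * (LINT x|\<mu>. \<bar>\<phi> x - \<psi> x\<bar>)"
      by (rule excess_controls_gradients[OF adm \<phi> \<psi>])
    also have "\<dots> \<le> a0 * \<epsilon> / 16 + Lip B / 2 * e"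
      using X L1 L by (intro add_mono mult_left_mono) (auto simp: \<delta>_def)
    also have "\<dots> \<le> a0 * \<epsilon> / 8" using eL by argo
    finally have "?D \<le> \<epsilon>" using a0 by simp
    with L1 e show "(LINT x|\<mu>. \<bar>\<phi> x - \<psi> x\<bar>) \<le> \<epsilon> \<and> ?D \<le> \<epsilon>" by simp
  qed
qed

section \<open>Minimizers\<close>

text \<open>
  The bounds \<open>0 \<le> u \<le> B\<close> are required everywhere; a limit of capped test functions satisfies them
  almost everywhere and can be clipped.
\<close>

definition minimizing :: "real \<Rightarrow> real \<Rightarrow> real \<Rightarrow> (nat \<Rightarrow> 'a \<Rightarrow> real) \<Rightarrow> ('a \<Rightarrow> real) \<Rightarrow> ('a \<Rightarrow> 'a) \<Rightarrow> bool" where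
  "minimizing A F G \<phi> u V \<longleftrightarrow> (\<forall>n. \<phi> n \<in> capped_test) \<and> (\<lambda>n. J A F G (\<phi> n)) \<longlonglongrightarrow> min_energy A F G \<and>
     u \<in> L2 \<Omega> \<and> V \<in> L2 \<Omega> \<and> (\<forall>x. 0 \<le> u x \<and> u x \<le> B) \<and>
     (\<lambda>n. LINT x|\<mu>. (norm (\<phi> n x - u x))\<^sup>2) \<longlonglongrightarrow> 0 \<and>
     (\<lambda>n. LINT x|\<mu>. (norm (grad (\<phi> n) x - V x))\<^sup>2) \<longlonglongrightarrow> 0"

lemma minimizingD:
  assumes "minimizing A F G \<phi> u V"
  shows "\<phi> n \<in> capped_test" "\<phi> n \<in> test" "(\<lambda>n. J A F G (\<phi> n)) \<longlonglongrightarrow> min_energy A F G"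
    "u \<in> L2 \<Omega>" "V \<in> L2 \<Omega>" "0 \<le> u x" "u x \<le> B"
    "(\<lambda>n. LINT x|\<mu>. (norm (\<phi> n x - u x))\<^sup>2) \<longlonglongrightarrow> 0"
    "(\<lambda>n. LINT x|\<mu>. (norm (grad (\<phi> n) x - V x))\<^sup>2) \<longlonglongrightarrow> 0"
  using assms capped_testD(1) unfolding minimizing_def by auto

lemma minimizer_exists:
  assumes adm: "admissible A F G"
  shows "\<exists>\<phi> u V. minimizing A F G \<phi> u V"
proof -
  have "\<exists>\<phi>. \<phi> \<in> capped_test \<and> J A F G \<phi> \<le> min_energy A F G + inverse (real (Suc n))" for n
    using minimizing_capped_test[OF adm, of "inverse (real (Suc n))"] by force
  then obtain \<phi> where \<phi>: "\<And>n. \<phi> n \<in> capped_test" "\<And>n. J A F G (\<phi> n) \<le> min_energy A F G + inverse (real (Suc n))"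
    by metis
  note t = capped_testD(1)[OF \<phi>(1)]
  have J: "(\<lambda>n. J A F G (\<phi> n)) \<longlonglongrightarrow> min_energy A F G"
  proof (rule tendsto_sandwich[of "\<lambda>_. min_energy A F G" _ _ "\<lambda>n. min_energy A F G + inverse (real (Suc n))"])
    show "(\<lambda>n. min_energy A F G + inverse (real (Suc n))) \<longlonglongrightarrow> min_energy A F G"
      using tendsto_add[OF tendsto_const LIMSEQ_inverse_real_of_nat] by simp
  qed (use \<phi>(2) min_energy_le[OF adm t] in auto)
  have close: "\<exists>N. \<forall>i\<ge>N. \<forall>j\<ge>N. (LINT x|\<mu>. \<bar>\<phi> i x - \<phi> j x\<bar>) \<le> e \<and> (LINT x|\<mu>. (norm (grad (\<phi> i) x - grad (\<phi> j) x))\<^sup>2) \<le> e"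
    if e: "e > 0" for e
  proof -
    obtain \<delta> where \<delta>: "\<delta> > 0" "\<And>A F G \<phi> \<psi>. admissible A F G \<Longrightarrow> \<phi> \<in> capped_test \<Longrightarrow> \<psi> \<in> capped_test \<Longrightarrow>
      J A F G \<phi> \<le> min_energy A F G + \<delta> \<Longrightarrow> J A F G \<psi> \<le> min_energy A F G + \<delta> \<Longrightarrow>
      (LINT x|\<mu>. \<bar>\<phi> x - \<psi> x\<bar>) \<le> e \<and> (LINT x|\<mu>. (norm (grad \<phi> x - grad \<psi> x))\<^sup>2) \<le> e"
      using almost_minimizers_close[OF e] by blast
    have "\<forall>\<^sub>F n in sequentially. J A F G (\<phi> n) < min_energy A F G + \<delta>"
      using order_tendstoD(2)[OF J, of "min_energy A F G + \<delta>"] \<delta>(1) by simp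
    then obtain N where "\<And>n. n \<ge> N \<Longrightarrow> J A F G (\<phi> n) \<le> min_energy A F G + \<delta>"
      unfolding eventually_sequentially by (meson less_imp_le)
    then show ?thesis using \<delta>(2)[OF adm \<phi>(1) \<phi>(1)] by blast
  qed
  have cu: "\<exists>N. \<forall>i\<ge>N. \<forall>j\<ge>N. (LINT x|\<mu>. (norm (\<phi> i x - \<phi> j x))\<^sup>2) < e" if e: "e > 0" for e
  proof -
    obtain N where N: "\<And>i j. i \<ge> N \<Longrightarrow> j \<ge> N \<Longrightarrow> (LINT x|\<mu>. \<bar>\<phi> i x - \<phi> j x\<bar>) \<le> e / (2 * B)"
      using close[of "e / (2 * B)"] e B_ge by auto
    have "(LINT x|\<mu>. (norm (\<phi> i x - \<phi> j x))\<^sup>2) < e" if "i \<ge> N" "j \<ge> N" for i j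
    proof -
      have "(norm (\<phi> i x - \<phi> j x))\<^sup>2 \<le> B * \<bar>\<phi> i x - \<phi> j x\<bar>" for x
      proof -
        have "\<bar>\<phi> i x - \<phi> j x\<bar> \<le> B"
          using capped_testD(2-)[OF \<phi>(1)[of i], of x] capped_testD(2-)[OF \<phi>(1)[of j], of x] by linarith
        then have "\<bar>\<phi> i x - \<phi> j x\<bar> * \<bar>\<phi> i x - \<phi> j x\<bar> \<le> B * \<bar>\<phi> i x - \<phi> j x\<bar>" by (intro mult_right_mono) auto
        then show ?thesis by (simp add: power2_eq_square)
      qed
      then have "(LINT x|\<mu>. (norm (\<phi> i x - \<phi> j x))\<^sup>2) \<le> (LINT x|\<mu>. B * \<bar>\<phi> i x - \<phi> j x\<bar>)"
        using capped_diff_integrable[OF \<phi>(1) \<phi>(1), of i j] L2_D(2)[OF L2_diff[OF test_in_L2[OF t] test_in_L2[OF t]], of i j]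
        by (intro integral_mono) auto
      also have "\<dots> = B * (LINT x|\<mu>. \<bar>\<phi> i x - \<phi> j x\<bar>)" by simp
      also have "\<dots> \<le> B * (e / (2 * B))"
        using N[OF that] B_ge by (intro mult_left_mono) auto
      finally show ?thesis using e B_ge by simp
    qed
    then show ?thesis by blast
  qed
  have cV: "\<exists>N. \<forall>i\<ge>N. \<forall>j\<ge>N. (LINT x|\<mu>. (norm (grad (\<phi> i) x - grad (\<phi> j) x))\<^sup>2) < e" if e: "e > 0" for e
  proof -
    obtain N where "\<And>i j. i \<ge> N \<Longrightarrow> j \<ge> N \<Longrightarrow> (LINT x|\<mu>. (norm (grad (\<phi> i) x - grad (\<phi> j) x))\<^sup>2) \<le> e / 2"
      using close[of "e / 2"] e by auto
    then show ?thesis using e by (intro exI[of _ N]) fastforce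
  qed
  obtain u0 where u0: "u0 \<in> borel_measurable \<mu>" "integrable \<mu> (\<lambda>x. (norm (u0 x))\<^sup>2)"
      "(\<lambda>n. LINT x|\<mu>. (norm (\<phi> n x - u0 x))\<^sup>2) \<longlonglongrightarrow> 0"
    using L2_complete[of \<phi>, OF L2_D(1)[OF test_in_L2[OF t]] L2_D(2)[OF test_in_L2[OF t]] cu] by blast
  obtain V where V: "V \<in> borel_measurable \<mu>" "integrable \<mu> (\<lambda>x. (norm (V x))\<^sup>2)"
      "(\<lambda>n. LINT x|\<mu>. (norm (grad (\<phi> n) x - V x))\<^sup>2) \<longlonglongrightarrow> 0"
    using L2_complete[of "\<lambda>n. grad (\<phi> n)", OF L2_D(1)[OF grad_test_in_L2[OF t]] L2_D(2)[OF grad_test_in_L2[OF t]] cV] by blast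
  define u where "u x = max 0 (min B (u0 x))" for x
  have ub: "0 \<le> u x" "u x \<le> B" for x using B_ge by (auto simp: u_def)
  have um: "u \<in> borel_measurable \<mu>" using u0(1) unfolding u_def by measurable
  have uL: "u \<in> L2 \<Omega>" using ub by (intro bounded_in_L2[OF um, of B]) auto
  have "(\<lambda>n. LINT x|\<mu>. (norm (\<phi> n x - u x))\<^sup>2) \<longlonglongrightarrow> 0"
  proof (rule tendsto_sandwich[OF _ _ tendsto_const u0(3)])
    have "(norm (\<phi> n x - u x))\<^sup>2 \<le> (norm (\<phi> n x - u0 x))\<^sup>2" for n x
      using capped_testD(2,3)[OF \<phi>(1)[of n], of x] by (intro power_mono) (auto simp: u_def)
    then show "\<forall>\<^sub>F n in sequentially. (LINT x|\<mu>. (norm (\<phi> n x - u x))\<^sup>2) \<le> (LINT x|\<mu>. (norm (\<phi> n x - u0 x))\<^sup>2)"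
      using L2_D(2)[OF L2_diff[OF test_in_L2[OF t] uL]]
        square_integrable_diff[OF L2_D(1)[OF test_in_L2[OF t]] L2_D(2)[OF test_in_L2[OF t]] u0(1,2)]
      by (intro always_eventually allI integral_mono) auto
  qed (simp add: integral_nonneg)
  with \<phi>(1) J uL ub V show ?thesis unfolding minimizing_def by (intro exI[of _ \<phi>] exI[of _ u] exI[of _ V]) (auto simp: L2_def)
qed

lemma minimizing_L1:
  assumes "minimizing A F G \<phi> u V"
  shows "(\<lambda>n. LINT x|\<mu>. \<bar>\<phi> n x - u x\<bar>) \<longlonglongrightarrow> 0"
  using L2_tendsto_L1[OF L2_D(1,2)[OF test_in_L2[OF minimizingD(2)[OF assms]]] L2_D(1,2)[OF minimizingD(4)[OF assms]]
      minimizingD(8)[OF assms]] by simp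

lemma minimizing_diff_integrable:
  assumes "minimizing A F G \<phi> u V"
  shows "integrable \<mu> (\<lambda>x. \<phi> n x - u x)"
  using L2_D(3)[OF L2_diff[OF test_in_L2[OF minimizingD(2)[OF assms]] minimizingD(4)[OF assms]]] .

section \<open>Continuous dependence of minimizers on the coefficients\<close>

definition perturbation_const :: real where
  "perturbation_const = (1 + Lip B * B * vol) / a0 + (B powr (\<beta> + 1) + B powr (\<alpha> + 1)) * vol"

lemma perturbation_const_nonneg: "0 \<le> perturbation_const"
  unfolding perturbation_const_def using Lip_nonneg[of B] vol_nonneg a0 B_ge
  by (intro add_nonneg_nonneg divide_nonneg_nonneg mult_nonneg_nonneg) auto

text \<open>
  The energy is affine in the coefficients. An energy bound controls the Dirichlet integral, which
  multiplies the change of \<open>A\<close>.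
\<close>

lemma energy_perturbation:
  assumes adm: "admissible A F G" "admissible A' F' G'" and \<phi>: "\<phi> \<in> capped_test" and J: "J A F G \<phi> \<le> 1"
  shows "J A' F' G' \<phi> \<le> J A F G \<phi> + perturbation_const * (\<bar>A - A'\<bar> + \<bar>F - F'\<bar> + \<bar>G - G'\<bar>)"
proof -
  let ?S = "LINT x|\<mu>. (norm (grad \<phi> x))\<^sup>2"
  note t = capped_testD(1)[OF \<phi>]
  have S0: "0 \<le> ?S" by (simp add: integral_nonneg)
  have "A / 2 * ?S \<le> 1 + Lip B * B * vol" using capped_energy_lower[OF adm(1) \<phi>] J by linarith
  moreover have "a0 / 2 * ?S \<le> A / 2 * ?S" using admissibleD[OF adm(1)] S0 by (intro mult_right_mono) auto
  ultimately have "a0 * (?S / 2) \<le> 1 + Lip B * B * vol" by simp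
  then have S: "?S / 2 \<le> (1 + Lip B * B * vol) / a0" using a0 by (simp add: pos_le_divide_eq mult.commute)
  have "\<bar>A - A'\<bar> * (?S / 2) \<le> \<bar>A - A'\<bar> * ((1 + Lip B * B * vol) / a0)" using S by (intro mult_left_mono) auto
  moreover have "(A' - A) * (?S / 2) \<le> \<bar>A - A'\<bar> * (?S / 2)" using S0 by (intro mult_right_mono) auto
  ultimately have 1: "A' / 2 * ?S \<le> A / 2 * ?S + \<bar>A - A'\<bar> * ((1 + Lip B * B * vol) / a0)"
    by (simp add: left_diff_distrib)
  have po: "pot F' G' (\<phi> x) \<le> pot F G (\<phi> x) + (\<bar>F - F'\<bar> + \<bar>G - G'\<bar>) * (B powr (\<beta> + 1) + B powr (\<alpha> + 1))" for x
  proof -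
    have pw: "(H - H') * (\<bar>\<phi> x\<bar> powr (c + 1) / (c + 1)) \<le> \<bar>H - H'\<bar> * B powr (c + 1)" if "0 \<le> c" for c H H'
    proof -
      have "\<bar>\<phi> x\<bar> powr (c + 1) / (c + 1) \<le> \<bar>\<phi> x\<bar> powr (c + 1) / 1" using that by (intro divide_left_mono) auto
      also have "\<dots> \<le> B powr (c + 1)" using capped_testD(4)[OF \<phi>] that by (auto intro: powr_mono2)
      finally have 1: "\<bar>\<phi> x\<bar> powr (c + 1) / (c + 1) \<le> B powr (c + 1)" .
      have "(H - H') * (\<bar>\<phi> x\<bar> powr (c + 1) / (c + 1)) \<le> \<bar>H - H'\<bar> * (\<bar>\<phi> x\<bar> powr (c + 1) / (c + 1))"
        using that by (intro mult_right_mono) auto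
      also have "\<dots> \<le> \<bar>H - H'\<bar> * B powr (c + 1)" using 1 by (intro mult_left_mono) auto
      finally show ?thesis .
    qed
    have "pot F' G' (\<phi> x) = pot F G (\<phi> x) + (G' - G) * (\<bar>\<phi> x\<bar> powr (\<beta> + 1) / (\<beta> + 1)) + (F - F') * (\<bar>\<phi> x\<bar> powr (\<alpha> + 1) / (\<alpha> + 1))"
      by (simp add: potential_def left_diff_distrib diff_divide_distrib)
    also have "\<dots> \<le> pot F G (\<phi> x) + \<bar>G' - G\<bar> * B powr (\<beta> + 1) + \<bar>F - F'\<bar> * B powr (\<alpha> + 1)"
      using \<alpha> \<beta> by (intro add_mono pw order_refl) auto
    also have "\<dots> \<le> pot F G (\<phi> x) + (\<bar>F - F'\<bar> + \<bar>G - G'\<bar>) * (B powr (\<beta> + 1) + B powr (\<alpha> + 1))"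
      by (simp add: distrib_left distrib_right abs_minus_commute[of G])
    finally show ?thesis .
  qed
  have "J A' F' G' \<phi> \<le> A' / 2 * ?S + (LINT x|\<mu>. pot F G (\<phi> x)) + (\<bar>F - F'\<bar> + \<bar>G - G'\<bar>) * (B powr (\<beta> + 1) + B powr (\<alpha> + 1)) * vol"
    by (rule energy_compare[OF adm(2) t grad_test_square_integrable[OF t] order_refl pot_test_integrable[OF adm(1) t] po])
  moreover have "\<bar>A - A'\<bar> * ((1 + Lip B * B * vol) / a0) + (\<bar>F - F'\<bar> + \<bar>G - G'\<bar>) * (B powr (\<beta> + 1) + B powr (\<alpha> + 1)) * vol
     \<le> (\<bar>A - A'\<bar> + \<bar>F - F'\<bar> + \<bar>G - G'\<bar>) * perturbation_const"
  proof -
    have "a * p + b * q * v \<le> (a + b) * (p + q * v)" if "0 \<le> a" "0 \<le> b" "0 \<le> p" "0 \<le> q" "0 \<le> v" for a b p q v :: real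
      using mult_nonneg_nonneg[OF that(1) mult_nonneg_nonneg[OF that(4,5)]] mult_nonneg_nonneg[OF that(2,3)]
      by (simp add: algebra_simps)
    from this[of "\<bar>A - A'\<bar>" "\<bar>F - F'\<bar> + \<bar>G - G'\<bar>" "(1 + Lip B * B * vol) / a0" "B powr (\<beta> + 1) + B powr (\<alpha> + 1)" vol]
    show ?thesis using Lip_nonneg[of B] vol_nonneg a0 B_ge by (simp add: perturbation_const_def add.assoc)
  qed
  ultimately show ?thesis
    using 1 energy_def[of A F G \<phi> "grad \<phi>"] unfolding mult.commute[of perturbation_const] by linarith
qed

text \<open>
  An almost minimizer for \<open>(A', F', G')\<close> is an almost minimizer for nearby \<open>(A, F, G)\<close>, since both the
  energies and their infima are close. So approximating test functions for the two minimizers are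
  close to each other.
\<close>

lemma minimizers_depend_continuously:
  assumes \<epsilon>: "\<epsilon> > 0"
  obtains \<delta> where "\<delta> > 0"
    "\<And>A F G A' F' G' \<phi> \<phi>' u u' V V'. admissible A F G \<Longrightarrow> admissible A' F' G' \<Longrightarrow>
      minimizing A F G \<phi> u V \<Longrightarrow> minimizing A' F' G' \<phi>' u' V' \<Longrightarrow>
      \<bar>A - A'\<bar> + \<bar>F - F'\<bar> + \<bar>G - G'\<bar> \<le> \<delta> \<Longrightarrow> (LINT x|\<mu>. \<bar>u x - u' x\<bar>) \<le> \<epsilon>"
proof -
  obtain \<delta>0 where \<delta>0: "\<delta>0 > 0" "\<And>A F G \<phi> \<psi>. admissible A F G \<Longrightarrow> \<phi> \<in> capped_test \<Longrightarrow> \<psi> \<in> capped_test \<Longrightarrow>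
      J A F G \<phi> \<le> min_energy A F G + \<delta>0 \<Longrightarrow> J A F G \<psi> \<le> min_energy A F G + \<delta>0 \<Longrightarrow>
      (LINT x|\<mu>. \<bar>\<phi> x - \<psi> x\<bar>) \<le> \<epsilon> \<and> (LINT x|\<mu>. (norm (grad \<phi> x - grad \<psi> x))\<^sup>2) \<le> \<epsilon>"
    using almost_minimizers_close[OF \<epsilon>] by blast
  define \<delta>1 where "\<delta>1 = min 1 \<delta>0"
  have \<delta>1: "0 < \<delta>1" "\<delta>1 \<le> 1" "\<delta>1 \<le> \<delta>0" using \<delta>0(1) by (auto simp: \<delta>1_def)
  note C = perturbation_const_nonneg
  define \<delta> where "\<delta> = \<delta>1 / (4 * (perturbation_const + 1))"
  have \<delta>: "0 < \<delta>" using \<delta>1 C by (simp add: \<delta>_def add_nonneg_pos)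
  have C\<delta>: "perturbation_const * d \<le> \<delta>1 / 4" if "d \<le> \<delta>" for d
  proof -
    have "perturbation_const * d \<le> perturbation_const * \<delta>" using that C by (intro mult_left_mono)
    moreover have "\<delta> * (4 * (perturbation_const + 1)) = \<delta>1" using C by (simp add: \<delta>_def)
    then have "perturbation_const * \<delta> \<le> \<delta>1 / 4" using \<delta> by (simp add: algebra_simps)
    ultimately show ?thesis by linarith
  qed
  show ?thesis
  proof (rule that[OF \<delta>])
    fix A F G A' F' G' \<phi> \<phi>' u u' V V'
    assume adm: "admissible A F G" "admissible A' F' G'"
      and min: "minimizing A F G \<phi> u V" and min': "minimizing A' F' G' \<phi>' u' V'"
      and d: "\<bar>A - A'\<bar> + \<bar>F - F'\<bar> + \<bar>G - G'\<bar> \<le> \<delta>"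
    have d': "\<bar>A' - A\<bar> + \<bar>F' - F\<bar> + \<bar>G' - G\<bar> \<le> \<delta>" using d by (simp add: abs_minus_commute)
    have ev: "\<forall>\<^sub>F n in sequentially. J A F G (\<phi> n) < min_energy A F G + \<delta>1 / 4"
      "\<forall>\<^sub>F n in sequentially. J A' F' G' (\<phi>' n) < min_energy A' F' G' + \<delta>1 / 4"
      using order_tendstoD(2)[OF minimizingD(3)[OF min]] order_tendstoD(2)[OF minimizingD(3)[OF min']] \<delta>1(1) by auto
    have "\<forall>\<^sub>F n in sequentially. (LINT x|\<mu>. \<bar>\<phi> n x - \<phi>' n x\<bar>) \<le> \<epsilon>"
      using ev
    proof eventually_elim
      case (elim n)
      note c = minimizingD(1)[OF min, of n] minimizingD(1)[OF min', of n]
      have "J A F G (\<phi> n) \<le> 1" "J A' F' G' (\<phi>' n) \<le> 1"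
        using elim min_energy_nonpos[OF adm(1)] min_energy_nonpos[OF adm(2)] \<delta>1 by linarith+
      from energy_perturbation[OF adm c(1) this(1)] energy_perturbation[OF adm(2,1) c(2) this(2)]
      have "J A' F' G' (\<phi> n) \<le> J A F G (\<phi> n) + \<delta>1 / 4" "J A F G (\<phi>' n) \<le> J A' F' G' (\<phi>' n) + \<delta>1 / 4"
        using C\<delta>[OF d] C\<delta>[OF d'] by linarith+
      moreover have "min_energy A' F' G' \<le> J A' F' G' (\<phi> n)" by (rule min_energy_le[OF adm(2) minimizingD(2)[OF min]])
      ultimately have "J A F G (\<phi>' n) \<le> min_energy A F G + \<delta>0" "J A F G (\<phi> n) \<le> min_energy A F G + \<delta>0"
        using elim \<delta>1 by linarith+
      then show ?case using \<delta>0(2)[OF adm(1) c] by blast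
    qed
    then have "\<forall>\<^sub>F n in sequentially. (LINT x|\<mu>. \<bar>u x - u' x\<bar>) \<le> (LINT x|\<mu>. \<bar>\<phi> n x - u x\<bar>) + \<epsilon> + (LINT x|\<mu>. \<bar>\<phi>' n x - u' x\<bar>)"
    proof eventually_elim
      case (elim n)
      note i = minimizing_diff_integrable[OF min, of n] minimizing_diff_integrable[OF min', of n]
        capped_diff_integrable[OF minimizingD(1)[OF min, of n] minimizingD(1)[OF min', of n]]
        L2_D(3)[OF L2_diff[OF minimizingD(4)[OF min] minimizingD(4)[OF min']]]
      have "(LINT x|\<mu>. \<bar>u x - u' x\<bar>) \<le> (LINT x|\<mu>. \<bar>\<phi> n x - u x\<bar> + \<bar>\<phi> n x - \<phi>' n x\<bar> + \<bar>\<phi>' n x - u' x\<bar>)"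
        by (intro integral_mono Bochner_Integration.integrable_add integrable_abs i) linarith
      also have "\<dots> = (LINT x|\<mu>. \<bar>\<phi> n x - u x\<bar>) + (LINT x|\<mu>. \<bar>\<phi> n x - \<phi>' n x\<bar>) + (LINT x|\<mu>. \<bar>\<phi>' n x - u' x\<bar>)"
        using i by simp
      finally show ?case using elim by linarith
    qed
    moreover have "(\<lambda>n. (LINT x|\<mu>. \<bar>\<phi> n x - u x\<bar>) + \<epsilon> + (LINT x|\<mu>. \<bar>\<phi>' n x - u' x\<bar>)) \<longlonglongrightarrow> 0 + \<epsilon> + 0"
      by (intro tendsto_add tendsto_const minimizing_L1[OF min] minimizing_L1[OF min'])
    ultimately show "(LINT x|\<mu>. \<bar>u x - u' x\<bar>) \<le> \<epsilon>"
      using tendsto_le[OF sequentially_bot _ tendsto_const] by force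
  qed
qed

end

section \<open>A bump function whose negative Laplacian is dominated by the function\<close>

definition laplacian :: "('a::euclidean_space \<Rightarrow> real) \<Rightarrow> 'a \<Rightarrow> real" where
  "laplacian w x = (\<Sum>b\<in>Basis. grad (\<lambda>y. grad w y \<bullet> b) x \<bullet> b)"

text \<open>
  This elementary bound governs the Laplacian of the bump function below near the edge of its
  support.
\<close>

lemma cubic_le_quartic:
  fixes P Q R :: real
  assumes "0 \<le> P" "0 \<le> Q" "0 < R"
  obtains K where "0 \<le> K" "\<And>y. 0 \<le> y \<Longrightarrow> P * y ^ 3 + Q * y\<^sup>2 \<le> R * y ^ 4 + K"
proof -
  define S where "S = P + Q"
  have S: "0 \<le> S" using assms by (simp add: S_def)
  define K where "K = S + S * (S / R) ^ 3"
  have K: "S \<le> K" "S * (S / R) ^ 3 \<le> K" using S assms by (auto simp: K_def)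
  have "P * y ^ 3 + Q * y\<^sup>2 \<le> R * y ^ 4 + K" if y: "0 \<le> y" for y
  proof (cases "y \<le> 1")
    case True
    have "P * y ^ 3 \<le> P * 1" "Q * y\<^sup>2 \<le> Q * 1"
      using True y assms by (intro mult_left_mono power_le_one; simp)+
    moreover have "0 \<le> R * y ^ 4" using assms y by simp
    ultimately show ?thesis using K(1) by (simp add: S_def)
  next
    case False
    have "Q * y\<^sup>2 \<le> Q * y ^ 3" using False assms by (intro mult_left_mono power_increasing) auto
    then have 1: "P * y ^ 3 + Q * y\<^sup>2 \<le> S * y ^ 3" by (simp add: S_def distrib_right)
    show ?thesis
    proof (cases "S \<le> R * y")
      case True
      have "S * y ^ 3 \<le> (R * y) * y ^ 3" using True y by (intro mult_right_mono) auto
      also have "\<dots> = R * y ^ 4" by (simp add: eval_nat_numeral)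
      finally show ?thesis using 1 K(1) S by linarith
    next
      case False
      then have "y \<le> S / R" using assms by (simp add: pos_le_divide_eq mult.commute)
      then have "S * y ^ 3 \<le> S * (S / R) ^ 3" using S y by (intro mult_left_mono power_mono) auto
      moreover have "0 \<le> R * y ^ 4" using assms y by simp
      ultimately show ?thesis using 1 K(2) by linarith
    qed
  qed
  moreover have "0 \<le> K" using K(1) S by linarith
  ultimately show ?thesis using that by blast
qed

lemma flat_exp_0_has_derivative: "(flat_exp 0 has_real_derivative flat_exp 2 t) (at t)"
  and flat_exp_2_has_derivative: "(flat_exp 2 has_real_derivative (flat_exp 4 t - 2 * flat_exp 3 t)) (at t)"
  using flat_exp_has_derivative[of 0 t] flat_exp_has_derivative[of 2 t] by (simp_all add: eval_nat_numeral)

definition ball_bump :: "'a::euclidean_space \<Rightarrow> real \<Rightarrow> 'a \<Rightarrow> real" where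
  "ball_bump z \<rho> x = flat_exp 0 (\<rho>\<^sup>2 - (norm (x - z))\<^sup>2)"

lemma smooth_radial: "smooth (\<lambda>x. \<rho>\<^sup>2 - (norm (x - z))\<^sup>2)"
proof -
  have eq: "(norm (x - z))\<^sup>2 = (\<Sum>b\<in>Basis. (x \<bullet> b - z \<bullet> b)\<^sup>2)" for x
    unfolding power2_norm_eq_inner by (subst euclidean_inner) (simp add: inner_diff_left power2_eq_square)
  show ?thesis
    unfolding eq by (intro smooth_diff smooth_const smooth_sum smooth_power2 smooth_inner finite_Basis)
qed

lemma smooth_ball_bump: "smooth (ball_bump z \<rho>)"
  unfolding ball_bump_def[abs_def] by (intro smooth_flat_exp smooth_radial)

lemma ball_bump_bounds: "0 \<le> ball_bump z \<rho> x" "ball_bump z \<rho> x \<le> 1"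
  by (simp_all add: ball_bump_def flat_exp_nonneg flat_exp_0_le_1)

lemma ball_bump_pos: "x \<in> ball z \<rho> \<Longrightarrow> 0 < ball_bump z \<rho> x"
proof -
  assume "x \<in> ball z \<rho>"
  then have "norm (x - z) < \<rho>" by (simp add: dist_norm norm_minus_commute)
  then have "(norm (x - z))\<^sup>2 < \<rho>\<^sup>2" by (intro power_strict_mono) auto
  then show ?thesis by (simp add: ball_bump_def flat_exp_def)
qed

lemma ball_bump_outside: "\<rho> > 0 \<Longrightarrow> x \<notin> ball z \<rho> \<Longrightarrow> ball_bump z \<rho> x = 0"
proof -
  assume "\<rho> > 0" "x \<notin> ball z \<rho>"
  then have "\<rho> \<le> norm (x - z)" by (simp add: dist_norm norm_minus_commute)
  then have "\<rho>\<^sup>2 \<le> (norm (x - z))\<^sup>2" using \<open>\<rho> > 0\<close> by (intro power_mono) auto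
  then show ?thesis by (simp add: ball_bump_def flat_exp_def)
qed

lemma test_ball_bump: "\<rho> > 0 \<Longrightarrow> cball z \<rho> \<subseteq> \<Omega> \<Longrightarrow> ball_bump z \<rho> \<in> test_functions \<Omega>"
  by (rule test_functionsI[OF smooth_ball_bump compact_cball[of z \<rho>]]) (auto intro!: ball_bump_outside)

lemma ball_bump_laplacian:
  fixes z x :: "'a::euclidean_space" and \<rho> :: real
  defines "s \<equiv> \<rho>\<^sup>2 - (norm (x - z))\<^sup>2"
  shows "laplacian (ball_bump z \<rho>) x =
    4 * (norm (x - z))\<^sup>2 * (flat_exp 4 s - 2 * flat_exp 3 s) - 2 * DIM('a) * flat_exp 2 s"
proof -
  have ds: "GDERIV (\<lambda>y. \<rho>\<^sup>2 - (norm (y - z))\<^sup>2) y :> (-2) *\<^sub>R (y - z)" for y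
    unfolding gderiv_def power2_norm_eq_inner
    by (auto intro!: derivative_eq_intros simp: inner_commute algebra_simps)
  have gb: "grad (ball_bump z \<rho>) y = flat_exp 2 (\<rho>\<^sup>2 - (norm (y - z))\<^sup>2) *\<^sub>R ((-2) *\<^sub>R (y - z))" for y
  proof (rule grad_eqI)
    show "GDERIV (ball_bump z \<rho>) y :> flat_exp 2 (\<rho>\<^sup>2 - (norm (y - z))\<^sup>2) *\<^sub>R ((-2) *\<^sub>R (y - z))"
      unfolding ball_bump_def[abs_def]
      by (rule GDERIV_DERIV_compose[OF ds flat_exp_0_has_derivative])
  qed
  have "grad (\<lambda>y. grad (ball_bump z \<rho>) y \<bullet> b) x \<bullet> b
     = 4 * (flat_exp 4 s - 2 * flat_exp 3 s) * ((x - z) \<bullet> b)\<^sup>2 - 2 * flat_exp 2 s" if b: "b \<in> Basis" for b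
  proof -
    have d1: "GDERIV (\<lambda>y. flat_exp 2 (\<rho>\<^sup>2 - (norm (y - z))\<^sup>2)) x :> (flat_exp 4 s - 2 * flat_exp 3 s) *\<^sub>R ((-2) *\<^sub>R (x - z))"
      unfolding s_def by (rule GDERIV_DERIV_compose[OF ds flat_exp_2_has_derivative])
    have d2: "GDERIV (\<lambda>y. (-2) * ((y - z) \<bullet> b)) x :> (-2) *\<^sub>R b"
      unfolding gderiv_def by (auto intro!: derivative_eq_intros)
    have "grad (\<lambda>y. grad (ball_bump z \<rho>) y \<bullet> b) x
      = flat_exp 2 s *\<^sub>R ((-2) *\<^sub>R b) + ((-2) * ((x - z) \<bullet> b)) *\<^sub>R ((flat_exp 4 s - 2 * flat_exp 3 s) *\<^sub>R ((-2) *\<^sub>R (x - z)))"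
    proof (rule grad_eqI)
      have "GDERIV (\<lambda>y. flat_exp 2 (\<rho>\<^sup>2 - (norm (y - z))\<^sup>2) * ((-2) * ((y - z) \<bullet> b))) x :>
        flat_exp 2 s *\<^sub>R ((-2) *\<^sub>R b) + ((-2) * ((x - z) \<bullet> b)) *\<^sub>R ((flat_exp 4 s - 2 * flat_exp 3 s) *\<^sub>R ((-2) *\<^sub>R (x - z)))"
        using GDERIV_mult[OF d1 d2] by (simp only: s_def)
      moreover have "(\<lambda>y. flat_exp 2 (\<rho>\<^sup>2 - (norm (y - z))\<^sup>2) * ((-2) * ((y - z) \<bullet> b))) = (\<lambda>y. grad (ball_bump z \<rho>) y \<bullet> b)"
        by (simp add: gb mult.assoc)
      ultimately show "GDERIV (\<lambda>y. grad (ball_bump z \<rho>) y \<bullet> b) x :>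
        flat_exp 2 s *\<^sub>R ((-2) *\<^sub>R b) + ((-2) * ((x - z) \<bullet> b)) *\<^sub>R ((flat_exp 4 s - 2 * flat_exp 3 s) *\<^sub>R ((-2) *\<^sub>R (x - z)))"
        by simp
    qed
    then show ?thesis
      using b by (simp only: inner_add_left inner_scaleR_left inner_same_Basis) (simp add: power2_eq_square algebra_simps)
  qed
  then have "laplacian (ball_bump z \<rho>) x =
      (\<Sum>b\<in>Basis. 4 * (flat_exp 4 s - 2 * flat_exp 3 s) * ((x - z) \<bullet> b)\<^sup>2 - 2 * flat_exp 2 s)"
    unfolding laplacian_def by (intro sum.cong refl)
  also have "\<dots> = 4 * (flat_exp 4 s - 2 * flat_exp 3 s) * (\<Sum>b\<in>Basis. ((x - z) \<bullet> b)\<^sup>2) - 2 * DIM('a) * flat_exp 2 s"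
    by (simp add: sum_subtractf sum_distrib_left)
  also have "(\<Sum>b\<in>Basis. ((x - z) \<bullet> b)\<^sup>2) = (norm (x - z))\<^sup>2"
    unfolding power2_norm_eq_inner[of "x - z"] by (subst (2) euclidean_inner) (simp add: power2_eq_square)
  finally show ?thesis by (simp add: mult_ac)
qed

text \<open>
  With \<open>t = \<rho>\<^sup>2 - |x - z|\<^sup>2\<close> and \<open>y = 1 / t\<close>, the quotient of \<open>- \<Delta>w\<close> by \<open>w\<close> is a polynomial in \<open>y\<close> with leading
  term \<open>- 4 \<rho>\<^sup>2 y\<^sup>4\<close>, hence bounded from above.
\<close>

lemma ball_bump_subsolution:
  fixes z :: "'a::euclidean_space"
  assumes \<rho>: "\<rho> > 0"
  obtains K where "0 \<le> K" "\<And>x. - laplacian (ball_bump z \<rho>) x \<le> K * ball_bump z \<rho> x"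
proof -
  obtain K where K: "0 \<le> K" "\<And>y. 0 \<le> y \<Longrightarrow> (4 + 8 * \<rho>\<^sup>2) * y ^ 3 + (2 * real DIM('a)) * y\<^sup>2 \<le> (4 * \<rho>\<^sup>2) * y ^ 4 + K"
    using cubic_le_quartic[of "4 + 8 * \<rho>\<^sup>2" "2 * real DIM('a)" "4 * \<rho>\<^sup>2"] \<rho> by (auto simp: add_nonneg_nonneg)
  have "- laplacian (ball_bump z \<rho>) x \<le> K * ball_bump z \<rho> x" for x
  proof -
    define t where "t = \<rho>\<^sup>2 - (norm (x - z))\<^sup>2"
    show ?thesis
    proof (cases "t > 0")
      case False
      then show ?thesis unfolding ball_bump_laplacian t_def[symmetric] by (simp add: ball_bump_def t_def[symmetric] flat_exp_def)
    next
      case True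
      define y where "y = 1 / t"
      have y: "0 \<le> y" using True by (simp add: y_def)
      have fe: "flat_exp n t = flat_exp 0 t * y ^ n" for n using True by (simp add: flat_exp_def y_def power_divide)
      have n: "(norm (x - z))\<^sup>2 = \<rho>\<^sup>2 - t" by (simp add: t_def)
      have q: "(\<rho>\<^sup>2 - t) * y ^ 4 = \<rho>\<^sup>2 * y ^ 4 - y ^ 3" using True by (simp add: y_def field_simps eval_nat_numeral)
      have q3: "(\<rho>\<^sup>2 - t) * y ^ 3 \<le> \<rho>\<^sup>2 * y ^ 3" using True y by (intro mult_right_mono) auto
      have "- laplacian (ball_bump z \<rho>) x = flat_exp 0 t * (- (4 * ((\<rho>\<^sup>2 - t) * y ^ 4)) + 8 * ((\<rho>\<^sup>2 - t) * y ^ 3) + 2 * real DIM('a) * y\<^sup>2)"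
        unfolding ball_bump_laplacian t_def[symmetric] unfolding n fe[of 4] fe[of 3] fe[of 2] by (simp add: algebra_simps)
      also have "\<dots> \<le> flat_exp 0 t * K"
      proof (rule mult_left_mono)
        show "- (4 * ((\<rho>\<^sup>2 - t) * y ^ 4)) + 8 * ((\<rho>\<^sup>2 - t) * y ^ 3) + 2 * real DIM('a) * y\<^sup>2 \<le> K"
          using K(2)[OF y] q3 unfolding q by (simp add: algebra_simps)
      qed (rule flat_exp_nonneg)
      finally show ?thesis by (simp add: ball_bump_def t_def mult.commute)
    qed
  qed
  with K(1) show ?thesis by (rule that)
qed

context bounded_domain
begin

lemma test_laplacian:
  assumes "w \<in> test"
  shows "laplacian w \<in> test"
proof -
  have "(\<lambda>x. \<Sum>b\<in>S. grad (\<lambda>y. grad w y \<bullet> b) x \<bullet> b) \<in> test" if "finite S" "S \<subseteq> Basis" for S :: "'a set"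
    using that by (induction S rule: finite_induct) (auto intro!: test_zero test_add test_grad_component assms)
  then show ?thesis unfolding laplacian_def[abs_def] by simp
qed

text \<open>
  Integration by parts in each coordinate.
\<close>

lemma green_identity:
  assumes w: "w \<in> test" and \<eta>: "\<eta> \<in> test"
  shows "(LINT x|\<mu>. grad w x \<bullet> grad \<eta> x) = - (LINT x|\<mu>. laplacian w x * \<eta> x)"
proof -
  have part: "(LINT x|\<mu>. (grad w x \<bullet> b) * (grad \<eta> x \<bullet> b)) = - (LINT x|\<mu>. (grad (\<lambda>y. grad w y \<bullet> b) x \<bullet> b) * \<eta> x)"
    and ints: "integrable \<mu> (\<lambda>x. (grad w x \<bullet> b) * (grad \<eta> x \<bullet> b))" "integrable \<mu> (\<lambda>x. (grad (\<lambda>y. grad w y \<bullet> b) x \<bullet> b) * \<eta> x)"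
    if b: "b \<in> Basis" for b
  proof -
    note tb = test_grad_component[OF w b]
    have L: "grad \<eta> \<in> L1_loc \<Omega>" "grad (\<lambda>y. grad w y \<bullet> b) \<in> L1_loc \<Omega>"
      using \<eta> tb grad_test_in_L2 L2_D(3) integrable_imp_L1_loc by blast+
    note i = test_mult_L1_loc_integrable[OF tb L(1)] test_mult_L1_loc_integrable[OF \<eta> L(2)]
    have e1: "(LINT x|\<mu>. (grad w x \<bullet> b) * (grad \<eta> x \<bullet> b)) = (LINT x|\<mu>. (grad w x \<bullet> b) *\<^sub>R grad \<eta> x) \<bullet> b"
      using integral_inner_left[OF i(1), of b] by simp
    have e2: "(LINT x|\<mu>. (grad (\<lambda>y. grad w y \<bullet> b) x \<bullet> b) * \<eta> x) = (LINT x|\<mu>. \<eta> x *\<^sub>R grad (\<lambda>y. grad w y \<bullet> b) x) \<bullet> b"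
      using integral_inner_left[OF i(2), of b] by (simp add: mult.commute)
    show "(LINT x|\<mu>. (grad w x \<bullet> b) * (grad \<eta> x \<bullet> b)) = - (LINT x|\<mu>. (grad (\<lambda>y. grad w y \<bullet> b) x \<bullet> b) * \<eta> x)"
      unfolding e1 e2 integration_by_parts[OF domain_sets tb \<eta>] by simp
    show "integrable \<mu> (\<lambda>x. (grad w x \<bullet> b) * (grad \<eta> x \<bullet> b))"
      using integrable_inner_left[OF i(1), of b] by simp
    show "integrable \<mu> (\<lambda>x. (grad (\<lambda>y. grad w y \<bullet> b) x \<bullet> b) * \<eta> x)"
      using integrable_inner_left[OF i(2), of b] by (simp add: mult.commute)
  qed
  have "(LINT x|\<mu>. grad w x \<bullet> grad \<eta> x) = (LINT x|\<mu>. (\<Sum>b\<in>Basis. (grad w x \<bullet> b) * (grad \<eta> x \<bullet> b)))"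
    by (subst euclidean_inner) simp
  also have "\<dots> = (\<Sum>b\<in>Basis. (LINT x|\<mu>. (grad w x \<bullet> b) * (grad \<eta> x \<bullet> b)))"
    by (intro Bochner_Integration.integral_sum ints)
  also have "\<dots> = - (\<Sum>b\<in>Basis. (LINT x|\<mu>. (grad (\<lambda>y. grad w y \<bullet> b) x \<bullet> b) * \<eta> x))"
    by (simp add: part sum_negf)
  also have "(\<Sum>b\<in>Basis. (LINT x|\<mu>. (grad (\<lambda>y. grad w y \<bullet> b) x \<bullet> b) * \<eta> x)) = (LINT x|\<mu>. laplacian w x * \<eta> x)"
    unfolding laplacian_def sum_distrib_right by (intro Bochner_Integration.integral_sum[symmetric] ints)
  finally show ?thesis .
qed

end

section \<open>Positivity of minimizers\<close>

context frozen_problem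
begin

text \<open>
  The competitor is the smoothed maximum \<open>\<phi> + p\<close> of \<open>\<phi>\<close> and \<open>v\<close>, where \<open>p\<close> approximates the positive part
  of \<open>d = v - \<phi>\<close>. Its Dirichlet integral exceeds that of \<open>\<phi>\<close> by at most \<open>2 \<integral>\<nabla>v \<bullet> \<nabla>p = - 2 \<integral>\<Delta>v p\<close>,
  which is bounded by a linear cost \<open>K v\<close> times the positive part; the gain in the potential
  exceeds this cost.
\<close>

lemma comparison_with_subsolution:
  assumes adm: "admissible A F G" and v: "v \<in> test" "\<And>x. 0 \<le> v x" "\<And>x. v x \<le> c" "c \<le> 1"
    and K: "0 \<le> K" "\<And>x. - laplacian v x \<le> K * v x"
    and c: "(A * K + G + 1) * c powr (1 - \<alpha>) \<le> F / 2"
    and \<phi>: "\<phi> \<in> capped_test"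
  shows "(LINT x|\<mu>. v x * max 0 (v x - \<phi> x)) \<le> J A F G \<phi> - min_energy A F G"
proof (rule field_le_epsilon)
  fix \<epsilon> :: real assume \<epsilon>: "\<epsilon> > 0"
  note t = capped_testD(1)[OF \<phi>] and adD = admissibleD[OF adm]
  obtain C where C: "C > 0" "\<And>x. \<bar>laplacian v x\<bar> \<le> C" using test_bounded[OF test_laplacian[OF v(1)]] by metis
  define D where "D = (A * C + Lip B) * vol"
  have D0: "0 \<le> D" unfolding D_def using C adD Lip_nonneg vol_nonneg by (intro mult_nonneg_nonneg add_nonneg_nonneg) auto
  define \<delta> where "\<delta> = \<epsilon> / (D + 1)"
  have \<delta>: "0 < \<delta>" "D * \<delta> \<le> \<epsilon>"
  proof -
    show p: "0 < \<delta>" using \<epsilon> D0 by (simp add: \<delta>_def add_nonneg_pos)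
    have "\<delta> * (D + 1) = \<epsilon>" using D0 by (simp add: \<delta>_def)
    then show "D * \<delta> \<le> \<epsilon>" using p by (simp add: algebra_simps)
  qed
  note sb = soft_abs_bounds[OF \<delta>(1)]
  define d where "d x = v x - \<phi> x" for x
  \<comment> \<open>This is the positive part \<open>(d + |d|) / 2\<close>, smoothed and shifted so that it vanishes with \<open>d\<close>.\<close>
  define p where "p x = (1/2) * (d x + soft_abs \<delta> (d x) - \<delta>)" for x
  define z where "z x = \<phi> x + p x" for x
  have smd: "smooth d" unfolding d_def[abs_def] by (intro smooth_diff test_smooth[OF v(1)] test_smooth[OF t])
  have smp: "smooth p" unfolding p_def[abs_def]
    by (intro smooth_mult smooth_diff smooth_add smooth_const smooth_soft_abs smd \<delta>)
  have tp: "p \<in> test"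
    by (rule test_functions_compose2[OF v(1) t smp]) (use \<delta> in \<open>simp add: p_def d_def soft_abs_def\<close>)
  have tz: "z \<in> test" unfolding z_def[abs_def] by (rule test_add[OF t tp])
  have p_max: "\<bar>p x - max 0 (d x)\<bar> \<le> \<delta>" "p x \<le> max 0 (d x)" for x
  proof -
    have eq: "p x - max 0 (d x) = (soft_abs \<delta> (d x) - \<bar>d x\<bar>) / 2 - \<delta> / 2"
      by (auto simp: p_def max_def abs_if field_simps)
    have "0 \<le> (soft_abs \<delta> (d x) - \<bar>d x\<bar>) / 2" "(soft_abs \<delta> (d x) - \<bar>d x\<bar>) / 2 \<le> \<delta> / 2"
      using sb(1,2)[of "d x"] by auto
    with eq \<delta>(1) show "\<bar>p x - max 0 (d x)\<bar> \<le> \<delta>" "p x \<le> max 0 (d x)" by linarith+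
  qed
  have max_eq: "max (\<phi> x) (v x) = \<phi> x + max 0 (d x)" for x by (auto simp: d_def max_def)
  have zb: "0 \<le> z x" "z x \<le> max (\<phi> x) (v x)" for x
  proof -
    have "z x = (\<phi> x + v x + (soft_abs \<delta> (d x) - \<delta>)) / 2" by (simp add: z_def p_def d_def field_simps)
    then show "0 \<le> z x" using sb(3)[of "d x"] capped_testD(2)[OF \<phi>, of x] v(2)[of x] by simp
    show "z x \<le> max (\<phi> x) (v x)"
      using p_max(2)[of x] by (simp add: z_def max_eq)
  qed
  have mB: "0 \<le> max (\<phi> x) (v x)" "max (\<phi> x) (v x) \<le> B" for x
    using capped_testD(2,3)[OF \<phi>, of x] v(2,3)[of x] v(4) B_ge by auto
  have po: "pot F G (z x) \<le> pot F G (max (\<phi> x) (v x)) + Lip B * \<delta>" for x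
  proof -
    have "\<bar>pot F G (z x) - pot F G (max (\<phi> x) (v x))\<bar> \<le> Lip B * \<bar>z x - max (\<phi> x) (v x)\<bar>"
      using zb[of x] mB[of x] by (intro pot_lipschitz[OF adm]) auto
    also have "\<dots> \<le> Lip B * \<delta>" using p_max(1)[of x] Lip_nonneg by (intro mult_left_mono) (auto simp: z_def max_eq)
    finally show ?thesis by linarith
  qed
  have gr: "(norm (grad z x))\<^sup>2 \<le> (norm (grad \<phi> x))\<^sup>2 + 2 * (grad v x \<bullet> grad p x)" for x
  proof -
    \<comment> \<open>The slope \<open>r\<close> lies in \<open>[0, 1]\<close>, so \<open>r\<^sup>2 - 2 r \<le> 0\<close> and the term with \<open>|\<nabla>d|\<^sup>2\<close> has the right sign.\<close>
    define r where "r = (1/2) * (1 + d x / soft_abs \<delta> (d x))"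
    have r: "0 \<le> r" "r \<le> 1" using soft_abs_slope[OF \<delta>(1), of "d x"] unfolding r_def abs_le_iff by auto
    have "((\<lambda>s. (1/2) * (s + soft_abs \<delta> s - \<delta>)) has_real_derivative r) (at (d x))"
      unfolding r_def by (auto intro!: derivative_eq_intros soft_abs_has_derivative[OF \<delta>(1)])
    from grad_compose[OF smd this] have gp: "grad p x = r *\<^sub>R grad d x" by (simp add: p_def[abs_def])
    have "GDERIV d x :> grad v x - grad \<phi> x"
      unfolding d_def[abs_def] by (intro GDERIV_diff smooth_GDERIV test_smooth[OF v(1)] test_smooth[OF t])
    then have gd: "grad d x = grad v x - grad \<phi> x" by (rule grad_eqI)
    then have g\<phi>: "grad \<phi> x = grad v x - grad d x" by simp
    have gz: "grad z x = grad \<phi> x + r *\<^sub>R grad d x"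
      unfolding z_def[abs_def] grad_add[OF test_smooth[OF t] smp] gp by simp
    have "(norm (grad z x))\<^sup>2 = (norm (grad \<phi> x))\<^sup>2 + 2 * r * (grad \<phi> x \<bullet> grad d x) + r\<^sup>2 * (norm (grad d x))\<^sup>2"
      unfolding gz power2_norm_eq_inner by (simp add: inner_add_left inner_add_right inner_commute power2_eq_square)
    also have "\<dots> = (norm (grad \<phi> x))\<^sup>2 + 2 * (grad v x \<bullet> grad p x) - (r * (2 - r)) * (norm (grad d x))\<^sup>2"
      unfolding gp g\<phi> power2_norm_eq_inner by (simp add: inner_diff_left inner_diff_right inner_commute power2_eq_square algebra_simps)
    also have "\<dots> \<le> (norm (grad \<phi> x))\<^sup>2 + 2 * (grad v x \<bullet> grad p x)"
      using mult_nonneg_nonneg[OF mult_nonneg_nonneg[OF r(1), of "2 - r"], of "(norm (grad d x))\<^sup>2"] r by simp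
    finally show ?thesis .
  qed
  note ig = grad_test_square_integrable[OF t] L2_inner_integrable[OF grad_test_in_L2[OF v(1)] grad_test_in_L2[OF tp]]
  note [measurable] = test_measurable[OF t] test_measurable[OF v(1)] test_measurable[OF tp] test_measurable[OF test_laplacian[OF v(1)]]
  have ipm: "integrable \<mu> (\<lambda>x. pot F G (max (\<phi> x) (v x)))"
    by (rule pot_integrable[OF adm, of _ B]) (measurable, use mB in simp)
  have dB: "max 0 (d x) \<le> 1" for x using v(3)[of x] v(4) capped_testD(2)[OF \<phi>, of x] by (simp add: d_def)
  have ivd: "integrable \<mu> (\<lambda>x. v x * max 0 (d x))"
  proof (rule bounded_integrable[of _ "1 * 1"])
    show "(\<lambda>x. v x * max 0 (d x)) \<in> borel_measurable \<mu>" unfolding d_def by measurable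
    show "norm (v x * max 0 (d x)) \<le> 1 * 1" for x
      unfolding norm_mult using v(2,3)[of x] v(4) dB[of x] by (intro mult_mono) auto
  qed
  have ilp: "integrable \<mu> (\<lambda>x. laplacian v x * p x)"
    using L2_inner_integrable[OF test_in_L2[OF test_laplacian[OF v(1)]] test_in_L2[OF tp]] by simp
  have "(LINT x|\<mu>. grad v x \<bullet> grad p x) = (LINT x|\<mu>. - (laplacian v x * p x))"
    using green_identity[OF v(1) tp] by simp
  also have "\<dots> \<le> (LINT x|\<mu>. K * (v x * max 0 (d x)) + C * \<delta>)"
  proof (rule integral_mono)
    show "- (laplacian v x * p x) \<le> K * (v x * max 0 (d x)) + C * \<delta>" for x
    proof -
      have "- (laplacian v x * p x) = - laplacian v x * max 0 (d x) + - laplacian v x * (p x - max 0 (d x))" by (simp add: algebra_simps)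
      also have "- laplacian v x * max 0 (d x) \<le> K * v x * max 0 (d x)" using K(2)[of x] by (intro mult_right_mono) auto
      also have "- laplacian v x * (p x - max 0 (d x)) \<le> \<bar>- laplacian v x * (p x - max 0 (d x))\<bar>" by simp
      also have "\<dots> \<le> C * \<delta>" unfolding abs_mult using C(2)[of x] C(1) p_max(1)[of x] by (intro mult_mono) auto
      finally show ?thesis by (simp add: mult.assoc)
    qed
  qed (use ilp ivd in auto)
  also have "\<dots> = K * (LINT x|\<mu>. v x * max 0 (d x)) + C * \<delta> * vol"
    using ivd by (simp add: integral_const_vol[symmetric])
  finally have lap: "A * (LINT x|\<mu>. grad v x \<bullet> grad p x) \<le> A * (K * (LINT x|\<mu>. v x * max 0 (d x)) + C * \<delta> * vol)"
    using adD by (intro mult_left_mono) auto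
  have pw: "pot F G (max (\<phi> x) (v x)) \<le> pot F G (\<phi> x) - (A * K + 1) * (v x * max 0 (d x))" for x
  proof -
    have "A * K * v x * max 0 (v x - \<phi> x) + pot F G (max (\<phi> x) (v x)) - pot F G (\<phi> x) \<le> - (v x * max 0 (v x - \<phi> x))"
      by (rule potential_subsolution[where c = c]) (use capped_testD(2)[OF \<phi>, of x] v adD \<alpha> \<beta> K c in auto)
    then show ?thesis unfolding d_def by (simp add: algebra_simps)
  qed
  have "(LINT x|\<mu>. pot F G (max (\<phi> x) (v x))) \<le> (LINT x|\<mu>. pot F G (\<phi> x) - (A * K + 1) * (v x * max 0 (d x)))"
    by (intro integral_mono ipm Bochner_Integration.integrable_diff pot_test_integrable[OF adm t] integrable_mult_right ivd pw)
  also have "\<dots> = (LINT x|\<mu>. pot F G (\<phi> x)) - (A * K + 1) * (LINT x|\<mu>. v x * max 0 (d x))"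
    using ivd pot_test_integrable[OF adm t] by simp
  finally have pint: "(LINT x|\<mu>. pot F G (max (\<phi> x) (v x))) \<le> \<dots>" .
  have "min_energy A F G \<le> J A F G z" by (rule min_energy_le[OF adm tz])
  also have "\<dots> \<le> A / 2 * (LINT x|\<mu>. (norm (grad \<phi> x))\<^sup>2 + 2 * (grad v x \<bullet> grad p x)) + (LINT x|\<mu>. pot F G (max (\<phi> x) (v x))) + Lip B * \<delta> * vol"
    by (rule energy_compare[OF adm tz _ gr ipm po]) (use ig in auto)
  also have "A / 2 * (LINT x|\<mu>. (norm (grad \<phi> x))\<^sup>2 + 2 * (grad v x \<bullet> grad p x))
      = A / 2 * (LINT x|\<mu>. (norm (grad \<phi> x))\<^sup>2) + A * (LINT x|\<mu>. grad v x \<bullet> grad p x)"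
    using ig by (simp add: distrib_left)
  finally have "min_energy A F G \<le> J A F G \<phi> - (LINT x|\<mu>. v x * max 0 (d x)) + D * \<delta>"
    using lap pint unfolding energy_def D_def by (simp add: algebra_simps)
  then show "(LINT x|\<mu>. v x * max 0 (v x - \<phi> x)) \<le> J A F G \<phi> - min_energy A F G + \<epsilon>"
    using \<delta>(2) unfolding d_def by linarith
qed

text \<open>
  Along the minimizing sequence the right-hand side of the comparison tends to zero, so \<open>u \<ge> v\<close> almost
  everywhere where \<open>v > 0\<close>. Countably many balls on which such a \<open>v\<close> is positive cover \<open>\<Omega>\<close>.
\<close>

lemma minimizer_positive:
  assumes adm: "admissible A F G" and min: "minimizing A F G \<phi> u V"
  shows "AE x in \<mu>. 0 < u x"
proof -
  note adD = admissibleD[OF adm]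
  have loc: "AE x in \<mu>. x \<in> ball y \<rho> \<longrightarrow> 0 < u x" if \<rho>: "\<rho> > 0" and sub: "cball y \<rho> \<subseteq> \<Omega>" for y \<rho>
  proof -
    obtain K where K: "0 \<le> K" "\<And>x. - laplacian (ball_bump y \<rho>) x \<le> K * ball_bump y \<rho> x"
      using ball_bump_subsolution[OF \<rho>] by blast
    have "A * K + G + 1 > 0" using adD K(1) by (intro add_nonneg_pos add_nonneg_nonneg mult_nonneg_nonneg) auto
    then obtain c where c: "0 < c" "c \<le> 1" "(A * K + G + 1) * c powr (1 - \<alpha>) \<le> F / 2"
      using small_constant_exists[of \<alpha> "A * K + G + 1" "F / 2"] \<alpha> adD by auto
    note w = test_ball_bump[OF \<rho> sub]
    define v where "v x = c * ball_bump y \<rho> x" for x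
    have tv: "v \<in> test" unfolding v_def[abs_def] by (rule test_scale[OF w])
    have v0: "0 \<le> v x" "v x \<le> c" for x
      using c ball_bump_bounds[of y \<rho> x] mult_left_mono[of "ball_bump y \<rho> x" 1 c] by (auto simp: v_def)
    have lap: "laplacian v x = c * laplacian (ball_bump y \<rho>) x" for x
    proof -
      have "grad (\<lambda>z. grad v z \<bullet> b) x \<bullet> b = c * (grad (\<lambda>z. grad (ball_bump y \<rho>) z \<bullet> b) x \<bullet> b)" if b: "b \<in> Basis" for b
        unfolding v_def[abs_def] grad_scale[OF smooth_ball_bump] inner_scaleR_left
          grad_scale[OF smooth_grad_component[OF smooth_ball_bump b]] by simp
      then show ?thesis by (simp add: laplacian_def sum_distrib_left)
    qed
    have lv: "- laplacian v x \<le> K * v x" for x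
      using mult_left_mono[OF K(2)[of x], of c] c unfolding lap v_def by (simp add: mult_ac)
    note uL = minimizingD(4)[OF min]
    note [measurable] = test_measurable[OF tv] L2_D(1)[OF uL]
    have int: "integrable \<mu> (\<lambda>x. v x * max 0 (v x - s x))" if s: "s \<in> borel_measurable \<mu>" "\<And>x. 0 \<le> s x" for s
    proof (rule bounded_integrable[of _ "1 * 1"])
      show "norm (v x * max 0 (v x - s x)) \<le> 1 * 1" for x
        unfolding norm_mult using v0[of x] c(2) s(2)[of x] by (intro mult_mono) auto
    qed (use s(1) in measurable)
    have "(LINT x|\<mu>. v x * max 0 (v x - u x)) \<le> (J A F G (\<phi> n) - min_energy A F G) + (LINT x|\<mu>. \<bar>\<phi> n x - u x\<bar>)" for n
    proof -
      note cn = minimizingD(1)[OF min, of n]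
      have "v x * max 0 (v x - u x) \<le> v x * max 0 (v x - \<phi> n x) + \<bar>\<phi> n x - u x\<bar>" for x
      proof -
        have "v x * max 0 (v x - u x) \<le> v x * (max 0 (v x - \<phi> n x) + \<bar>\<phi> n x - u x\<bar>)"
          using v0[of x] by (intro mult_left_mono) auto
        also have "v x * \<bar>\<phi> n x - u x\<bar> \<le> 1 * \<bar>\<phi> n x - u x\<bar>" using v0[of x] c(2) by (intro mult_right_mono) auto
        then have "v x * (max 0 (v x - \<phi> n x) + \<bar>\<phi> n x - u x\<bar>) \<le> v x * max 0 (v x - \<phi> n x) + \<bar>\<phi> n x - u x\<bar>"
          by (simp add: distrib_left)
        finally show ?thesis .
      qed
      then have "(LINT x|\<mu>. v x * max 0 (v x - u x)) \<le> (LINT x|\<mu>. v x * max 0 (v x - \<phi> n x) + \<bar>\<phi> n x - u x\<bar>)"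
        using int[OF test_measurable[OF minimizingD(2)[OF min]] capped_testD(2)[OF cn]]
          int[OF L2_D(1)[OF uL] minimizingD(6)[OF min]] minimizing_diff_integrable[OF min, of n]
        by (intro integral_mono) auto
      also have "\<dots> = (LINT x|\<mu>. v x * max 0 (v x - \<phi> n x)) + (LINT x|\<mu>. \<bar>\<phi> n x - u x\<bar>)"
        using int[OF test_measurable[OF minimizingD(2)[OF min]] capped_testD(2)[OF cn]] minimizing_diff_integrable[OF min, of n] by simp
      also have "(LINT x|\<mu>. v x * max 0 (v x - \<phi> n x)) \<le> J A F G (\<phi> n) - min_energy A F G"
        by (rule comparison_with_subsolution[OF adm tv v0 c(2) K(1) lv c(3) cn])
      finally show ?thesis by simp
    qed
    note bound = this
    have lim: "(\<lambda>n. (J A F G (\<phi> n) - min_energy A F G) + (LINT x|\<mu>. \<bar>\<phi> n x - u x\<bar>)) \<longlonglongrightarrow> (min_energy A F G - min_energy A F G) + 0"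
      by (intro tendsto_intros minimizingD(3)[OF min] minimizing_L1[OF min])
    have "(LINT x|\<mu>. v x * max 0 (v x - u x)) \<le> (min_energy A F G - min_energy A F G) + 0"
      by (rule LIMSEQ_le_const[OF lim]) (use bound in blast)
    then have "(LINT x|\<mu>. v x * max 0 (v x - u x)) \<le> 0" by simp
    then have "(LINT x|\<mu>. v x * max 0 (v x - u x)) = 0" using v0 by (intro antisym integral_nonneg) auto
    then have "AE x in \<mu>. v x * max 0 (v x - u x) = 0"
      using int[OF L2_D(1)[OF uL] minimizingD(6)[OF min]] v0 by (subst (asm) integral_nonneg_eq_0_iff_AE) auto
    then show ?thesis
    proof eventually_elim
      case (elim x)
      show ?case
      proof
        assume "x \<in> ball y \<rho>"
        then have "0 < ball_bump y \<rho> x" by (rule ball_bump_pos)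
        then have "0 < v x" using c(1) by (simp add: v_def)
        with elim show "0 < u x" by (auto simp: max_def split: if_splits)
      qed
    qed
  qed
  have "\<exists>\<rho>>0. cball y \<rho> \<subseteq> \<Omega>" if "y \<in> \<Omega>" for y using open_domain that open_contains_cball by blast
  then obtain \<rho> where \<rho>: "\<And>y. y \<in> \<Omega> \<Longrightarrow> \<rho> y > 0" "\<And>y. y \<in> \<Omega> \<Longrightarrow> cball y (\<rho> y) \<subseteq> \<Omega>" by metis
  obtain \<B> where \<B>: "\<B> \<subseteq> (\<lambda>y. ball y (\<rho> y)) ` \<Omega>" "countable \<B>" "\<Union>\<B> = \<Union>((\<lambda>y. ball y (\<rho> y)) ` \<Omega>)"
    using Lindelof[of "(\<lambda>y. ball y (\<rho> y)) ` \<Omega>"] by auto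
  have "AE x in \<mu>. \<forall>S\<in>\<B>. x \<in> S \<longrightarrow> 0 < u x"
    using \<B>(1) loc \<rho> by (subst AE_ball_countable[OF \<B>(2)]) blast
  moreover have "\<Omega> \<subseteq> \<Union>\<B>" unfolding \<B>(3) using \<rho>(1) by auto
  ultimately have cover: "AE x in \<mu>. \<forall>S\<in>\<B>. x \<in> S \<longrightarrow> 0 < u x" "\<Omega> \<subseteq> \<Union>\<B>" by blast+
  show ?thesis
    using cover(1) AE_space
  proof eventually_elim
    case (elim x)
    then have "x \<in> \<Omega>" by (simp add: space_restrict_space)
    with cover(2) elim show ?case by blast
  qed
qed

end

section \<open>The Euler-Lagrange equation\<close>

context frozen_problem
begin

lemma minimizing_perturbed_energy:
  assumes adm: "admissible A F G" and min: "minimizing A F G \<phi> u V" and \<eta>: "\<eta> \<in> test"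
  shows "(\<lambda>n. J A F G (\<lambda>x. \<phi> n x + t * \<eta> x)) \<longlonglongrightarrow> energy A F G (\<lambda>x. u x + t * \<eta> x) (\<lambda>x. V x + t *\<^sub>R grad \<eta> x)"
proof -
  note tp = minimizingD(2)[OF min] and uL = minimizingD(4)[OF min] and VL = minimizingD(5)[OF min]
  have t\<eta>: "(\<lambda>x. t * \<eta> x) \<in> test" by (rule test_scale[OF \<eta>])
  obtain C where C: "C > 0" "\<And>x. \<bar>t * \<eta> x\<bar> \<le> C" using test_bounded[OF t\<eta>] by metis
  have g: "grad (\<lambda>x. \<phi> n x + t * \<eta> x) x = grad (\<phi> n) x + t *\<^sub>R grad \<eta> x" for n x
    by (simp only: grad_add[OF test_smooth[OF tp] test_smooth[OF t\<eta>]] grad_scale[OF test_smooth[OF \<eta>]])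
  note ts = test_add[OF tp t\<eta>]
  have neg: "(\<lambda>x. - t *\<^sub>R grad \<eta> x) \<in> L2 \<Omega>"
  proof -
    have "grad (\<lambda>x. (- t) * \<eta> x) \<in> L2 \<Omega>" by (rule grad_test_in_L2[OF test_scale[OF \<eta>]])
    moreover have "grad (\<lambda>x. (- t) * \<eta> x) = (\<lambda>x. - t *\<^sub>R grad \<eta> x)"
      by (rule ext) (rule grad_scale[OF test_smooth[OF \<eta>]])
    ultimately show ?thesis by simp
  qed
  have VL': "(\<lambda>x. V x + t *\<^sub>R grad \<eta> x) \<in> L2 \<Omega>" using L2_diff[OF VL neg] by simp
  have "(\<lambda>n. LINT x|\<mu>. (norm (grad (\<lambda>x. \<phi> n x + t * \<eta> x) x))\<^sup>2) \<longlonglongrightarrow> (LINT x|\<mu>. (norm (V x + t *\<^sub>R grad \<eta> x))\<^sup>2)"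
    by (rule L2_tendsto_norm_square[OF L2_D(1,2)[OF grad_test_in_L2[OF ts]] L2_D(1,2)[OF VL']])
       (use minimizingD(9)[OF min] in \<open>simp add: g\<close>)
  moreover have "(\<lambda>n. LINT x|\<mu>. pot F G (\<phi> n x + t * \<eta> x)) \<longlonglongrightarrow> (LINT x|\<mu>. pot F G (u x + t * \<eta> x))"
  proof (rule Lim_null[THEN iffD2], rule tendsto_rabs_zero_cancel, rule tendsto_sandwich[OF _ _ tendsto_const])
    let ?D = "\<lambda>n. \<bar>(LINT x|\<mu>. pot F G (\<phi> n x + t * \<eta> x)) - (LINT x|\<mu>. pot F G (u x + t * \<eta> x))\<bar>"
    have b: "\<bar>\<phi> n x + t * \<eta> x\<bar> \<le> B + C" "\<bar>u x + t * \<eta> x\<bar> \<le> B + C" for n x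
      using capped_testD(4)[OF minimizingD(1)[OF min], of n x] minimizingD(6,7)[OF min, of x] C(2)[of x] by linarith+
    have i1: "integrable \<mu> (\<lambda>x. pot F G (\<phi> n x + t * \<eta> x))" for n by (rule pot_test_integrable[OF adm ts])
    have i2: "integrable \<mu> (\<lambda>x. pot F G (u x + t * \<eta> x))"
      by (rule pot_integrable[OF adm _ b(2)]) (use L2_D(1)[OF uL] test_measurable[OF t\<eta>] in measurable)
    have "?D n \<le> Lip (B + C) * (LINT x|\<mu>. \<bar>\<phi> n x - u x\<bar>)" for n
    proof -
      have "?D n = \<bar>LINT x|\<mu>. pot F G (\<phi> n x + t * \<eta> x) - pot F G (u x + t * \<eta> x)\<bar>" using i1 i2 by simp
      also have "\<dots> \<le> (LINT x|\<mu>. \<bar>pot F G (\<phi> n x + t * \<eta> x) - pot F G (u x + t * \<eta> x)\<bar>)" by (rule integral_abs_bound)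
      also have "\<dots> \<le> (LINT x|\<mu>. Lip (B + C) * \<bar>\<phi> n x - u x\<bar>)"
      proof (rule integral_mono)
        show "\<bar>pot F G (\<phi> n x + t * \<eta> x) - pot F G (u x + t * \<eta> x)\<bar> \<le> Lip (B + C) * \<bar>\<phi> n x - u x\<bar>" for x
          using pot_lipschitz[OF adm b(1) b(2), of n x x] by simp
      qed (use i1 i2 minimizing_diff_integrable[OF min] in auto)
      finally show ?thesis by simp
    qed
    then show "\<forall>\<^sub>F n in sequentially. ?D n \<le> Lip (B + C) * (LINT x|\<mu>. \<bar>\<phi> n x - u x\<bar>)" by simp
    show "(\<lambda>n. Lip (B + C) * (LINT x|\<mu>. \<bar>\<phi> n x - u x\<bar>)) \<longlonglongrightarrow> 0"
      using tendsto_mult[OF tendsto_const minimizing_L1[OF min]] by simp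
  qed simp
  ultimately show ?thesis unfolding energy_def by (intro tendsto_add tendsto_mult tendsto_const)
qed

lemma minimizer_energy:
  assumes adm: "admissible A F G" and min: "minimizing A F G \<phi> u V"
  shows "energy A F G u V = min_energy A F G"
proof -
  have "(\<lambda>n. J A F G (\<phi> n)) \<longlonglongrightarrow> energy A F G u V"
    using minimizing_perturbed_energy[OF adm min test_zero, of 0] by simp
  then show ?thesis using minimizingD(3)[OF min] LIMSEQ_unique by blast
qed

lemma minimizer_perturbed_energy_ge:
  assumes adm: "admissible A F G" and min: "minimizing A F G \<phi> u V" and \<eta>: "\<eta> \<in> test"
  shows "min_energy A F G \<le> energy A F G (\<lambda>x. u x + t * \<eta> x) (\<lambda>x. V x + t *\<^sub>R grad \<eta> x)"
  by (rule LIMSEQ_le_const[OF minimizing_perturbed_energy[OF adm min \<eta>]])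
     (use min_energy_le[OF adm test_add[OF minimizingD(2)[OF min] test_scale[OF \<eta>]]] in blast)

lemma minimizer_powr_in_L2:
  assumes min: "minimizing A F G \<phi> u V" and c: "0 \<le> c"
  shows "(\<lambda>x. u x powr c) \<in> L2 \<Omega>"
proof (rule bounded_in_L2[of _ "B powr c"])
  show "(\<lambda>x. u x powr c) \<in> borel_measurable \<mu>" using L2_D(1)[OF minimizingD(4)[OF min]] by measurable
  show "norm (u x powr c) \<le> B powr c" for x using minimizingD(6,7)[OF min, of x] c by (auto intro: powr_mono2)
qed

text \<open>
  Minimality makes the difference quotients of the energy nonnegative from the right and nonpositive
  from the left, and both limits are the first variation. The potential is differentiable at \<open>u x\<close> for
  almost every \<open>x\<close> because \<open>u\<close> is positive there; its Lipschitz bound dominates the quotients.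
\<close>

lemma euler_lagrange_test:
  assumes adm: "admissible A F G" and min: "minimizing A F G \<phi> u V" and \<eta>: "\<eta> \<in> test"
  shows "A * (LINT x|\<mu>. V x \<bullet> grad \<eta> x) = F * (LINT x|\<mu>. u x powr \<alpha> * \<eta> x) - G * (LINT x|\<mu>. u x powr \<beta> * \<eta> x)"
proof -
  note uL = minimizingD(4)[OF min] and VL = minimizingD(5)[OF min]
  obtain C where C: "C > 0" "\<And>x. \<bar>\<eta> x\<bar> \<le> C" using test_bounded[OF \<eta>] by metis
  note [measurable] = L2_D(1)[OF uL] test_measurable[OF \<eta>]
  let ?W = "LINT x|\<mu>. V x \<bullet> grad \<eta> x"
  let ?N = "LINT x|\<mu>. (norm (grad \<eta> x))\<^sup>2"
  let ?P = "LINT x|\<mu>. (G * u x powr \<beta> - F * u x powr \<alpha>) * \<eta> x"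
  \<comment> \<open>The energy of \<open>u + t \<eta>\<close> above the minimum; its expansion in \<open>t\<close> starts with the first variation.\<close>
  define Q where "Q t = energy A F G (\<lambda>x. u x + t * \<eta> x) (\<lambda>x. V x + t *\<^sub>R grad \<eta> x) - min_energy A F G" for t
  have Q0: "0 \<le> Q t" for t using minimizer_perturbed_energy_ge[OF adm min \<eta>] by (simp add: Q_def)
  have b: "\<bar>u x\<bar> \<le> B + C" "\<bar>t\<bar> \<le> 1 \<Longrightarrow> \<bar>u x + t * \<eta> x\<bar> \<le> B + C" for x t
  proof -
    show "\<bar>u x\<bar> \<le> B + C" using minimizingD(6,7)[OF min, of x] C(1) by simp
    assume "\<bar>t\<bar> \<le> 1"
    then have "\<bar>t\<bar> * \<bar>\<eta> x\<bar> \<le> 1 * C" using C(2)[of x] by (intro mult_mono) auto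
    then have "\<bar>t * \<eta> x\<bar> \<le> C" by (simp add: abs_mult)
    then show "\<bar>u x + t * \<eta> x\<bar> \<le> B + C" using minimizingD(6,7)[OF min, of x] by linarith
  qed
  have pi: "integrable \<mu> (\<lambda>x. pot F G (u x))" "\<bar>t\<bar> \<le> 1 \<Longrightarrow> integrable \<mu> (\<lambda>x. pot F G (u x + t * \<eta> x))" for t
    by (rule pot_integrable[OF adm _ b(1)], measurable) (rule pot_integrable[OF adm _ b(2)], measurable)
  have Qdiv: "Q t / t = A * ?W + A / 2 * t * ?N + (LINT x|\<mu>. (pot F G (u x + t * \<eta> x) - pot F G (u x)) / t)"
    if t: "t \<noteq> 0" "\<bar>t\<bar> \<le> 1" for t
  proof -
    note i = L2_D(2)[OF VL] L2_inner_integrable[OF VL grad_test_in_L2[OF \<eta>]] grad_test_square_integrable[OF \<eta>]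
    have "(norm (V x + t *\<^sub>R grad \<eta> x))\<^sup>2 = (norm (V x))\<^sup>2 + (2 * t) * (V x \<bullet> grad \<eta> x) + t\<^sup>2 * (norm (grad \<eta> x))\<^sup>2" for x
      unfolding power2_norm_eq_inner by (simp add: inner_add_left inner_add_right inner_commute power2_eq_square)
    then have sq: "(LINT x|\<mu>. (norm (V x + t *\<^sub>R grad \<eta> x))\<^sup>2) = (LINT x|\<mu>. (norm (V x))\<^sup>2) + (2 * t) * ?W + t\<^sup>2 * ?N"
      using i by simp
    have "Q t = energy A F G (\<lambda>x. u x + t * \<eta> x) (\<lambda>x. V x + t *\<^sub>R grad \<eta> x) - energy A F G u V"
      unfolding Q_def minimizer_energy[OF adm min] by simp
    also have "\<dots> = A * t * ?W + A / 2 * t\<^sup>2 * ?N + ((LINT x|\<mu>. pot F G (u x + t * \<eta> x)) - (LINT x|\<mu>. pot F G (u x)))"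
      unfolding energy_def sq by (simp add: algebra_simps)
    also have "(LINT x|\<mu>. pot F G (u x + t * \<eta> x)) - (LINT x|\<mu>. pot F G (u x))
        = t * (LINT x|\<mu>. (pot F G (u x + t * \<eta> x) - pot F G (u x)) / t)"
      using pi t by simp
    finally show ?thesis using t by (simp add: field_simps power2_eq_square)
  qed
  have lim: "(\<lambda>n. Q (s n) / s n) \<longlonglongrightarrow> A * ?W + ?P"
    if s: "s \<longlonglongrightarrow> 0" "\<And>n. s n \<noteq> 0" "\<And>n. \<bar>s n\<bar> \<le> 1" for s :: "nat \<Rightarrow> real"
  proof -
    have "(\<lambda>n. LINT x|\<mu>. (pot F G (u x + s n * \<eta> x) - pot F G (u x)) / s n) \<longlonglongrightarrow> ?P"
    proof (rule integral_dominated_convergence[where w = "\<lambda>x. Lip (B + C) * \<bar>\<eta> x\<bar>"])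
      show "integrable \<mu> (\<lambda>x. Lip (B + C) * \<bar>\<eta> x\<bar>)" using L2_D(3)[OF test_in_L2[OF \<eta>]] by simp
      have "\<bar>pot F G (u x + s n * \<eta> x) - pot F G (u x)\<bar> \<le> Lip (B + C) * \<bar>s n * \<eta> x\<bar>" for n x
        using pot_lipschitz[OF adm b(2)[OF s(3)] b(1), of x n x] by simp
      then have "\<bar>pot F G (u x + s n * \<eta> x) - pot F G (u x)\<bar> / \<bar>s n\<bar> \<le> Lip (B + C) * \<bar>\<eta> x\<bar>" for n x
        using s(2)[of n] by (simp add: pos_divide_le_eq abs_mult mult_ac)
      then show "AE x in \<mu>. norm ((pot F G (u x + s n * \<eta> x) - pot F G (u x)) / s n) \<le> Lip (B + C) * \<bar>\<eta> x\<bar>" for n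
        by (simp add: abs_divide)
      show "AE x in \<mu>. (\<lambda>n. (pot F G (u x + s n * \<eta> x) - pot F G (u x)) / s n) \<longlonglongrightarrow> (G * u x powr \<beta> - F * u x powr \<alpha>) * \<eta> x"
        using minimizer_positive[OF adm min]
      proof eventually_elim
        case (elim x)
        have 1: "((\<lambda>t. u x + t * \<eta> x) has_real_derivative \<eta> x) (at 0)" by (auto intro!: derivative_eq_intros)
        have 2: "(pot F G has_real_derivative (G * u x powr \<beta> - F * u x powr \<alpha>)) (at (u x + 0 * \<eta> x))"
          using elim \<alpha> \<beta> by (auto intro!: potential_has_derivative)
        have "((\<lambda>t. pot F G (u x + t * \<eta> x)) has_real_derivative (G * u x powr \<beta> - F * u x powr \<alpha>) * \<eta> x) (at 0)"
          using DERIV_chain2[OF 2 1] by simp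
        then have "((\<lambda>t. (pot F G (u x + t * \<eta> x) - pot F G (u x)) / t) \<longlongrightarrow> (G * u x powr \<beta> - F * u x powr \<alpha>) * \<eta> x) (at 0)"
          by (simp add: DERIV_def)
        moreover have "filterlim s (at 0) sequentially" using s(1,2) by (auto simp: filterlim_at)
        ultimately show ?case by (rule filterlim_compose)
      qed
    qed measurable
    moreover have "(\<lambda>n. A / 2 * s n * ?N) \<longlonglongrightarrow> A / 2 * 0 * ?N" by (intro tendsto_intros s(1))
    ultimately have "(\<lambda>n. A * ?W + A / 2 * s n * ?N + (LINT x|\<mu>. (pot F G (u x + s n * \<eta> x) - pot F G (u x)) / s n))
        \<longlonglongrightarrow> A * ?W + A / 2 * 0 * ?N + ?P"
      by (intro tendsto_add tendsto_const)
    then show ?thesis using s by (simp add: Qdiv)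
  qed
  let ?s = "\<lambda>n. inverse (real (Suc n))"
  have s: "?s \<longlonglongrightarrow> 0" "0 < ?s n" "?s n \<le> 1" for n
    by (rule LIMSEQ_inverse_real_of_nat) (auto simp: field_simps)
  have "0 \<le> A * ?W + ?P"
  proof (rule LIMSEQ_le_const[OF lim[of ?s]])
    show "\<exists>N. \<forall>n\<ge>N. 0 \<le> Q (?s n) / ?s n" using Q0 s(2) by (auto intro!: divide_nonneg_pos)
  qed (use s in \<open>auto simp: less_imp_neq[THEN not_sym] abs_of_pos simp del: of_nat_Suc\<close>)
  moreover have "A * ?W + ?P \<le> 0"
  proof (rule LIMSEQ_le_const2[OF lim[of "\<lambda>n. - ?s n"]])
    show "\<exists>N. \<forall>n\<ge>N. Q (- ?s n) / - ?s n \<le> 0" using Q0 s(2) by (auto intro!: divide_nonneg_pos simp del: of_nat_Suc)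
  qed (use s tendsto_minus[OF s(1)] in \<open>auto simp: less_imp_neq[THEN not_sym] abs_of_pos simp del: of_nat_Suc\<close>)
  ultimately have "A * ?W = - ?P" by simp
  moreover have "?P = G * (LINT x|\<mu>. u x powr \<beta> * \<eta> x) - F * (LINT x|\<mu>. u x powr \<alpha> * \<eta> x)"
  proof -
    have i: "integrable \<mu> (\<lambda>x. u x powr c * \<eta> x)" if "0 \<le> c" for c
      using L2_inner_integrable[OF minimizer_powr_in_L2[OF min that] test_in_L2[OF \<eta>]] by simp
    have "?P = (LINT x|\<mu>. G * (u x powr \<beta> * \<eta> x) - F * (u x powr \<alpha> * \<eta> x))"
      by (simp add: left_diff_distrib mult.assoc)
    also have "\<dots> = G * (LINT x|\<mu>. u x powr \<beta> * \<eta> x) - F * (LINT x|\<mu>. u x powr \<alpha> * \<eta> x)"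
      using i \<alpha> \<beta> by simp
    finally show ?thesis .
  qed
  ultimately show ?thesis by simp
qed

lemma euler_lagrange_H10:
  assumes adm: "admissible A F G" and min: "minimizing A F G \<phi> u V" and \<psi>: "\<psi> \<in> H10 \<Omega>"
  shows "A * (LINT x|\<mu>. V x \<bullet> weak_gradient \<Omega> \<psi> x)
     = F * (LINT x|\<mu>. u x powr \<alpha> * \<psi> x) - G * (LINT x|\<mu>. u x powr \<beta> * \<psi> x)"
proof -
  note VL = minimizingD(5)[OF min]
  obtain \<eta> where \<eta>: "\<And>n. \<eta> n \<in> test" and \<psi>L: "\<psi> \<in> L2 \<Omega>" and wL: "weak_gradient \<Omega> \<psi> \<in> L2 \<Omega>"
    and conv: "(\<lambda>n. LINT x|\<mu>. (norm (\<eta> n x - \<psi> x))\<^sup>2) \<longlonglongrightarrow> 0"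
      "(\<lambda>n. LINT x|\<mu>. (norm (grad (\<eta> n) x - weak_gradient \<Omega> \<psi> x))\<^sup>2) \<longlonglongrightarrow> 0"
    using H10_approximation[OF \<psi>] by blast
  have l1: "(\<lambda>n. LINT x|\<mu>. V x \<bullet> grad (\<eta> n) x) \<longlonglongrightarrow> (LINT x|\<mu>. V x \<bullet> weak_gradient \<Omega> \<psi> x)"
    using L2_tendsto_inner[OF L2_D(1,2)[OF grad_test_in_L2[OF \<eta>]] L2_D(1,2)[OF wL] L2_D(1,2)[OF VL] conv(2)]
    by (simp add: inner_commute)
  have l2: "(\<lambda>n. LINT x|\<mu>. u x powr c * \<eta> n x) \<longlonglongrightarrow> (LINT x|\<mu>. u x powr c * \<psi> x)" if c: "0 \<le> c" for c
    using L2_tendsto_inner[OF L2_D(1,2)[OF test_in_L2[OF \<eta>]] L2_D(1,2)[OF \<psi>L] L2_D(1,2)[OF minimizer_powr_in_L2[OF min c]] conv(1)]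
    by (simp add: mult.commute)
  have "(\<lambda>n. A * (LINT x|\<mu>. V x \<bullet> grad (\<eta> n) x)) \<longlonglongrightarrow> A * (LINT x|\<mu>. V x \<bullet> weak_gradient \<Omega> \<psi> x)"
    by (intro tendsto_mult tendsto_const l1)
  moreover have "(\<lambda>n. A * (LINT x|\<mu>. V x \<bullet> grad (\<eta> n) x)) \<longlonglongrightarrow> F * (LINT x|\<mu>. u x powr \<alpha> * \<psi> x) - G * (LINT x|\<mu>. u x powr \<beta> * \<psi> x)"
    unfolding euler_lagrange_test[OF adm min \<eta>]
    by (intro tendsto_diff tendsto_mult tendsto_const l2) (use \<alpha> \<beta> in auto)
  ultimately show ?thesis by (rule LIMSEQ_unique)
qed

lemma minimizer_weak_solution:
  assumes adm: "admissible A F G" and min: "minimizing A F G \<phi> u V"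
    and a: "a (LINT x|\<mu>. \<bar>u x\<bar> powr q) = A" and f: "f (LINT x|\<mu>. \<bar>u x\<bar> powr p) = F"
    and g: "g (LINT x|\<mu>. \<bar>u x\<bar> powr r) = G"
  shows "weak_solution \<Omega> a f g p q r \<alpha> \<beta> u"
proof -
  note uL = minimizingD(4)[OF min] and VL = minimizingD(5)[OF min]
  note H = L2_limit_of_test_functions[OF minimizingD(2)[OF min] uL VL minimizingD(8,9)[OF min]]
  have ae: "AE x in \<mu>. weak_gradient \<Omega> u x = V x" by (rule weak_gradient_AE[OF H(1)])
  have wm: "weak_gradient \<Omega> w \<in> borel_measurable \<mu>" if "w \<in> H10 \<Omega>" for w
    using H10_approximation[OF that] L2_D(1) by metis
  have eq: "(LINT x|\<mu>. weak_gradient \<Omega> u x \<bullet> weak_gradient \<Omega> \<psi> x) = (LINT x|\<mu>. V x \<bullet> weak_gradient \<Omega> \<psi> x)"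
    if \<psi>: "\<psi> \<in> H10 \<Omega>" for \<psi>
  proof (rule integral_cong_AE)
    show "AE x in \<mu>. weak_gradient \<Omega> u x \<bullet> weak_gradient \<Omega> \<psi> x = V x \<bullet> weak_gradient \<Omega> \<psi> x"
      using ae by eventually_elim simp
  qed (use wm[OF \<psi>] wm[OF H(2)] L2_D(1)[OF VL] in measurable)
  have "u \<in> Linf \<Omega>"
    unfolding Linf_def using L2_D(1)[OF uL] minimizingD(6,7)[OF min] by (auto intro!: exI[of _ B])
  then show ?thesis
    unfolding weak_solution_def a f g
    using H(2) minimizer_positive[OF adm min] euler_lagrange_H10[OF adm min] by (simp add: eq)
qed

lemma minimizer_power_integral_bounds:
  assumes min: "minimizing A F G \<phi> u V" and s: "1 \<le> s"
  shows "0 \<le> (LINT x|\<mu>. \<bar>u x\<bar> powr s)" "(LINT x|\<mu>. \<bar>u x\<bar> powr s) \<le> B powr s * vol"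
proof -
  show "0 \<le> (LINT x|\<mu>. \<bar>u x\<bar> powr s)" by simp
  have b: "\<bar>u x\<bar> powr s \<le> B powr s" for x using minimizingD(6,7)[OF min, of x] s by (intro powr_mono2) auto
  have "(\<lambda>x. \<bar>u x\<bar> powr s) \<in> borel_measurable \<mu>" using L2_D(1)[OF minimizingD(4)[OF min]] by measurable
  then have "integrable \<mu> (\<lambda>x. \<bar>u x\<bar> powr s)" using b by (intro bounded_integrable[of _ "B powr s"]) auto
  then have "(LINT x|\<mu>. \<bar>u x\<bar> powr s) \<le> (LINT x|\<mu>. B powr s)" using b by (intro integral_mono) auto
  then show "(LINT x|\<mu>. \<bar>u x\<bar> powr s) \<le> B powr s * vol" by (simp only: integral_const_vol)
qed

lemma minimizer_power_integral_diff:
  assumes min: "minimizing A F G \<phi> u V" and min': "minimizing A' F' G' \<phi>' u' V'" and s: "1 \<le> s"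
  shows "\<bar>(LINT x|\<mu>. \<bar>u x\<bar> powr s) - (LINT x|\<mu>. \<bar>u' x\<bar> powr s)\<bar> \<le> s * B powr (s - 1) * (LINT x|\<mu>. \<bar>u x - u' x\<bar>)"
proof -
  have i: "integrable \<mu> (\<lambda>x. \<bar>w x\<bar> powr s)" if "w \<in> L2 \<Omega>" "\<And>x. 0 \<le> w x" "\<And>x. w x \<le> B" for w
  proof (rule bounded_integrable[of _ "B powr s"])
    show "(\<lambda>x. \<bar>w x\<bar> powr s) \<in> borel_measurable \<mu>" using L2_D(1)[OF that(1)] by measurable
    show "norm (\<bar>w x\<bar> powr s) \<le> B powr s" for x using that(2,3)[of x] s by (auto intro: powr_mono2)
  qed
  note iu = i[OF minimizingD(4)[OF min] minimizingD(6,7)[OF min]] and iu' = i[OF minimizingD(4)[OF min'] minimizingD(6,7)[OF min']]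
  have "\<bar>(LINT x|\<mu>. \<bar>u x\<bar> powr s) - (LINT x|\<mu>. \<bar>u' x\<bar> powr s)\<bar> = \<bar>LINT x|\<mu>. \<bar>u x\<bar> powr s - \<bar>u' x\<bar> powr s\<bar>"
    using iu iu' by simp
  also have "\<dots> \<le> (LINT x|\<mu>. \<bar>\<bar>u x\<bar> powr s - \<bar>u' x\<bar> powr s\<bar>)" by (rule integral_abs_bound)
  also have "\<dots> \<le> (LINT x|\<mu>. s * B powr (s - 1) * \<bar>u x - u' x\<bar>)"
  proof (rule integral_mono)
    show "\<bar>\<bar>u x\<bar> powr s - \<bar>u' x\<bar> powr s\<bar> \<le> s * B powr (s - 1) * \<bar>u x - u' x\<bar>" for x
      using minimizingD(6,7)[OF min, of x] minimizingD(6,7)[OF min', of x] s by (intro powr_lipschitz) auto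
    show "integrable \<mu> (\<lambda>x. s * B powr (s - 1) * \<bar>u x - u' x\<bar>)"
      using L2_D(3)[OF L2_diff[OF minimizingD(4)[OF min] minimizingD(4)[OF min']]] by simp
  qed (use iu iu' in auto)
  finally show ?thesis by simp
qed

end

section \<open>Solving the nonlocal problem by a fixed point in the space of coefficients\<close>

text \<open>
  A value above the essential bound would persist on an interval, which has positive measure.
\<close>

lemma Linf_continuous_bounded:
  fixes f :: "real \<Rightarrow> real"
  assumes cont: "continuous_on {0..} f" and "f \<in> Linf {0..}"
  obtains C where "\<And>t. t \<ge> 0 \<Longrightarrow> f t \<le> C"
proof -
  obtain C where "AE t in lebesgue_on {0..}. \<bar>f t\<bar> \<le> C" using assms(2) by (auto simp: Linf_def)
  then have ae: "AE t in lebesgue. 0 \<le> t \<longrightarrow> \<bar>f t\<bar> \<le> C" by (simp add: AE_restrict_space_iff)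
  have "f t \<le> C" if t: "t \<ge> 0" for t
  proof (rule ccontr)
    assume "\<not> f t \<le> C"
    then obtain d where d: "d > 0" "\<And>s. s \<ge> 0 \<Longrightarrow> dist s t < d \<Longrightarrow> dist (f s) (f t) < f t - C"
      using cont t unfolding continuous_on_iff by (metis atLeast_iff diff_gt_0_iff_gt not_le)
    have "AE s in lebesgue. s \<notin> {t<..<t + d}"
      using ae
    proof eventually_elim
      case (elim s)
      show ?case
      proof
        assume s: "s \<in> {t<..<t + d}"
        then have "dist (f s) (f t) < f t - C" using t by (intro d(2)) (auto simp: dist_real_def)
        moreover have "f s \<le> C" using elim s t by auto
        ultimately show False by (simp add: dist_real_def)
      qed
    qed
    then have "{t<..<t + d} \<in> null_sets lebesgue" by (subst AE_iff_null_sets) auto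
    then show False using d(1) by (simp add: null_sets_def)
  qed
  then show ?thesis by (rule that)
qed

theorem theorem4p2:
  fixes \<Omega> :: "'a::euclidean_space set"
    and a f g :: "real \<Rightarrow> real"
    and a\<^sub>0 p q r \<alpha> \<beta> :: real
  assumes "open \<Omega>" and "connected \<Omega>" and "\<Omega> \<noteq> {}" and "bounded \<Omega>" and "smooth_boundary \<Omega>"
    and "continuous_on {0..} a" and "continuous_on {0..} f" and "continuous_on {0..} g"
    and "f \<in> Linf {0..}" and "g \<in> Linf {0..}"
    and "a\<^sub>0 > 0"
    and "(INF t\<in>{0..}. ereal (a t)) \<ge> ereal a\<^sub>0"
    and "(INF t\<in>{0..}. ereal (f t)) \<ge> ereal a\<^sub>0"
    and "(INF t\<in>{0..}. ereal (g t)) \<ge> ereal a\<^sub>0"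
    and "p \<ge> 1" and "q \<ge> 1" and "r \<ge> 1" and "\<beta> \<ge> 1"
    and "0 \<le> \<alpha>" and "\<alpha> < 1"
  shows "\<exists>u. weak_solution \<Omega> a f g p q r \<alpha> \<beta> u"
proof -
  have low: "a\<^sub>0 \<le> h t" if "(INF t\<in>{0..}. ereal (h t)) \<ge> ereal a\<^sub>0" "t \<ge> 0" for h :: "real \<Rightarrow> real" and t
    using that by (auto simp: le_INF_iff)
  obtain Cf where Cf: "\<And>t. t \<ge> 0 \<Longrightarrow> f t \<le> Cf" using Linf_continuous_bounded[OF assms(7,9)] by blast
  obtain Cg where Cg: "\<And>t. t \<ge> 0 \<Longrightarrow> g t \<le> Cg" using Linf_continuous_bounded[OF assms(8,10)] by blast
  define \<Lambda> where "\<Lambda> = max a\<^sub>0 (max Cf Cg)"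
  \<comment> \<open>Beyond this \<open>M\<close> the absorption dominates the source, whatever values \<open>f\<close> and \<open>g\<close> take.\<close>
  define M where "M = max 1 ((\<Lambda> / a\<^sub>0) powr (1 / (1 - \<alpha>)))"
  have \<Lambda>: "a\<^sub>0 \<le> \<Lambda>" "Cf \<le> \<Lambda>" "Cg \<le> \<Lambda>" by (auto simp: \<Lambda>_def)
  have M: "1 \<le> M" "\<Lambda> \<le> a\<^sub>0 * M powr (1 - \<alpha>)"
  proof -
    show "1 \<le> M" by (simp add: M_def)
    have pos: "0 < \<Lambda> / a\<^sub>0" using \<Lambda>(1) assms(11) by simp
    have "1 / (1 - \<alpha>) * (1 - \<alpha>) = 1" using assms(20) by simp
    then have "\<Lambda> / a\<^sub>0 = ((\<Lambda> / a\<^sub>0) powr (1 / (1 - \<alpha>))) powr (1 - \<alpha>)"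
      unfolding powr_powr using pos by (simp only: powr_one less_imp_le)
    also have "\<dots> \<le> M powr (1 - \<alpha>)" unfolding M_def using assms(20) by (intro powr_mono2) auto
    finally show "\<Lambda> \<le> a\<^sub>0 * M powr (1 - \<alpha>)" using assms(11) by (simp add: pos_divide_le_eq mult.commute)
  qed
  interpret frozen_problem \<Omega> \<alpha> \<beta> a\<^sub>0 \<Lambda> M
    by unfold_locales (use assms \<Lambda> M in auto)
  obtain \<Phi> U W where min: "\<And>A F G. admissible A F G \<Longrightarrow> minimizing A F G (\<Phi> A F G) (U A F G) (W A F G)"
    using minimizer_exists by metis
  define N where "N s = (\<lambda>(A, F, G). LINT x|\<mu>. \<bar>U A F G x\<bar> powr s)" for s
  \<comment> \<open>Only now is \<open>a\<close> bounded: on the range of the integral of \<open>u\<^sup>q\<close>, which is known since \<open>u \<le> B\<close>.\<close>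
  have "compact (a ` {0..B powr q * vol})"
    by (intro compact_continuous_image continuous_on_subset[OF assms(6)]) auto
  then obtain Ca where Ca: "\<And>t. t \<in> {0..B powr q * vol} \<Longrightarrow> \<bar>a t\<bar> \<le> Ca"
    using compact_imp_bounded bounded_iff by (metis imageI real_norm_def)
  define K where "K = {a\<^sub>0..max a\<^sub>0 Ca} \<times> ({a\<^sub>0..\<Lambda>} \<times> {a\<^sub>0..\<Lambda>})"
  have admK: "admissible A F G" if "(A, F, G) \<in> K" for A F G
    using that by (auto simp: K_def admissible_def)
  have N_bounds: "0 \<le> N s k" "N s k \<le> B powr s * vol" if "k \<in> K" "1 \<le> s" for s k
    using that minimizer_power_integral_bounds[OF min[OF admK] that(2)] by (cases k; auto simp: N_def)+
  have N_cont: "continuous_on K (N s)" if s: "1 \<le> s" for s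
    unfolding continuous_on_iff
  proof (intro ballI allI impI)
    fix k :: "real \<times> real \<times> real" and \<epsilon> :: real assume k: "k \<in> K" and \<epsilon>: "0 < \<epsilon>"
    define L where "L = s * B powr (s - 1)"
    have L: "0 < L" using s B_ge by (simp add: L_def)
    have e2: "0 < \<epsilon> / (2 * L)" using L \<epsilon> by simp
    obtain \<delta> where \<delta>: "\<delta> > 0" "\<And>A F G A' F' G' \<phi> \<phi>' u u' V V'. admissible A F G \<Longrightarrow> admissible A' F' G' \<Longrightarrow>
      minimizing A F G \<phi> u V \<Longrightarrow> minimizing A' F' G' \<phi>' u' V' \<Longrightarrow>
      \<bar>A - A'\<bar> + \<bar>F - F'\<bar> + \<bar>G - G'\<bar> \<le> \<delta> \<Longrightarrow> (LINT x|\<mu>. \<bar>u x - u' x\<bar>) \<le> \<epsilon> / (2 * L)"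
      using minimizers_depend_continuously[OF e2] by blast
    show "\<exists>d>0. \<forall>k'\<in>K. dist k' k < d \<longrightarrow> dist (N s k') (N s k) < \<epsilon>"
    proof (intro exI[of _ "\<delta> / 3"] conjI ballI impI)
      fix k' assume k': "k' \<in> K" and d: "dist k' k < \<delta> / 3"
      obtain A F G where l: "k = (A, F, G)" by (cases k)
      obtain A' F' G' where l': "k' = (A', F', G')" by (cases k')
      note ad = admK[OF k[unfolded l]] and ad' = admK[OF k'[unfolded l']]
      have "\<bar>A' - A\<bar> \<le> dist k' k" "\<bar>F' - F\<bar> \<le> dist k' k" "\<bar>G' - G\<bar> \<le> dist k' k"
        using dist_fst_le[of k' k] dist_snd_le[of k' k] dist_fst_le[of "snd k'" "snd k"] dist_snd_le[of "snd k'" "snd k"]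
        by (simp_all add: l l' dist_real_def)
      then have "\<bar>A' - A\<bar> + \<bar>F' - F\<bar> + \<bar>G' - G\<bar> \<le> \<delta>" using d by linarith
      then have c: "(LINT x|\<mu>. \<bar>U A' F' G' x - U A F G x\<bar>) \<le> \<epsilon> / (2 * L)"
        by (rule \<delta>(2)[OF ad' ad min[OF ad'] min[OF ad]])
      have "dist (N s k') (N s k) \<le> L * (LINT x|\<mu>. \<bar>U A' F' G' x - U A F G x\<bar>)"
        using minimizer_power_integral_diff[OF min[OF ad'] min[OF ad] s] by (simp add: N_def l l' dist_real_def L_def)
      also have "\<dots> \<le> L * (\<epsilon> / (2 * L))" using c L by (intro mult_left_mono) auto
      also have "\<dots> < \<epsilon>" using L \<epsilon> by simp
      finally show "dist (N s k') (N s k) < \<epsilon>" .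
    qed (use \<delta>(1) in simp)
  qed
  \<comment> \<open>A fixed point of \<open>T\<close> is a triple of coefficients reproduced by its own minimizer.\<close>
  define T where "T k = (a (N q k), f (N p k), g (N r k))" for k
  have T_cont: "continuous_on K T"
    unfolding T_def
    by (intro continuous_on_Pair continuous_on_compose2[OF assms(6) N_cont] continuous_on_compose2[OF assms(7) N_cont]
        continuous_on_compose2[OF assms(8) N_cont]) (use N_bounds assms(15-17) in auto)
  have T_K: "T \<in> K \<rightarrow> K"
  proof
    fix k assume k: "k \<in> K"
    note b = N_bounds[OF k assms(15)] N_bounds[OF k assms(16)] N_bounds[OF k assms(17)]
    show "T k \<in> K"
      using low[OF assms(12) b(3)] low[OF assms(13) b(1)] low[OF assms(14) b(5)] Ca[of "N q k"] b Cf[OF b(1)] Cg[OF b(5)] \<Lambda>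
      by (auto simp: T_def K_def)
  qed
  have "compact K" "convex K" "K \<noteq> {}"
    unfolding K_def using \<Lambda>(1) by (auto intro!: compact_Times convex_Times)
  then obtain k where k: "k \<in> K" "T k = k"
    using brouwer[OF _ _ _ T_cont T_K] by blast
  obtain A F G where l: "k = (A, F, G)" by (cases k)
  have ad: "admissible A F G" using admK k(1) l by blast
  have "weak_solution \<Omega> a f g p q r \<alpha> \<beta> (U A F G)"
    by (rule minimizer_weak_solution[OF ad min[OF ad]]) (use k(2) in \<open>auto simp: T_def N_def l\<close>)
  then show ?thesis by blast
qed

end
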